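(* For all integers $r$ and $k$ with $k\geq 2r+2\geq 8$, there exists $N_{r,k}$ such that for every integer $n>N_{r,k}$, $$\mathrm{ex}^{conn}_r(n,\textup{Berge-}P_k)=\binom{\lfloor k/2\rfloor-1}{r-1}\left(n-\lceil k/2\rceil\right)+\binom{\lceil k/2\rceil}{r}.$$
   Context: An $r$-graph is a hypergraph all of whose hyperedges are $r$-element subsets of the vertex set. $P_k$ denotes the path on $k$ vertices. For a graph $F$, an $r$-graph $\mathcal{H}$ is a Berge-$F$ if there is a bijection $\phi:E(F)\to E(\mathcal{H})$ with $e\subseteq\phi(e)$ for every $e\in E(F)$; $\mathcal{H}$ is Berge-$F$-free if it contains no subhypergraph that is a Berge-$F$. A hypergraph is connected if its vertex set cannot be partitioned into two nonempty parts such that no hyperedge meets both parts. $\mathrm{ex}^{conn}_r(n,\textup{Berge-}P_k)$ denotes the maximum number of hyperedges in a connected $n$-vertex $r$-graph that is Berge-$P_k$-free. *)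

theory Defs
  imports Complex_Main
begin

text \<open>A finite hypergraph is a pair of a vertex set and a set of hyperedges; a graph is a
  2-uniform one. Isolated vertices are allowed, and there are no multiple hyperedges.\<close>

type_synonym 'a hypergraph = "'a set \<times> 'a set set"

abbreviation verts :: "'a hypergraph \<Rightarrow> 'a set" where
  "verts H \<equiv> fst H"

abbreviation hedges :: "'a hypergraph \<Rightarrow> 'a set set" where
  "hedges H \<equiv> snd H"

definition hypergraph :: "'a hypergraph \<Rightarrow> bool" where
  "hypergraph H \<longleftrightarrow> finite (verts H) \<and> (\<forall>e \<in> hedges H. e \<subseteq> verts H)"

definition r_graph :: "nat \<Rightarrow> 'a hypergraph \<Rightarrow> bool" where
  "r_graph r H \<longleftrightarrow> hypergraph H \<and> (\<forall>e \<in> hedges H. card e = r)"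

definition subhypergraph :: "'a hypergraph \<Rightarrow> 'a hypergraph \<Rightarrow> bool" where
  "subhypergraph H' H \<longleftrightarrow>
     hypergraph H' \<and> verts H' \<subseteq> verts H \<and> hedges H' \<subseteq> hedges H"

definition path_graph :: "nat \<Rightarrow> nat hypergraph" where
  "path_graph k = ({..<k}, {{i, Suc i} | i. Suc i < k})"

text \<open>The injection \<open>f\<close> places a copy of \<open>F\<close> on the vertices of \<open>H\<close>: usually \<open>F\<close> is
  identified with this copy and the condition reads \<open>e \<subseteq> \<phi> e\<close>.\<close>

definition is_Berge :: "'b hypergraph \<Rightarrow> 'a hypergraph \<Rightarrow> bool" where
  "is_Berge F H \<longleftrightarrow>
     (\<exists>f \<phi>. inj_on f (verts F) \<and> f ` verts F \<subseteq> verts H \<and>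
        bij_betw \<phi> (hedges F) (hedges H) \<and> (\<forall>e \<in> hedges F. f ` e \<subseteq> \<phi> e))"

definition Berge_free :: "'b hypergraph \<Rightarrow> 'a hypergraph \<Rightarrow> bool" where
  "Berge_free F H \<longleftrightarrow> \<not> (\<exists>H'. subhypergraph H' H \<and> is_Berge F H')"

definition connected_hypergraph :: "'a hypergraph \<Rightarrow> bool" where
  "connected_hypergraph H \<longleftrightarrow>
     \<not> (\<exists>A B. A \<noteq> {} \<and> B \<noteq> {} \<and> A \<inter> B = {} \<and> A \<union> B = verts H \<and>
           (\<forall>e \<in> hedges H. e \<inter> A = {} \<or> e \<inter> B = {}))"

text \<open>Every finite hypergraph has an isomorphic copy on natural numbers. The set below is
  finite, its elements being at most \<open>n choose r\<close>; \<open>Max\<close> is unspecified when it is empty.\<close>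

definition ex_conn :: "nat \<Rightarrow> nat \<Rightarrow> 'b hypergraph \<Rightarrow> nat" where
  "ex_conn r n F = Max {card (hedges H) | H :: nat hypergraph.
     r_graph r H \<and> card (verts H) = n \<and> connected_hypergraph H \<and> Berge_free F H}"

end

theory Submission
  imports Defs
begin

text \<open>Put \<open>s = k div 2 - 1\<close>, so that \<open>k\<close> is \<open>2 * s + 2\<close> or \<open>2 * s + 3\<close>, and \<open>K = s choose (r - 1)\<close>.
  The upper bound is a progressive induction on the number \<open>card E - K * card V\<close>. A large connected
  hypergraph without long Berge paths has a bounded set \<open>P\<close> of vertices whose removal leaves many small
  components. By the pigeonhole principle many of these attach to \<open>P\<close> in the same way (they are clones),
  and a Berge path can use a fresh clone between any two hubs, the vertices of \<open>P\<close> adjacent to the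
  clones. With \<open>h\<close> hubs this yields about \<open>2 * h + 1\<close> vertices and, if paths can continue inside the
  clones, correspondingly more; hence few ancestors (hubs and vertices of the clone) are available to
  each vertex in a depth-first search of a clone, and a clone \<open>W\<close> carries at most \<open>K * card W\<close> edges.
  If the inequality is strict, deleting the clone increases \<open>card E - K * card V\<close>; iterating this
  would end in a small hypergraph with more edges than possible. If equality holds
  for all clones, they are single vertices joined completely to a set \<open>A\<close> of \<open>s\<close> hubs. Then Berge paths run
  through all of \<open>A\<close>, and the same counting in the components of \<open>V - A\<close> gives the exact bound; for odd \<open>k\<close>
  a single component may contribute up to \<open>s choose (r - 2)\<close> additional edges.\<close>

section \<open>Berge paths\<close>

text \<open>The arithmetic behind the bound: suppose an inner vertex of a clone fits between any two
  of \<open>h\<close> hubs, and both ends of the path can be prolonged by \<open>L\<close> vertices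
  of further clones. Then a Berge path has \<open>2 * L + 2 * h - 1\<close> vertices, at most
  \<open>2 * s + 2\<close> for either parity of \<open>k\<close>, so
  \<open>h + L \<le> s + 1\<close>. In a depth-first search from a hub, a vertex has at most
  \<open>L - 1\<close> ancestors in the clone, hence with the hubs at most \<open>s\<close> vertices
  to form edges with; this gives \<open>s choose (r - 1)\<close> edges per vertex. The obstacle
  peculiar to Berge paths is that two hubs may share their only edge of the clone, and then no inner
  vertex fits between them. Edges through a hub that lies in no other edge of the clone are
  therefore set aside; if there are \<open>t\<close> of them, the others are counted with
  \<open>s - t\<close> in place of \<open>s\<close>, and this saves more than it costs. Deleting
  clones rather than vertices of small degree keeps the hypergraph connected, because a walk through
  a deleted clone can be rerouted through another clone with the same hubs.\<close>

fun berge_walk :: "'a list \<Rightarrow> 'a set list \<Rightarrow> bool" where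
  "berge_walk [x] [] = True"
| "berge_walk (x # y # xs) (e # es) = (x \<in> e \<and> y \<in> e \<and> berge_walk (y # xs) es)"
| "berge_walk _ _ = False"

text \<open>Vertices and edges form two separate lists, so that repetition of edges is a condition
  on \<open>es\<close> alone. A single vertex with \<open>es = []\<close> is a path for every
  \<open>E\<close>, whether or not an edge covers it.\<close>

definition bpath :: "'a set set \<Rightarrow> 'a list \<Rightarrow> 'a set list \<Rightarrow> bool" where
  "bpath E xs es \<longleftrightarrow> berge_walk xs es \<and> distinct xs \<and> distinct es \<and> set es \<subseteq> E"

lemma berge_walk_length: "berge_walk xs es \<Longrightarrow> length xs = Suc (length es)"
  by (induction xs es rule: berge_walk.induct) auto

lemma berge_walk_append:
  "berge_walk (xs @ [a]) es \<Longrightarrow> berge_walk (a # ys) fs \<Longrightarrow> berge_walk (xs @ a # ys) (es @ fs)"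
proof (induction xs arbitrary: es)
  case Nil
  then have "es = []" using berge_walk_length by fastforce
  then show ?case using Nil by simp
next
  case (Cons x xs)
  from Cons.prems(1) obtain e es' where es: "es = e # es'"
    by (cases es; cases xs) auto
  show ?case using Cons es by (cases xs) auto
qed

lemma berge_walk_snoc:
  "berge_walk (xs @ [a]) es \<Longrightarrow> a \<in> e \<Longrightarrow> z \<in> e \<Longrightarrow> berge_walk (xs @ [a, z]) (es @ [e])"
  using berge_walk_append[of xs a es "[z]" "[e]"] by simp

lemma berge_walk_rev: "berge_walk xs es \<Longrightarrow> berge_walk (rev xs) (rev es)"
proof (induction xs es rule: berge_walk.induct)
  case (2 x y xs e es)
  then have "berge_walk (rev xs @ [y]) (rev es)" by simp
  from berge_walk_snoc[OF this, of e x] 2 show ?case by simp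
qed auto

lemma berge_walk_take:
  "berge_walk xs es \<Longrightarrow> i \<le> length es \<Longrightarrow> berge_walk (take (Suc i) xs) (take i es)"
proof (induction xs es arbitrary: i rule: berge_walk.induct)
  case (2 x y xs e es)
  then show ?case by (cases i) auto
qed auto

lemma berge_walk_nth:
  "berge_walk xs es \<Longrightarrow> i < length es \<Longrightarrow> xs ! i \<in> es ! i \<and> xs ! Suc i \<in> es ! i"
proof (induction xs es arbitrary: i rule: berge_walk.induct)
  case (2 x y xs e es)
  then show ?case by (cases i) auto
qed auto

lemma bpath_mono: "bpath E xs es \<Longrightarrow> E \<subseteq> E' \<Longrightarrow> bpath E' xs es"
  by (auto simp: bpath_def)

lemma bpath_rev: "bpath E xs es \<Longrightarrow> bpath E (rev xs) (rev es)"
  by (auto simp: bpath_def berge_walk_rev)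

lemma bpath_take: "bpath E xs es \<Longrightarrow> i \<le> length es \<Longrightarrow> bpath E (take (Suc i) xs) (take i es)"
  unfolding bpath_def using berge_walk_take set_take_subset[of i es]
  by (metis distinct_take subset_trans)

lemma bpath_length: "bpath E xs es \<Longrightarrow> length xs = Suc (length es)"
  by (simp add: bpath_def berge_walk_length)

text \<open>An edge joins two consecutive vertices, and the later of them is never the start. Thus
  each edge of an end path that leaves the core contains a vertex outside the core, by which it can
  be told from the edges elsewhere.\<close>

lemma bpath_edge_meets:
  assumes "bpath E (a # xs) es" "e \<in> set es"
  shows "e \<inter> set xs \<noteq> {}"
proof -
  obtain i where i: "i < length es" "es ! i = e" using assms(2) by (metis in_set_conv_nth)
  have "(a # xs) ! Suc i \<in> es ! i"
    using berge_walk_nth[of "a # xs" es i] assms(1) i by (auto simp: bpath_def)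
  moreover have "i < length xs" using bpath_length[OF assms(1)] i by simp
  ultimately show ?thesis using i by auto
qed

lemma bpath_join:
  assumes "bpath E (xs @ [a]) es" "bpath E (a # ys) fs"
    and "set xs \<inter> set ys = {}" "set es \<inter> set fs = {}"
  shows "bpath E (xs @ a # ys) (es @ fs)"
  using assms by (auto simp: bpath_def intro: berge_walk_append)

text \<open>If the new edge already occurs on the path, the path is cut at its first use. The first edge
  survives either way.\<close>

lemma bpath_extend:
  assumes p: "bpath E (p # xs) es" "es \<noteq> []" and g: "g \<in> E" "last (p # xs) \<in> g" "z \<in> g"
    and z: "z \<notin> set (p # xs)"
  obtains xs' es' where "bpath E (p # xs' @ [z]) (es' @ [g])" "set xs' \<subseteq> set xs"
    "hd (es' @ [g]) = hd es"
proof (cases "g \<in> set es")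
  case False
  have "berge_walk (butlast (p # xs) @ [last (p # xs)]) es"
    using p by (simp add: bpath_def del: butlast.simps last.simps)
  from berge_walk_snoc[OF this g(2,3)]
  have "berge_walk (butlast (p # xs) @ [last (p # xs)] @ [z]) (es @ [g])"
    by (simp del: butlast.simps last.simps)
  then have "berge_walk (p # xs @ [z]) (es @ [g])"
    unfolding append_assoc[symmetric] append_butlast_last_id[OF list.distinct(2)] by simp
  then have "bpath E (p # xs @ [z]) (es @ [g])"
    using p g z False by (auto simp: bpath_def)
  then show ?thesis using that[of xs es] p by simp
next
  case True
  then obtain i where i: "i < length es" "es ! i = g" by (metis in_set_conv_nth)
  have b: "bpath E (take (Suc i) (p # xs)) (take i es)"
    using bpath_take[OF p(1), of i] i by simp
  have l: "take (Suc i) (p # xs) = take i (p # xs) @ [(p # xs) ! i]"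
    using i bpath_length[OF p(1)] by (intro take_Suc_conv_app_nth) simp
  have gi: "(p # xs) ! i \<in> g"
    using berge_walk_nth[of "p # xs" es i] p i by (auto simp: bpath_def)
  have "berge_walk (take i (p # xs) @ [(p # xs) ! i, z]) (take i es @ [g])"
    using berge_walk_snoc b gi g(3) unfolding bpath_def l by metis
  moreover have "take i (p # xs) @ [(p # xs) ! i, z] = p # take i xs @ [z]"
    using l by (metis append.assoc append_Cons append_Nil take_Suc_Cons)
  ultimately have w: "berge_walk (p # take i xs @ [z]) (take i es @ [g])" by simp
  have d: "distinct (take i es @ [g])"
    using p i take_Suc_conv_app_nth[of i es] distinct_take[of es "Suc i"] by (simp add: bpath_def)
  have "bpath E (p # take i xs @ [z]) (take i es @ [g])"
    unfolding bpath_def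
  proof (intro conjI)
    show "distinct (p # take i xs @ [z])"
      using p z by (auto simp: bpath_def dest: in_set_takeD)
    show "set (take i es @ [g]) \<subseteq> E" using p g by (auto simp: bpath_def dest: in_set_takeD)
  qed (use w d in auto)
  moreover have "hd (take i es @ [g]) = hd es"
    using i p(2) by (cases i; cases es) auto
  ultimately show ?thesis using that[of "take i xs" "take i es"] by (auto dest: in_set_takeD)
qed

text \<open>This is the 2-shadow induced on \<open>W\<close>: both vertices must lie in
  \<open>W\<close>, but the edge witnessing their adjacency may leave \<open>W\<close>, for instance
  through hubs.\<close>

definition adj :: "'a set set \<Rightarrow> 'a set \<Rightarrow> ('a \<times> 'a) set" where
  "adj E W = {(x, y). x \<in> W \<and> y \<in> W \<and> (\<exists>e\<in>E. x \<in> e \<and> y \<in> e)}"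

lemma adjI: "x \<in> W \<Longrightarrow> y \<in> W \<Longrightarrow> e \<in> E \<Longrightarrow> x \<in> e \<Longrightarrow> y \<in> e \<Longrightarrow> (x, y) \<in> adj E W"
  by (auto simp: adj_def)

lemma sym_adj: "sym (adj E W)"
  by (auto simp: adj_def sym_def)

lemma adj_rtrancl_sym: "(x, y) \<in> (adj E W)\<^sup>* \<Longrightarrow> (y, x) \<in> (adj E W)\<^sup>*"
  by (meson sym_adj sym_rtrancl symD)

lemma adj_rtrancl_mem: "(x, y) \<in> (adj E W)\<^sup>* \<Longrightarrow> x \<in> W \<Longrightarrow> y \<in> W"
  by (induction rule: rtrancl_induct) (auto simp: adj_def)

text \<open>\<open>V\<close> need not be connected; every component of its shadow has to be met by
  an edge through \<open>a\<close>. Unlike connectedness of \<open>V\<close>, this is inherited by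
  both parts into which the search splits \<open>V\<close>.\<close>

definition attached :: "'a set set \<Rightarrow> 'a set \<Rightarrow> 'a \<Rightarrow> bool" where
  "attached E V a \<longleftrightarrow>
     (\<forall>x\<in>V. \<exists>y\<in>V. (x, y) \<in> (adj E V)\<^sup>* \<and> (\<exists>e\<in>E. a \<in> e \<and> y \<in> e))"

text \<open>The edges are distributed over the vertices along a depth-first search tree with root \<open>a\<close>: the
  vertex \<open>w\<close>, entered through the edge \<open>e\<close>, is charged for \<open>e\<close> and for the edges meeting \<open>V\<close> only in \<open>w\<close> and its
  ancestors \<open>ys\<close>. The first conjunct allows the first tree edge to be chosen freely.\<close>

lemma search_tree_count:
  assumes "finite V" "finite E0" "E0 \<subseteq> E" "\<And>g. g \<in> E0 \<Longrightarrow> g \<inter> V \<noteq> {}" "a \<notin> V" "attached E V a"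
    and "\<And>ys w es e. bpath E (a # ys @ [w]) (es @ [e]) \<Longrightarrow> set ys \<subseteq> V \<Longrightarrow> w \<in> V \<Longrightarrow>
      card ({g \<in> E0 - set es. w \<in> g \<and> g \<inter> V \<subseteq> insert w (set ys)} \<union> ({e} \<inter> E0)) \<le> K"
  shows "(\<forall>e w. e \<in> E \<longrightarrow> a \<in> e \<longrightarrow> w \<in> e \<longrightarrow> w \<in> V \<longrightarrow>
            card E0 \<le> card ({g \<in> E0. g \<inter> V = {w}} \<union> ({e} \<inter> E0)) + K * (card V - 1)) \<and>
         card E0 \<le> K * card V"
  using assms
proof (induction "card V" arbitrary: V E E0 a rule: less_induct)
  case less
  note fin = less.prems(1,2) and sub = less.prems(3) and touch = less.prems(4)
    and aV = less.prems(5) and att = less.prems(6) and pay = less.prems(7)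
  have first: "card E0 \<le> card ({g \<in> E0. g \<inter> V = {w}} \<union> ({e} \<inter> E0)) + K * (card V - 1)"
    if e: "e \<in> E" "a \<in> e" and w: "w \<in> e" "w \<in> V" for e w
  proof -
    \<comment> \<open>\<open>V1\<close> is the subtree below \<open>w\<close>: what can be reached
      from \<open>w\<close> without \<open>e\<close> and without returning to \<open>a\<close>. The
      search continues there with root \<open>w\<close>, and in the rest \<open>V2\<close> with root
      \<open>a\<close>.\<close>
    define R where "R = (adj (E - {e}) (V - {w}))\<^sup>*"
    define V1 where "V1 = {x \<in> V - {w}. \<exists>y\<in>V - {w}. (x, y) \<in> R \<and> (\<exists>g\<in>E - {e}. w \<in> g \<and> y \<in> g)}"
    define V2 where "V2 = V - {w} - V1"
    define F1 where "F1 = {g \<in> E0 - {e}. g \<inter> V1 \<noteq> {}}"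
    define F2 where "F2 = {g \<in> E0 - {e}. g \<inter> V1 = {} \<and> g \<inter> V2 \<noteq> {}}"
    define F0 where "F0 = {g \<in> E0. g \<inter> V = {w}} \<union> ({e} \<inter> E0)"
    have closed1: "y \<in> V1" if h: "x \<in> V1" "x \<in> g" "y \<in> g" "g \<in> E - {e}" "y \<in> V - {w}" for x y g
    proof -
      obtain u g' where u: "u \<in> V - {w}" "(x, u) \<in> R" "g' \<in> E - {e}" "w \<in> g'" "u \<in> g'"
        using h(1) by (auto simp: V1_def)
      have "(y, x) \<in> adj (E - {e}) (V - {w})" using that by (auto simp: V1_def intro!: adjI)
      then have "(y, u) \<in> R" using u(2) unfolding R_def by (rule converse_rtrancl_into_rtrancl)
      then show ?thesis using u that(5) by (auto simp: V1_def)
    qed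
    have wV1: "y \<in> V1" if "w \<in> g" "y \<in> g" "g \<in> E - {e}" "y \<in> V - {w}" for y g
      using that by (auto simp: V1_def R_def)
    have F1V: "g \<inter> V \<subseteq> insert w V1" if "g \<in> F1" for g
    proof
      fix y assume y: "y \<in> g \<inter> V"
      obtain x where "x \<in> V1" "x \<in> g" using \<open>g \<in> F1\<close> by (auto simp: F1_def)
      then show "y \<in> insert w V1"
        using closed1[of x g y] y \<open>g \<in> F1\<close> sub by (auto simp: F1_def)
    qed
    have F2V: "g \<inter> V \<subseteq> V2" if g: "g \<in> F2" for g
    proof -
      obtain x where x: "x \<in> V2" "x \<in> g" using g by (auto simp: F2_def)
      have "w \<notin> g" using wV1[of g x] x g sub by (auto simp: F2_def V2_def)
      then show ?thesis using g by (auto simp: F2_def V2_def)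
    qed
    have Vsplit: "V = insert w (V1 \<union> V2)" "w \<notin> V1" "w \<notin> V2" "V1 \<inter> V2 = {}"
      using w by (auto simp: V1_def V2_def)
    have finV: "finite V1" "finite V2" using fin Vsplit(1) by (metis finite_Un finite_insert)+
    have cV: "card V = Suc (card V1 + card V2)"
      using Vsplit finV by (simp add: card_Un_disjoint)
    have E0s: "E0 \<subseteq> F0 \<union> F1 \<union> F2"
    proof
      fix g assume g: "g \<in> E0"
      have "g \<inter> V \<noteq> {}" using touch g .
      then show "g \<in> F0 \<union> F1 \<union> F2"
        using g Vsplit(1) unfolding F0_def F1_def F2_def by blast
    qed
    have c1: "card F1 \<le> K * card V1"
    proof -
      \<comment> \<open>Since \<open>e\<close> is withdrawn from the edges available below
        \<open>w\<close>, each path from \<open>w\<close> found there can be prefixed by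
        \<open>a\<close> and \<open>e\<close>. This turns the hypothesis for the root
        \<open>a\<close> into the one for the root \<open>w\<close>.\<close>
      have att1: "attached (E - {e}) V1 w"
        unfolding attached_def
      proof
        fix x assume "x \<in> V1"
        then obtain u where u: "u \<in> V - {w}" "(x, u) \<in> R" "\<exists>g\<in>E - {e}. w \<in> g \<and> u \<in> g"
          by (auto simp: V1_def)
        have "u' \<in> V1 \<and> (x, u') \<in> (adj (E - {e}) V1)\<^sup>*" if "(x, u') \<in> R" for u'
          using that unfolding R_def
        proof (induction rule: rtrancl_induct)
          case base show ?case using \<open>x \<in> V1\<close> by simp
        next
          case (step y z)
          then obtain g where g: "g \<in> E - {e}" "y \<in> g" "z \<in> g" "z \<in> V - {w}"
            by (auto simp: adj_def)
          have "z \<in> V1" using closed1 step g by blast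
          then show ?case using step g by (meson adjI rtrancl.rtrancl_into_rtrancl)
        qed
        then show "\<exists>y\<in>V1. (x, y) \<in> (adj (E - {e}) V1)\<^sup>* \<and> (\<exists>e\<in>E - {e}. w \<in> e \<and> y \<in> e)"
          using u by blast
      qed
      have pay1: "card ({g \<in> F1 - set es. w' \<in> g \<and> g \<inter> V1 \<subseteq> insert w' (set ys)} \<union> ({e'} \<inter> F1)) \<le> K"
        if b: "bpath (E - {e}) (w # ys @ [w']) (es @ [e'])" "set ys \<subseteq> V1" "w' \<in> V1" for ys w' es e'
      proof -
        have "bpath E (a # (w # ys) @ [w']) ((e # es) @ [e'])"
          using b e w aV Vsplit(1) by (auto simp: bpath_def)
        then have "card ({g \<in> E0 - set (e # es). w' \<in> g \<and> g \<inter> V \<subseteq> insert w' (set (w # ys))} \<union> ({e'} \<inter> E0)) \<le> K"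
          using b(2,3) Vsplit(1) w by (intro pay) auto
        moreover have "{g \<in> F1 - set es. w' \<in> g \<and> g \<inter> V1 \<subseteq> insert w' (set ys)} \<union> ({e'} \<inter> F1)
            \<subseteq> {g \<in> E0 - set (e # es). w' \<in> g \<and> g \<inter> V \<subseteq> insert w' (set (w # ys))} \<union> ({e'} \<inter> E0)"
          (is "?A \<subseteq> ?B")
        proof
          fix g assume "g \<in> ?A"
          then show "g \<in> ?B" using F1V[of g] unfolding F1_def by auto
        qed
        moreover have "finite ?B" using fin by simp
        ultimately show ?thesis by (meson card_mono le_trans)
      qed
      have F1: "finite F1" "F1 \<subseteq> E - {e}" "\<And>g. g \<in> F1 \<Longrightarrow> g \<inter> V1 \<noteq> {}"
        using fin sub by (auto simp: F1_def)
      have "card V1 < card V" using cV by simp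
      from less.hyps[OF this finV(1) F1 Vsplit(2) att1 pay1] show ?thesis by (rule conjunct2)
    qed
    have c2: "card F2 \<le> K * card V2"
    proof -
      \<comment> \<open>Only \<open>e\<close> can lead out of \<open>V2\<close>, because
        \<open>V1\<close> is closed under all other edges and contains all other neighbours of
        \<open>w\<close>. But \<open>e\<close> contains \<open>a\<close>, so the vertex where a walk
        leaves \<open>V2\<close> is itself next to the root.\<close>
      have att2: "attached E V2 a"
        unfolding attached_def
      proof
        fix x assume x: "x \<in> V2"
        then obtain u where u: "u \<in> V" "(x, u) \<in> (adj E V)\<^sup>*" "\<exists>e\<in>E. a \<in> e \<and> u \<in> e"
          using att Vsplit(1) unfolding attached_def by blast
        have "(\<exists>y\<in>V2. (x, y) \<in> (adj E V2)\<^sup>* \<and> y \<in> e) \<or> (u \<in> V2 \<and> (x, u) \<in> (adj E V2)\<^sup>*)"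
          using u(2)
        proof (induction rule: rtrancl_induct)
          case base show ?case using x by simp
        next
          case (step y z)
          show ?case
          proof (cases "\<exists>y\<in>V2. (x, y) \<in> (adj E V2)\<^sup>* \<and> y \<in> e")
            case False
            then have y: "y \<in> V2" "(x, y) \<in> (adj E V2)\<^sup>*" using step by auto
            obtain g where g: "g \<in> E" "y \<in> g" "z \<in> g" "z \<in> V" using step by (auto simp: adj_def)
            have "g \<noteq> e" using False y g by blast
            have "z \<noteq> w" using wV1[of g y] y g \<open>g \<noteq> e\<close> by (auto simp: V2_def)
            moreover have "z \<notin> V1" using closed1[of z g y] y g \<open>g \<noteq> e\<close> by (auto simp: V2_def)
            ultimately have "z \<in> V2" using g by (auto simp: V2_def)
            then show ?thesis using y g by (meson adjI rtrancl.rtrancl_into_rtrancl)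
          qed simp
        qed
        then show "\<exists>y\<in>V2. (x, y) \<in> (adj E V2)\<^sup>* \<and> (\<exists>e\<in>E. a \<in> e \<and> y \<in> e)"
          using u e by blast
      qed
      have pay2: "card ({g \<in> F2 - set es. w' \<in> g \<and> g \<inter> V2 \<subseteq> insert w' (set ys)} \<union> ({e'} \<inter> F2)) \<le> K"
        if b: "bpath E (a # ys @ [w']) (es @ [e'])" "set ys \<subseteq> V2" "w' \<in> V2" for ys w' es e'
      proof -
        have "card ({g \<in> E0 - set es. w' \<in> g \<and> g \<inter> V \<subseteq> insert w' (set ys)} \<union> ({e'} \<inter> E0)) \<le> K"
          using b Vsplit(1) by (intro pay) auto
        moreover have "{g \<in> F2 - set es. w' \<in> g \<and> g \<inter> V2 \<subseteq> insert w' (set ys)} \<union> ({e'} \<inter> F2)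
            \<subseteq> {g \<in> E0 - set es. w' \<in> g \<and> g \<inter> V \<subseteq> insert w' (set ys)} \<union> ({e'} \<inter> E0)"
          (is "?A \<subseteq> ?B")
        proof
          fix g assume "g \<in> ?A"
          then show "g \<in> ?B" using F2V[of g] unfolding F2_def by auto
        qed
        moreover have "finite ?B" using fin by simp
        ultimately show ?thesis by (meson card_mono le_trans)
      qed
      have F2: "finite F2" "F2 \<subseteq> E" "\<And>g. g \<in> F2 \<Longrightarrow> g \<inter> V2 \<noteq> {}" "a \<notin> V2"
        using fin sub aV Vsplit(1) by (auto simp: F2_def)
      have "card V2 < card V" using cV by simp
      from less.hyps[OF this finV(2) F2 att2 pay2] show ?thesis by (rule conjunct2)
    qed
    have "card E0 \<le> card (F0 \<union> F1 \<union> F2)"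
      using E0s fin by (intro card_mono) (auto simp: F0_def F1_def F2_def)
    also have "\<dots> \<le> card F0 + card F1 + card F2"
      using card_Un_le[of "F0 \<union> F1" F2] card_Un_le[of F0 F1] by linarith
    also have "\<dots> \<le> card F0 + K * (card V - 1)" using c1 c2 cV by (simp add: algebra_simps)
    finally show ?thesis unfolding F0_def .
  qed
  have second: "card E0 \<le> K * card V"
  proof (cases "V = {}")
    case True
    then have "E0 = {}" using touch by auto
    then show ?thesis by simp
  next
    case False
    then obtain e w where e: "e \<in> E" "a \<in> e" "w \<in> e" "w \<in> V"
      using att unfolding attached_def by blast
    have "bpath E (a # [] @ [w]) ([] @ [e])" using e aV by (auto simp: bpath_def)
    from pay[OF this]
    have "card ({g \<in> E0. w \<in> g \<and> g \<inter> V \<subseteq> {w}} \<union> ({e} \<inter> E0)) \<le> K" using e by simp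
    moreover have "{g \<in> E0. w \<in> g \<and> g \<inter> V \<subseteq> {w}} = {g \<in> E0. g \<inter> V = {w}}" using e by blast
    ultimately have "card E0 \<le> K + K * (card V - 1)" using first[OF e] by simp
    also have "\<dots> = K * card V" using False fin by (cases "card V") auto
    finally show ?thesis .
  qed
  show ?case by (intro conjI allI impI first second)
qed

section \<open>Counting the edges of a chunk\<close>

lemma le_binomial: "1 \<le> j \<Longrightarrow> j < n \<Longrightarrow> n \<le> n choose j"
proof (induction n)
  case (Suc n)
  then obtain i where j: "j = Suc i" by (cases j) auto
  show ?case
  proof (cases "j = n")
    case True
    then show ?thesis by (simp add: binomial_symmetric[of n "Suc n"])
  next
    case False
    then have "n \<le> n choose j" using Suc j by simp
    moreover have "1 \<le> n choose i" using Suc.prems j zero_less_binomial[of i n] by linarith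
    ultimately show ?thesis unfolding j binomial_Suc_Suc by linarith
  qed
qed simp

text \<open>By Pascal's rule the difference is \<open>s - 1 choose (r - 2)\<close>, where
  \<open>1 \<le> r - 2 < s - 1\<close>. This slack pays for edges charged to a vertex beyond those
  inside its set of ancestors.\<close>

lemma binomial_drop:
  assumes "3 \<le> r" "r \<le> s"
  shows "(s - 1 choose (r - 1)) + s - 1 \<le> s choose (r - 1)"
proof -
  obtain s' r' where s: "s = Suc s'" "r = Suc (Suc r')"
    using assms by (intro that[of "s - 1" "r - 2"]) auto
  then show ?thesis using le_binomial[of r' s'] assms by simp
qed

lemma card_link_le:
  assumes "finite X" "\<And>g. g \<in> G \<Longrightarrow> card g = r \<and> w \<in> g \<and> g \<subseteq> insert w X"
  shows "card G \<le> card X choose (r - 1)"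
proof -
  have "card G \<le> card {Y. Y \<subseteq> X \<and> card Y = r - 1}"
  proof (rule card_inj_on_le)
    show "inj_on (\<lambda>g. g - {w}) G"
    proof (rule inj_onI)
      fix g h assume "g \<in> G" "h \<in> G" "g - {w} = h - {w}"
      moreover from this have "w \<in> g" "w \<in> h" using assms(2) by auto
      ultimately show "g = h" by blast
    qed
    show "(\<lambda>g. g - {w}) ` G \<subseteq> {Y. Y \<subseteq> X \<and> card Y = r - 1}"
      using assms(2) by (auto simp: card_Diff_singleton_if)
    show "finite {Y. Y \<subseteq> X \<and> card Y = r - 1}" using assms(1) by simp
  qed
  then show ?thesis using assms(1) by (simp add: n_subsets)
qed

lemma bpath_snoc:
  assumes "bpath E (xs @ [y]) es" "e \<in> E" "e \<notin> set es" "y \<in> e" "z \<in> e" "z \<notin> set (xs @ [y])"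
  shows "bpath E (xs @ [y, z]) (es @ [e])"
  using assms berge_walk_snoc[of xs y es e z] by (auto simp: bpath_def)

lemma bpath_last_edge:
  assumes "bpath E (xs @ [y, z]) (es @ [e])"
  shows "y \<in> e" "z \<in> e" "bpath E (xs @ [y]) es"
proof -
  have l: "length es = length xs" using bpath_length[OF assms] by simp
  have b: "berge_walk (xs @ [y, z]) (es @ [e])" using assms by (simp add: bpath_def)
  from berge_walk_nth[OF b, of "length es"] l show "y \<in> e" "z \<in> e"
    by (auto simp: nth_append)
  have "bpath E (take (Suc (length es)) (xs @ [y, z])) (take (length es) (es @ [e]))"
    by (rule bpath_take[OF assms]) simp
  then show "bpath E (xs @ [y]) es" using l by simp
qed

lemma bpath_butlast_edge:
  assumes "bpath E (a # ys @ [w]) (es @ [e])"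
  shows "last (a # ys) \<in> e" "w \<in> e" "bpath E (a # ys) es"
proof -
  have "a # ys @ [w] = butlast (a # ys) @ [last (a # ys), w]"
    by (metis append_Cons append_assoc append_butlast_last_id append_Nil list.distinct(1))
  with assms have *: "bpath E (butlast (a # ys) @ [last (a # ys), w]) (es @ [e])" by metis
  from bpath_last_edge(1,2)[OF *] show "last (a # ys) \<in> e" "w \<in> e" by -
  from bpath_last_edge(3)[OF *] show "bpath E (a # ys) es"
    by (metis append_butlast_last_id list.distinct(1))
qed

lemma bpath_snoc2:
  assumes "bpath E (a # ys) es" "e \<in> E" "e \<notin> set es" "last (a # ys) \<in> e" "z \<in> e"
    "z \<notin> set (a # ys)"
  shows "bpath E (a # ys @ [z]) (es @ [e])"
proof -
  have "a # ys = butlast (a # ys) @ [last (a # ys)]" by simp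
  then have "bpath E (butlast (a # ys) @ [last (a # ys), z]) (es @ [e])"
    using bpath_snoc assms by metis
  then show ?thesis
    by (metis append_Cons append_assoc append_butlast_last_id append_Nil list.distinct(1))
qed

text \<open>The edges charged to \<open>w\<close> lie in \<open>w\<close> together with the at most \<open>s\<close> vertices of \<open>B\<close> and of the
  path before \<open>w\<close>. If \<open>e\<close> itself is not among them, it leads to a further vertex \<open>u\<close>; then no other
  charged edge contains the predecessor of \<open>w\<close>, since it could replace \<open>e\<close> and \<open>e\<close> would lengthen
  the path.\<close>

lemma charge_bound:
  fixes r s :: nat
  assumes fin: "finite V" "finite E" "finite B" and dis: "B \<inter> V = {}"
    and E: "\<And>g. g \<in> E \<Longrightarrow> g \<subseteq> V \<union> B \<and> card g = r"
    and rs: "3 \<le> r" "r \<le> s" and a: "a \<in> B" and BL: "card B + L \<le> s + 1"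
    and noend: "\<And>xs es. bpath E (a # xs) es \<Longrightarrow> set xs \<subseteq> V \<Longrightarrow> length xs \<le> L"
    and p: "bpath E (a # ys @ [w]) (es @ [e])" "set ys \<subseteq> V" "w \<in> V"
  defines "S \<equiv> {g \<in> E - set es. w \<in> g \<and> g \<inter> V \<subseteq> insert w (set ys)} \<union> ({e} \<inter> E)"
  shows "card S \<le> s choose (r - 1)"
    and "card (B \<union> set ys) < s \<or> \<not> e \<inter> V \<subseteq> insert w (set ys) \<Longrightarrow> card S < s choose (r - 1)"
proof -
  define X where "X = B \<union> set ys"
  have finX: "finite X" using fin by (simp add: X_def)
  have L: "Suc (length ys) \<le> L" using noend[OF p(1)] p by simp
  have cX: "card X \<le> card B + length ys"
    unfolding X_def by (meson card_Un_le card_length le_trans add_left_mono)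
  have eE: "e \<in> E" using p by (simp add: bpath_def)
  have inX: "g \<subseteq> insert w X" if "g \<in> E" "g \<inter> V \<subseteq> insert w (set ys)" for g
    using that E unfolding X_def by blast
  \<comment> \<open>The slack is at least \<open>s - 1 \<ge> 2\<close>: one unit pays for
    \<open>e\<close>, which need not lie in \<open>insert w X\<close>, and another makes the bound
    strict.\<close>
  have drop: "(s - 1 choose (r - 1)) + 1 < s choose (r - 1)" using binomial_drop[OF rs] rs by linarith
  have small: "card S < s choose (r - 1)"
    if Y: "finite Y" "card Y \<le> s - 1" and h: "\<And>g. g \<in> S - {e} \<Longrightarrow> g \<subseteq> insert w Y" for Y
  proof -
    have "card (S - {e}) \<le> card Y choose (r - 1)"
      using h E by (intro card_link_le[OF Y(1)]) (auto simp: S_def)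
    also have "\<dots> \<le> s - 1 choose (r - 1)" using Y by (intro binomial_right_mono) simp
    finally have "card (S - {e}) \<le> s - 1 choose (r - 1)" .
    moreover have "card S \<le> Suc (card (S - {e}))"
      by (cases "e \<in> S") (simp_all add: card_Diff_singleton_if card_gt_0_iff)
    ultimately show ?thesis using drop by linarith
  qed
  show strict: "card S < s choose (r - 1)" if "card (B \<union> set ys) < s \<or> \<not> e \<inter> V \<subseteq> insert w (set ys)"
  proof (cases "card X < s")
    case True
    moreover have "g \<subseteq> insert w X" if "g \<in> S - {e}" for g
      using that inX by (auto simp: S_def)
    ultimately show ?thesis using small[OF finX] by simp
  next
    case False
    with that obtain u where u: "u \<in> e" "u \<in> V" "u \<notin> insert w (set ys)" by (auto simp: X_def)
    \<comment> \<open>The predecessor of \<open>w\<close>; for \<open>ys = []\<close> it is the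
      root, which lies in \<open>B\<close>. In this branch \<open>card X = s\<close>, so the path
      already has the maximal number \<open>L\<close> of vertices after \<open>a\<close>.\<close>
    define y where "y = last (a # ys)"
    have inX': "g \<subseteq> insert w X" if "g \<in> S - {e}" for g
      using that inX by (auto simp: S_def)
    have yX: "y \<in> X" using a by (auto simp: y_def X_def)
    have "y \<notin> g" if g: "g \<in> S - {e}" for g
    proof
      assume "y \<in> g"
      have "w \<notin> set (a # ys)" using p by (auto simp: bpath_def)
      then have "bpath E (a # ys @ [w]) (es @ [g])"
        using bpath_snoc2[OF bpath_butlast_edge(3)[OF p(1)], of g w] g \<open>y \<in> g\<close>
        by (auto simp: y_def S_def)
      moreover have "e \<notin> set (es @ [g])" using p g by (auto simp: bpath_def)
      moreover have "u \<notin> set (a # ys @ [w])" using u a dis by auto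
      ultimately have "bpath E (a # (ys @ [w]) @ [u]) ((es @ [g]) @ [e])"
        using bpath_snoc2[of E a "ys @ [w]" "es @ [g]" e u] eE u bpath_butlast_edge(2)[OF p(1)]
        by simp
      then have "length (ys @ [w, u]) \<le> L" using noend[of "(ys @ [w]) @ [u]"] p u by simp
      then show False using False cX BL by simp
    qed
    moreover have "card (X - {y}) \<le> s - 1" using yX finX cX L BL by simp
    moreover have "g \<subseteq> insert w X" if "g \<in> S - {e}" for g
      using that inX by (auto simp: S_def)
    ultimately show ?thesis
      using small[of "X - {y}"] finX by blast
  qed
  show "card S \<le> s choose (r - 1)"
  proof (cases "card (B \<union> set ys) < s \<or> \<not> e \<inter> V \<subseteq> insert w (set ys)")
    case True
    then show ?thesis using strict by simp
  next
    case False
    have "w \<in> e" using bpath_butlast_edge(2)[OF p(1)] .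
    then have "card S \<le> card X choose (r - 1)"
      using False inX E eE by (intro card_link_le[OF finX]) (auto simp: S_def)
    also have "\<dots> \<le> s choose (r - 1)" using cX L BL by (intro binomial_right_mono) simp
    finally show ?thesis .
  qed
qed

lemma obtain_other:
  assumes "2 \<le> card V" "w \<in> V"
  obtains v where "v \<in> V" "v \<noteq> w"
proof -
  have "\<not> V \<subseteq> {w}"
    using assms(1) card_mono[of "{w}" V] by auto
  then show ?thesis using that by blast
qed

text \<open>For strictness it is enough that one vertex is charged less than
  \<open>s choose (r - 1)\<close>. The first vertex of the search can play this part, because its
  charge appears separately in \<open>search_tree_count\<close>. A single vertex joined in all ways
  to \<open>s\<close> hubs attains equality, hence the two alternatives.\<close>

lemma edge_bound:
  fixes r s :: nat
  assumes fin: "finite V" "finite E" "finite B" and dis: "B \<inter> V = {}"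
    and E: "\<And>g. g \<in> E \<Longrightarrow> g \<subseteq> V \<union> B \<and> card g = r" and touch: "\<And>g. g \<in> E \<Longrightarrow> g \<inter> V \<noteq> {}"
    and rs: "3 \<le> r" "r \<le> s" and a: "a \<in> B" and BL: "card B + L \<le> s + 1"
    and noend: "\<And>xs es. bpath E (a # xs) es \<Longrightarrow> set xs \<subseteq> V \<Longrightarrow> length xs \<le> L"
    and att: "attached E V a"
  shows "card E \<le> (s choose (r - 1)) * card V"
    and "V \<noteq> {} \<Longrightarrow> card B < s \<or> (2 \<le> card V \<and> (\<forall>x\<in>V. \<forall>y\<in>V. (x, y) \<in> (adj E V)\<^sup>*)) \<Longrightarrow>
      card E < (s choose (r - 1)) * card V"
proof -
  let ?K = "s choose (r - 1)"
  have aV: "a \<notin> V" using a dis by auto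
  have charge: "card ({g \<in> E - set es. w \<in> g \<and> g \<inter> V \<subseteq> insert w (set ys)} \<union> ({e} \<inter> E)) \<le> ?K"
    if "bpath E (a # ys @ [w]) (es @ [e])" "set ys \<subseteq> V" "w \<in> V" for ys w es e
    by (rule charge_bound(1)[OF fin dis E rs a BL noend that])
  have T: "(\<forall>e w. e \<in> E \<longrightarrow> a \<in> e \<longrightarrow> w \<in> e \<longrightarrow> w \<in> V \<longrightarrow>
      card E \<le> card ({g \<in> E. g \<inter> V = {w}} \<union> ({e} \<inter> E)) + ?K * (card V - 1)) \<and>
      card E \<le> ?K * card V"
    by (rule search_tree_count[OF fin(1,2) subset_refl touch aV att charge])
  show "card E \<le> ?K * card V" by (rule conjunct2[OF T])
  assume V: "V \<noteq> {}" and str: "card B < s \<or> (2 \<le> card V \<and> (\<forall>x\<in>V. \<forall>y\<in>V. (x, y) \<in> (adj E V)\<^sup>*))"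
  obtain e w where e: "e \<in> E" "a \<in> e" "w \<in> e" "w \<in> V"
    using att V unfolding attached_def by blast
  have p: "bpath E (a # [] @ [w]) ([] @ [e])" using e aV by (auto simp: bpath_def)
  have "card (B \<union> set []) < s \<or> \<not> e \<inter> V \<subseteq> insert w (set [])"
  proof (rule ccontr)
    \<comment> \<open>Otherwise there are at least \<open>s\<close> hubs, which forces
      \<open>L \<le> 1\<close>; yet in a connected chunk with a second vertex a path goes on from
      \<open>w\<close> by an edge other than \<open>e\<close>.\<close>
    assume n: "\<not> ?thesis"
    with str have c: "2 \<le> card V" "\<forall>x\<in>V. \<forall>y\<in>V. (x, y) \<in> (adj E V)\<^sup>*" by auto
    obtain v where v: "v \<in> V" "v \<noteq> w" using obtain_other[OF c(1) e(4)] .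
    have "(w, v) \<in> (adj E V)\<^sup>*" using c(2) v e(4) by blast
    then have "v = w \<or> (\<exists>u. (w, u) \<in> adj E V \<and> u \<noteq> w)"
      by (induction rule: rtrancl_induct) auto
    then obtain u where "(w, u) \<in> adj E V" "u \<noteq> w" using v by blast
    then obtain g where g: "g \<in> E" "w \<in> g" "u \<in> g" "u \<in> V" "u \<noteq> w" by (auto simp: adj_def)
    then have "bpath E (a # [w, u]) [e, g]" using n e g aV by (auto simp: bpath_def)
    from noend[OF this] have "2 \<le> L" using g e by simp
    then show False using n BL by auto
  qed
  then have "card ({g \<in> E - set []. w \<in> g \<and> g \<inter> V \<subseteq> insert w (set [])} \<union> ({e} \<inter> E)) < ?K"
    by (intro charge_bound(2)[OF fin dis E rs a BL noend p _ e(4)]) auto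
  then have "card ({g \<in> E. w \<in> g \<and> g \<inter> V \<subseteq> {w}} \<union> ({e} \<inter> E)) < ?K" by simp
  moreover have "{g \<in> E. w \<in> g \<and> g \<inter> V \<subseteq> {w}} = {g \<in> E. g \<inter> V = {w}}" using e by blast
  moreover have "card E \<le> card ({g \<in> E. g \<inter> V = {w}} \<union> ({e} \<inter> E)) + ?K * (card V - 1)"
    using conjunct1[OF T] e by blast
  ultimately have "card E < ?K + ?K * (card V - 1)" by simp
  also have "\<dots> = ?K * card V" using V fin by (cases "card V") auto
  finally show "card E < ?K * card V" .
qed

section \<open>Many small components\<close>

abbreviation coadj :: "'a set set \<Rightarrow> 'a \<Rightarrow> 'a \<Rightarrow> bool" where
  "coadj E x y \<equiv> \<exists>e\<in>E. x \<in> e \<and> y \<in> e"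

text \<open>The members of \<open>e\<close> cut \<open>zs\<close> into blocks, each beginning with
  one of them. If fewer than \<open>h\<close> vertices followed each of them in its block, every
  block would have at most \<open>h\<close> vertices, too few for the length of
  \<open>zs\<close>.\<close>

lemma free_block:
  assumes "zs \<noteq> []" "hd zs \<in> e" "length (filter (\<lambda>x. x \<in> e) zs) * h < length zs"
  shows "\<exists>us z vs ws. zs = us @ z # vs @ ws \<and> z \<in> e \<and> set vs \<inter> e = {} \<and> h \<le> length vs"
  using assms
proof (induction "length zs" arbitrary: zs rule: less_induct)
  case less
  then obtain z rest where zs: "zs = z # rest" by (cases zs) auto
  define vs where "vs = takeWhile (\<lambda>x. x \<notin> e) rest"
  define ws where "ws = dropWhile (\<lambda>x. x \<notin> e) rest"
  have rest: "rest = vs @ ws" by (simp add: vs_def ws_def)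
  have vs: "set vs \<inter> e = {}" by (auto simp: vs_def dest: set_takeWhileD)
  show ?case
  proof (cases "h \<le> length vs")
    case True
    have "zs = [] @ z # vs @ ws" "z \<in> e" using zs rest less.prems by simp_all
    then show ?thesis using True vs by blast
  next
    case False
    have f: "filter (\<lambda>x. x \<in> e) vs = []" using vs by (auto simp: filter_empty_conv)
    have len: "length zs = Suc (length vs + length ws)" using zs rest by simp
    have cnt: "length (filter (\<lambda>x. x \<in> e) zs) = Suc (length (filter (\<lambda>x. x \<in> e) ws))"
      using zs rest f less.prems by simp
    have l: "length (filter (\<lambda>x. x \<in> e) ws) * h < length ws"
      using less.prems(3) False unfolding len cnt by simp
    then have ne: "ws \<noteq> []" by auto
    then have "hd ws \<in> e" using hd_dropWhile[of "\<lambda>x. x \<notin> e" rest] by (auto simp: ws_def)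
    moreover have "length ws < length zs" using len by simp
    ultimately obtain us z' vs' ws' where
      b: "ws = us @ z' # vs' @ ws'" "z' \<in> e" "set vs' \<inter> e = {}" "h \<le> length vs'"
      using less.hyps ne l by blast
    have "zs = (z # vs @ us) @ z' # vs' @ ws'" using zs rest b by simp
    then show ?thesis using b by blast
  qed
qed

text \<open>In the recursive clause one vertex is spent on the start of the path and one makes the
  pigeonhole strict: the remaining list falls into at most \<open>r\<close> blocks, one of which
  must be long enough for the next step.\<close>

primrec shadow_length :: "nat \<Rightarrow> nat \<Rightarrow> nat" where
  "shadow_length r 0 = 1"
| "shadow_length r (Suc k) = r * shadow_length r k + 2"

text \<open>An edge meets a shadow path in at most \<open>r\<close> vertices, so it may serve as the first edge of a
  Berge path that jumps to the beginning of a long block avoiding this edge.\<close>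

lemma shadow_path_imp_bpath:
  assumes "\<And>e. e \<in> E \<Longrightarrow> finite e \<and> card e \<le> r"
    and "successively (coadj E) ys" "distinct ys" "shadow_length r k \<le> length ys"
  shows "\<exists>xs es. bpath E (hd ys # xs) es \<and> set xs \<subseteq> set ys \<and> length xs = k"
  using assms
proof (induction k arbitrary: ys E)
  case 0
  then show ?case by (intro exI[of _ "[]"]) (auto simp: bpath_def)
next
  case (Suc k)
  have "2 \<le> length ys" using Suc.prems(4) by simp
  then obtain y y' zs' where ys': "ys = y # y' # zs'"
    by (metis Suc_le_length_iff numeral_2_eq_2)
  define zs where "zs = y' # zs'"
  have ys: "ys = y # zs" "zs \<noteq> []" "hd zs = y'" using ys' by (auto simp: zs_def)
  obtain e where e: "e \<in> E" "y \<in> e" "hd zs \<in> e"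
    using Suc.prems(2) ys' ys(3) by auto
  have "length (filter (\<lambda>x. x \<in> e) zs) = card (set (filter (\<lambda>x. x \<in> e) zs))"
    using Suc.prems(3) ys by (intro distinct_card[symmetric] distinct_filter) simp
  also have "\<dots> \<le> card e" using Suc.prems(1)[OF e(1)] by (intro card_mono) auto
  finally have "length (filter (\<lambda>x. x \<in> e) zs) \<le> r" using Suc.prems(1)[OF e(1)] by simp
  then have "length (filter (\<lambda>x. x \<in> e) zs) * shadow_length r k \<le> r * shadow_length r k"
    by (rule mult_le_mono1)
  also have "\<dots> < length zs" using Suc.prems(4) ys by simp
  finally have "length (filter (\<lambda>x. x \<in> e) zs) * shadow_length r k < length zs" .
  from free_block[OF ys(2) e(3) this]
  obtain us z vs ws where b: "zs = us @ z # vs @ ws" "z \<in> e" "set vs \<inter> e = {}"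
      "shadow_length r k \<le> length vs" by blast
  have "ys = (y # us) @ (z # vs) @ ws" using ys b by simp
  then have s: "successively (coadj E) (z # vs)"
    using Suc.prems(2) by (simp only: successively_append_iff)
  \<comment> \<open>Each consecutive pair contains a vertex of \<open>vs\<close>, which avoids
    \<open>e\<close>; so another edge joins it.\<close>
  have "successively (coadj (E - {e})) (z # vs)"
    using s b(3)
  proof (induction vs arbitrary: z)
    case (Cons v vs)
    then have "successively (coadj (E - {e})) (v # vs)" by simp
    moreover have "coadj (E - {e}) z v" using Cons.prems by auto
    ultimately show ?case by (simp only: successively.simps simp_thms)
  qed simp
  moreover have "\<And>e'. e' \<in> E - {e} \<Longrightarrow> finite e' \<and> card e' \<le> r" using Suc.prems(1) by blast
  moreover have "distinct (z # vs)" using Suc.prems(3) ys(1) b(1) by simp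
  moreover have "shadow_length r k \<le> length (z # vs)" using b(4) by simp
  ultimately have "\<exists>xs es. bpath (E - {e}) (hd (z # vs) # xs) es \<and> set xs \<subseteq> set (z # vs) \<and> length xs = k"
    by (intro Suc.IH)
  then obtain xs es where p: "bpath (E - {e}) (z # xs) es" "set xs \<subseteq> set (z # vs)" "length xs = k"
    by auto
  have "bpath E (y # z # xs) (e # es)"
    using p e b ys Suc.prems(3) by (auto simp: bpath_def)
  then show ?case using p b ys by (intro exI[of _ "z # xs"] exI[of _ "e # es"]) auto
qed

section \<open>Components of the 2-shadow, and how to obtain many small ones\<close>

definition component :: "'a set set \<Rightarrow> 'a set \<Rightarrow> 'a \<Rightarrow> 'a set" where
  "component E W x = {y. (x, y) \<in> (adj E W)\<^sup>*}"

lemma component_self: "x \<in> component E W x"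
  by (simp add: component_def)

lemma component_subset: "x \<in> W \<Longrightarrow> component E W x \<subseteq> W"
  using adj_rtrancl_mem by (fastforce simp: component_def)

lemma component_eq: "y \<in> component E W x \<Longrightarrow> component E W y = component E W x"
  unfolding component_def
  by (auto intro: rtrancl_trans dest: adj_rtrancl_sym)

lemma component_closed:
  assumes "y \<in> component E W x" "x \<in> W" "e \<in> E" "y \<in> e"
  shows "e \<inter> W \<subseteq> component E W x"
proof
  fix z assume "z \<in> e \<inter> W"
  moreover have "y \<in> W" using component_subset assms by fastforce
  ultimately have "(y, z) \<in> adj E W" using assms by (auto intro: adjI)
  then show "z \<in> component E W x"
    using assms(1) unfolding component_def by (auto intro: rtrancl_into_rtrancl)
qed

lemma component_connected:
  assumes x: "x \<in> W" and C: "C = component E W x" and F: "F = {e \<in> E. e \<inter> C \<noteq> {}}"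
    and y: "y \<in> C" and z: "z \<in> C"
  shows "(y, z) \<in> (adj F C)\<^sup>*"
proof -
  have "(y, z) \<in> (adj E W)\<^sup>*" using y z component_eq[of y E W x] C by (auto simp: component_def)
  then have "z \<in> C \<and> (y, z) \<in> (adj F C)\<^sup>*"
  proof (induction rule: rtrancl_induct)
    case (step u v)
    then obtain e where e: "e \<in> E" "u \<in> e" "v \<in> e" "v \<in> W" by (auto simp: adj_def)
    then have "v \<in> C" using component_closed[of u E W x e] step x C by blast
    moreover have "e \<in> F" using e step F by auto
    ultimately show ?case using step e by (meson adjI rtrancl.rtrancl_into_rtrancl)
  qed (use y in auto)
  then show ?thesis by simp
qed

text \<open>The number \<open>M q\<close> of components asked for depends on the bound
  \<open>q\<close> on their size, since larger components admit more profiles. So the thresholds are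
  fixed from the last stage of the descent upwards, \<open>d\<close> being the number of steps
  left.\<close>

primrec chunk_size :: "(nat \<Rightarrow> nat) \<Rightarrow> nat \<Rightarrow> nat" where
  "chunk_size M 0 = 1"
| "chunk_size M (Suc d) = M (chunk_size M d) * chunk_size M d + 2"

text \<open>A shadow path is continued greedily into any component that is still large. It has at
  most \<open>T\<close> vertices, so at some vertex \<open>x\<close> all components below are small;
  as together they make up the component of \<open>x\<close> except \<open>x\<close> itself, they
  are numerous.\<close>

lemma many_small_components_aux:
  assumes fin: "finite V"
    and long: "\<And>ys. successively (coadj E) ys \<Longrightarrow> distinct ys \<Longrightarrow> set ys \<subseteq> V \<Longrightarrow> length ys \<le> T"
  shows "length xs + d = T \<Longrightarrow> successively (coadj E) (x # xs) \<Longrightarrow> distinct (x # xs) \<Longrightarrow>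
      set (x # xs) \<subseteq> V \<Longrightarrow> chunk_size M d \<le> card (component E (V - set xs) x) \<Longrightarrow>
    \<exists>P d \<W>. P \<subseteq> V \<and> P \<noteq> {} \<and> card P \<le> T \<and> d \<le> T \<and> \<W> \<subseteq> component E (V - P) ` (V - P) \<and>
      M (chunk_size M d) \<le> card \<W> \<and> (\<forall>W\<in>\<W>. card W \<le> chunk_size M d)"
proof (induction d arbitrary: x xs)
  case 0
  then show ?case using long[of "x # xs"] by simp
next
  case (Suc d)
  define C where "C = component E (V - set xs) x"
  define P where "P = set (x # xs)"
  have x: "x \<in> V - set xs" using Suc.prems by auto
  have CV: "C - {x} \<subseteq> V - P" using component_subset[OF x] by (auto simp: C_def P_def)
  \<comment> \<open>Each component left after removing \<open>x\<close> contains a neighbour of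
    \<open>x\<close>, the vertex by which the path goes on.\<close>
  have link: "z \<noteq> x \<longrightarrow> (\<exists>y\<in>component E (V - P) z. y \<in> V - P \<and> coadj E y x)"
    if "(x, z) \<in> (adj E (V - set xs))\<^sup>*" for z
    using that
  proof (induction rule: rtrancl_induct)
    case (step z z')
    show ?case
    proof
      assume z': "z' \<noteq> x"
      obtain e where e: "e \<in> E" "z \<in> e" "z' \<in> e" "z \<in> V - set xs" "z' \<in> V - set xs"
        using step by (auto simp: adj_def)
      show "\<exists>y\<in>component E (V - P) z'. y \<in> V - P \<and> coadj E y x"
      proof (cases "z = x")
        case True
        then show ?thesis using e z' component_self[of z' E "V - P"] by (auto simp: P_def)
      next
        case False
        then have "(z, z') \<in> adj E (V - P)" using e z' by (auto simp: P_def intro!: adjI)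
        then have "component E (V - P) z' = component E (V - P) z"
          by (intro component_eq) (auto simp: component_def)
        then show ?thesis using step False by simp
      qed
    qed
  qed simp
  show ?case
  proof (cases "\<exists>z\<in>C - {x}. chunk_size M d \<le> card (component E (V - P) z)")
    case True
    then obtain z where z: "z \<in> C - {x}" "chunk_size M d \<le> card (component E (V - P) z)" by blast
    then obtain y where y: "y \<in> component E (V - P) z" "y \<in> V - P" "coadj E y x"
      using link[of z] by (auto simp: C_def component_def)
    have "component E (V - P) y = component E (V - P) z" using component_eq[OF y(1)] .
    then show ?thesis
      using Suc.IH[of "x # xs" y] Suc.prems y z by (simp add: P_def)
  next
    case False
    then have small: "card (component E (V - P) z) \<le> chunk_size M d" if "z \<in> C - {x}" for z
      using that nat_le_linear by blast
    define D where "D = component E (V - P) ` (C - {x})"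
    have finC: "finite C" using fin component_subset[OF x] unfolding C_def
      by (meson finite_Diff finite_subset)
    have "C - {x} \<subseteq> \<Union>D"
    proof
      fix y assume "y \<in> C - {x}"
      moreover have "y \<in> component E (V - P) y" by (rule component_self)
      ultimately show "y \<in> \<Union>D" unfolding D_def by blast
    qed
    moreover have "finite (\<Union>D)"
      unfolding D_def using component_subset CV fin by (meson UN_least finite_Diff finite_subset subsetD)
    ultimately have "card (C - {x}) \<le> card (\<Union>D)" by (intro card_mono)
    also have "\<dots> \<le> (\<Sum>W\<in>D. card W)" by (rule card_Union_le_sum_card)
    also have "\<dots> \<le> (\<Sum>W\<in>D. chunk_size M d)"
      unfolding D_def using small by (intro sum_mono) blast
    finally have "card (C - {x}) \<le> card D * chunk_size M d" by simp
    moreover have "card C = Suc (card (C - {x}))"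
      using finC component_self[of x E "V - set xs"] by (metis C_def card.remove)
    moreover have "M (chunk_size M d) * chunk_size M d + 2 \<le> card C"
      using Suc.prems(5) by (simp add: C_def)
    ultimately have "M (chunk_size M d) * chunk_size M d \<le> card D * chunk_size M d" by linarith
    moreover have "0 < chunk_size M d" by (cases d) auto
    ultimately have "M (chunk_size M d) \<le> card D" by simp
    moreover have "\<forall>W\<in>D. card W \<le> chunk_size M d" unfolding D_def using small by blast
    moreover have "D \<subseteq> component E (V - P) ` (V - P)" using CV by (auto simp: D_def)
    moreover have "card P \<le> T" using Suc.prems by (simp add: P_def distinct_card)
    moreover have "P \<subseteq> V" "P \<noteq> {}" using Suc.prems by (auto simp: P_def)
    ultimately show ?thesis using Suc.prems(1) by (intro exI[of _ P] exI[of _ d] exI[of _ D]) simp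
  qed
qed

lemma many_small_components:
  assumes fin: "finite V" "V \<noteq> {}" and con: "\<And>x y. x \<in> V \<Longrightarrow> y \<in> V \<Longrightarrow> (x, y) \<in> (adj E V)\<^sup>*"
    and e: "\<And>e. e \<in> E \<Longrightarrow> finite e \<and> card e \<le> r"
    and short: "\<And>xs es. bpath E xs es \<Longrightarrow> length xs \<le> k"
    and T: "T = shadow_length r k" and big: "chunk_size M T \<le> card V"
  shows "\<exists>P d \<W>. P \<subseteq> V \<and> P \<noteq> {} \<and> card P \<le> T \<and> d \<le> T \<and>
      \<W> \<subseteq> component E (V - P) ` (V - P) \<and> M (chunk_size M d) \<le> card \<W> \<and>
      (\<forall>W\<in>\<W>. card W \<le> chunk_size M d)"
proof -
  obtain x where x: "x \<in> V" using fin by auto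
  have "component E V x = V"
    using component_subset[OF x] con[OF x] by (auto simp: component_def)
  moreover have "length ys \<le> T" if ys: "successively (coadj E) ys" "distinct ys" for ys
  proof (rule ccontr)
    assume "\<not> ?thesis"
    then obtain xs es where "bpath E (hd ys # xs) es" "length xs = k"
      using shadow_path_imp_bpath[OF e ys, of k] T by auto
    then show False using short by fastforce
  qed
  ultimately show ?thesis
    using x big by (intro many_small_components_aux[OF fin(1), of E T "[]" T x]) auto
qed

section \<open>Paths through hubs and clones\<close>

lemma bpath_cut:
  assumes "bpath E (p # xs) es" "z \<in> set xs"
  obtains xs' es' where "bpath E (p # xs' @ [z]) es'" "set xs' \<subseteq> set xs" "hd es' = hd es"
proof -
  obtain us vs where xs: "xs = us @ z # vs" using split_list[OF assms(2)] by blast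
  have l: "Suc (length us) \<le> length es" using bpath_length[OF assms(1)] xs by simp
  have "bpath E (p # us @ [z]) (take (Suc (length us)) es)"
    using bpath_take[OF assms(1) l] xs by simp
  moreover have "hd (take (Suc (length us)) es) = hd es" by (cases es) auto
  moreover have "set us \<subseteq> set xs" using xs by auto
  ultimately show ?thesis using that by blast
qed

text \<open>Prescribing the first edge is the point: when the path is later completed by an edge
  \<open>f\<close> different from \<open>e\<close>, it cannot consist of one edge and so has an
  inner vertex.\<close>

lemma bpath_to_vertex:
  assumes con: "\<And>x y. x \<in> W \<Longrightarrow> y \<in> W \<Longrightarrow> (x, y) \<in> (adj F W)\<^sup>*"
    and e: "e \<in> F" "a \<in> e" "e \<inter> W \<noteq> {}" and a: "a \<notin> W" and z: "z \<in> W"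
  shows "\<exists>xs es. bpath F (a # xs @ [z]) es \<and> set xs \<subseteq> W \<and> hd es = e"
proof -
  obtain x where x: "x \<in> e" "x \<in> W" using e by auto
  have "(x, z) \<in> (adj F W)\<^sup>*" using con x z by blast
  then have "z \<in> W \<and> (\<exists>xs es. bpath F (a # xs @ [z]) es \<and> set xs \<subseteq> W \<and> hd es = e)"
  proof (induction rule: rtrancl_induct)
    case base
    have "bpath F (a # [] @ [x]) [e]" using e x a by (auto simp: bpath_def)
    then show ?case using x by fastforce
  next
    case (step y z)
    then obtain xs es where p: "bpath F (a # xs @ [y]) es" "set xs \<subseteq> W" "hd es = e" by blast
    obtain g where g: "g \<in> F" "y \<in> g" "z \<in> g" "z \<in> W" "y \<in> W" using step by (auto simp: adj_def)
    show ?case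
    proof (cases "z \<in> set (xs @ [y])")
      case True
      from bpath_cut[OF p(1) this] obtain xs' es' where
        "bpath F (a # xs' @ [z]) es'" "set xs' \<subseteq> set (xs @ [y])" "hd es' = hd es" .
      moreover have "set (xs @ [y]) \<subseteq> W" using p g by auto
      ultimately show ?thesis using p g by (metis subset_trans)
    next
      case False
      have "es \<noteq> []" using bpath_length[OF p(1)] by auto
      moreover have "z \<notin> set (a # xs @ [y])" using False a g by auto
      moreover have "last (a # xs @ [y]) \<in> g" using g by simp
      ultimately obtain xs' es' where
        q: "bpath F (a # xs' @ [z]) (es' @ [g])" "set xs' \<subseteq> set (xs @ [y])" "hd (es' @ [g]) = hd es"
        using bpath_extend[OF p(1)] g by metis
      moreover have "set (xs @ [y]) \<subseteq> W" using p g by auto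
      ultimately show ?thesis using p g by (metis subset_trans)
    qed
  qed
  then show ?thesis by blast
qed

lemma bpath_between:
  assumes con: "\<And>x y. x \<in> W \<Longrightarrow> y \<in> W \<Longrightarrow> (x, y) \<in> (adj F W)\<^sup>*"
    and touch: "\<And>e. e \<in> F \<Longrightarrow> e \<inter> W \<noteq> {}"
    and ab: "a \<notin> W" "b \<notin> W" "a \<noteq> b" and e: "e \<in> F" "a \<in> e" and f: "f \<in> F" "b \<in> f"
  shows "\<exists>xs es. bpath F (a # xs @ [b]) es \<and> set xs \<subseteq> W \<and> (e \<noteq> f \<longrightarrow> xs \<noteq> [])"
proof (cases "e = f")
  case True
  have "bpath F (a # [] @ [b]) [e]" using True ab e f by (auto simp: bpath_def)
  then show ?thesis using True by fastforce
next
  case False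
  obtain z where z: "z \<in> f" "z \<in> W" using touch f by blast
  obtain xs es where p: "bpath F (a # xs @ [z]) es" "set xs \<subseteq> W" "hd es = e"
    using bpath_to_vertex[OF con e touch[OF e(1)] ab(1) z(2)] by blast
  have "es \<noteq> []" using bpath_length[OF p(1)] by auto
  moreover have "b \<notin> set (a # xs @ [z])" using ab z p by auto
  moreover have "last (a # xs @ [z]) \<in> f" using z by simp
  ultimately obtain xs' es' where
    q: "bpath F (a # xs' @ [b]) (es' @ [f])" "set xs' \<subseteq> set (xs @ [z])" "hd (es' @ [f]) = hd es"
    using bpath_extend[OF p(1) _ f(1)] f by metis
  have "xs' \<noteq> []"
  proof
    assume "xs' = []"
    then have "es' = []" using bpath_length[OF q(1)] by simp
    then show False using q p False by simp
  qed
  moreover have "set xs' \<subseteq> W" using q p z by auto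
  ultimately show ?thesis using q by blast
qed

section \<open>Chaining hubs through clones\<close>

definition touching :: "'a set set \<Rightarrow> 'a set \<Rightarrow> 'a set set" where
  "touching E W = {e \<in> E. e \<inter> W \<noteq> {}}"

text \<open>Two different edges are what a path between hubs \<open>a\<close> and \<open>b\<close>
  needs to have an inner vertex in the chunk. With \<open>a = b\<close> the formula says that
  \<open>a\<close> lies in at least two edges.\<close>

definition linked :: "'a set set \<Rightarrow> 'a \<Rightarrow> 'a \<Rightarrow> bool" where
  "linked F a b \<longleftrightarrow> (\<exists>e\<in>F. \<exists>f\<in>F. a \<in> e \<and> b \<in> f \<and> e \<noteq> f)"

definition end_path :: "'a set set \<Rightarrow> 'a set \<Rightarrow> 'a \<Rightarrow> nat \<Rightarrow> bool" where
  "end_path F W a l \<longleftrightarrow> (\<exists>xs es. bpath F (a # xs) es \<and> set xs \<subseteq> W \<and> length xs = l)"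

fun gain :: "('a \<Rightarrow> 'a \<Rightarrow> bool) \<Rightarrow> 'a list \<Rightarrow> nat" where
  "gain lk (a # b # xs) = (if lk a b then 1 else 0) + gain lk (b # xs)"
| "gain lk _ = 0"

lemma gain_append:
  "distinct xs \<Longrightarrow> (\<And>a b. a \<in> set xs \<Longrightarrow> b \<in> set xs \<Longrightarrow> a \<noteq> b \<Longrightarrow> lk a b) \<Longrightarrow>
    length xs \<le> Suc (gain lk (xs @ ys))"
proof (induction xs)
  case (Cons a xs)
  then show ?case
  proof (cases xs)
    case Nil
    then show ?thesis by simp
  next
    case (Cons b xs')
    then have "lk a b" using Cons.prems by auto
    then show ?thesis using Cons.IH Cons.prems Cons by auto
  qed
qed simp

text \<open>Only the shape of the chunks is fixed here; that they look alike from \<open>P\<close>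
  is assumed separately where it is needed. This lets single vertices next to the core serve as
  chunks too.\<close>

locale clones =
  fixes E :: "'a set set" and P :: "'a set" and \<W> :: "'a set set"
  assumes outside: "W \<in> \<W> \<Longrightarrow> W \<inter> P = {}"
    and disjoint: "W \<in> \<W> \<Longrightarrow> W' \<in> \<W> \<Longrightarrow> W \<noteq> W' \<Longrightarrow> W \<inter> W' = {}"
    and edges: "W \<in> \<W> \<Longrightarrow> e \<in> touching E W \<Longrightarrow> e \<subseteq> W \<union> P"
    and con: "W \<in> \<W> \<Longrightarrow> x \<in> W \<Longrightarrow> y \<in> W \<Longrightarrow> (x, y) \<in> (adj (touching E W) W)\<^sup>*"
begin

lemma touching_disjoint:
  assumes "W \<in> \<W>" "W' \<in> \<W>" "W \<noteq> W'"
  shows "touching E W \<inter> touching E W' = {}"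
  using edges assms disjoint[OF assms] outside[OF assms(2)] unfolding touching_def by blast

text \<open>Each consecutive pair of hubs consumes one chunk, so the pieces share no edges and only
  hubs as vertices. Restricting to a subfamily \<open>\<W>'\<close> leaves other chunks free for the
  two ends.\<close>

lemma hub_path:
  assumes "\<And>W a. W \<in> \<W>' \<Longrightarrow> a \<in> set hs \<Longrightarrow> a \<in> \<Union>(touching E W)"
    and "\<And>W a b. W \<in> \<W>' \<Longrightarrow> lk a b \<Longrightarrow> a \<in> set hs \<Longrightarrow> b \<in> set hs \<Longrightarrow> linked (touching E W) a b"
    and "distinct hs" "hs \<noteq> []" "set hs \<subseteq> P"
    and "finite \<W>'" "\<W>' \<subseteq> \<W>" "length hs \<le> Suc (card \<W>')"
  shows "\<exists>xs es. bpath (\<Union>W\<in>\<W>'. touching E W) (hd hs # xs) es \<and> set (hd hs # xs) \<subseteq> set hs \<union> \<Union>\<W>' \<and>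
    last (hd hs # xs) = last hs \<and> length hs + gain lk hs \<le> length (hd hs # xs)"
  using assms
proof (induction hs arbitrary: \<W>')
  case (Cons a hs)
  show ?case
  proof (cases hs)
    case Nil
    have "bpath (\<Union>W\<in>\<W>'. touching E W) [a] []" by (auto simp: bpath_def)
    then show ?thesis using Nil by (intro exI[of _ "[]"]) simp
  next
    case hs: (Cons b hs')
    have "\<W>' \<noteq> {}" using Cons.prems hs by auto
    then obtain W where W: "W \<in> \<W>'" by blast
    define \<W>'' where "\<W>'' = \<W>' - {W}"
    have sub: "\<W>'' \<subseteq> \<W>'" "W \<notin> \<W>''" by (auto simp: \<W>''_def)
    have cW: "card \<W>' = Suc (card \<W>'')" using W Cons.prems by (metis \<W>''_def card.remove)
    have WW: "W \<in> \<W>" using W Cons.prems by blast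
    have "\<exists>xs es. bpath (\<Union>W\<in>\<W>''. touching E W) (hd hs # xs) es \<and> set (hd hs # xs) \<subseteq> set hs \<union> \<Union>\<W>'' \<and>
      last (hd hs # xs) = last hs \<and> length hs + gain lk hs \<le> length (hd hs # xs)"
    proof (rule Cons.IH)
      show "finite \<W>''" "\<W>'' \<subseteq> \<W>" "length hs \<le> Suc (card \<W>'')"
        using Cons.prems sub cW finite_subset by auto
      show "distinct hs" "hs \<noteq> []" "set hs \<subseteq> P" using Cons.prems(3,5) hs by simp_all
      show "a \<in> \<Union>(touching E W)" if "W \<in> \<W>''" "a \<in> set hs" for W a
        using Cons.prems(1)[of W a] that sub(1) by auto
      show "linked (touching E W) a b" if "W \<in> \<W>''" "lk a b" "a \<in> set hs" "b \<in> set hs" for W a b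
        using Cons.prems(2)[of W a b] that sub(1) by auto
    qed
    then obtain xs es where p: "bpath (\<Union>W\<in>\<W>''. touching E W) (b # xs) es"
      "set (b # xs) \<subseteq> set hs \<union> \<Union>\<W>''" "last (b # xs) = last hs" "length hs + gain lk hs \<le> length (b # xs)"
      using hs by auto
    have ab: "a \<notin> W" "b \<notin> W" "a \<noteq> b" using outside[OF WW] Cons.prems hs by auto
    have "\<exists>e\<in>touching E W. \<exists>f\<in>touching E W. a \<in> e \<and> b \<in> f \<and> (lk a b \<longrightarrow> e \<noteq> f)"
    proof (cases "lk a b")
      case True
      then show ?thesis using Cons.prems(2)[OF W True] hs unfolding linked_def by auto
    next
      case False
      then show ?thesis using Cons.prems(1)[OF W] hs by auto
    qed
    then obtain e f where ef: "e \<in> touching E W" "a \<in> e" "f \<in> touching E W" "b \<in> f" "lk a b \<longrightarrow> e \<noteq> f"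
      by blast
    have "\<exists>ys fs. bpath (touching E W) (a # ys @ [b]) fs \<and> set ys \<subseteq> W \<and> (e \<noteq> f \<longrightarrow> ys \<noteq> [])"
      using con[OF WW] ab ef by (intro bpath_between) (auto simp: touching_def)
    then obtain ys fs where q: "bpath (touching E W) (a # ys @ [b]) fs" "set ys \<subseteq> W" "lk a b \<longrightarrow> ys \<noteq> []"
      using ef by blast
    let ?U = "\<Union>W\<in>\<W>'. touching E W"
    have "bpath ?U ((a # ys) @ b # xs) (fs @ es)"
    proof (rule bpath_join)
      show "bpath ?U ((a # ys) @ [b]) fs" using bpath_mono[OF q(1)] W by auto
      show "bpath ?U (b # xs) es" using bpath_mono[OF p(1)] sub by blast
      have "a \<notin> \<Union>\<W>''" using Cons.prems(5,7) sub outside by auto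
      then have "a \<notin> set xs" using p(2) Cons.prems(3) by auto
      moreover have "set ys \<inter> set xs = {}"
      proof -
        have "W \<inter> set hs = {}" using outside[OF WW] Cons.prems(5) by auto
        moreover have "W \<inter> W' = {}" if "W' \<in> \<W>''" for W'
          using disjoint[OF WW, of W'] that Cons.prems(7) sub by auto
        ultimately have "W \<inter> (set hs \<union> \<Union>\<W>'') = {}" by blast
        then show ?thesis using p(2) q(2) by auto
      qed
      ultimately show "set (a # ys) \<inter> set xs = {}" by auto
      have "set fs \<subseteq> touching E W" "set es \<subseteq> (\<Union>W\<in>\<W>''. touching E W)"
        using q p by (auto simp: bpath_def)
      moreover have "touching E W \<inter> touching E W' = {}" if "W' \<in> \<W>''" for W'
        using touching_disjoint[OF WW, of W'] that Cons.prems(7) sub by auto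
      ultimately show "set fs \<inter> set es = {}" by blast
    qed
    moreover have "set (a # ys @ b # xs) \<subseteq> set (a # hs) \<union> \<Union>\<W>'"
    proof -
      have "W \<union> \<Union>\<W>'' \<subseteq> \<Union>\<W>'" using W sub by auto
      moreover have "set (a # ys @ b # xs) \<subseteq> insert a (W \<union> (set hs \<union> \<Union>\<W>''))"
        using p(2) q(2) by auto
      ultimately have "set (a # ys @ b # xs) \<subseteq> insert a (set hs \<union> \<Union>\<W>')" by fast
      then show ?thesis by simp
    qed
    moreover have "last (a # ys @ b # xs) = last (a # hs)" using p hs by simp
    moreover have "length (a # hs) + gain lk (a # hs) \<le> length (a # ys @ b # xs)"
      using p(4) q(3) hs by (cases ys) auto
    ultimately show ?thesis
      by (intro exI[of _ "ys @ b # xs"] exI[of _ "fs @ es"]) (simp only: list.sel append_Cons simp_thms)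
  qed
qed simp

end

lemma bpath_attach_ends:
  assumes m: "bpath E (h # xs) es" and f: "bpath E (h # ys) fs" and b: "bpath E (last (h # xs) # zs) gs"
    and v: "set ys \<inter> set (h # xs) = {}" "set zs \<inter> set (h # xs) = {}" "set ys \<inter> set zs = {}"
    and e: "set es \<inter> set fs = {}" "set es \<inter> set gs = {}" "set fs \<inter> set gs = {}"
  obtains ws hs where "bpath E ws hs" "length ws = length ys + length (h # xs) + length zs"
proof -
  have "bpath E (rev ys @ [h]) (rev fs)" using bpath_rev[OF f] by simp
  then have 1: "bpath E (rev ys @ h # xs) (rev fs @ es)"
    using bpath_join[of E "rev ys" h "rev fs" xs es] m v e by auto
  have "rev ys @ h # xs = (rev ys @ butlast (h # xs)) @ [last (h # xs)]" by simp
  then have 2: "bpath E ((rev ys @ butlast (h # xs)) @ [last (h # xs)]) (rev fs @ es)" using 1 by simp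
  have "set (butlast (h # xs)) \<subseteq> set (h # xs)" using in_set_butlastD by fast
  then have 3: "set (rev ys @ butlast (h # xs)) \<inter> set zs = {}" using v by fastforce
  have 4: "set (rev fs @ es) \<inter> set gs = {}" using e by auto
  from bpath_join[OF 2 b 3 4] show ?thesis using that by simp
qed

section \<open>How fast a binomial coefficient falls, and the edges of a single clone\<close>

lemma binomial_drop2:
  assumes "3 \<le> r" "r \<le> s" "2 \<le> t" "t \<le> s"
  shows "(s - t choose (r - 1)) + s \<le> s choose (r - 1)"
proof -
  obtain s' r' where s: "s = Suc (Suc s')" "r = Suc (Suc r')"
    using assms by (intro that[of "s - 2" "r - 2"]) auto
  have "s - t choose (r - 1) \<le> s' choose (r - 1)"
    using assms s by (intro binomial_right_mono) auto
  moreover have "1 \<le> s' choose r'" using assms s zero_less_binomial[of r' s'] by linarith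
  moreover have "s - 1 choose (r - 1) = (s' choose r') + (s' choose (r - 1))" using s by simp
  ultimately show ?thesis using binomial_drop[OF assms(1,2)] s by linarith
qed

text \<open>Here \<open>t\<close> edges are set aside and each of \<open>q\<close> vertices is
  charged one edge more than \<open>s - t choose (r - 1)\<close>. For \<open>t = 1\<close> the fall
  may be only 2, so two vertices are needed to cover the edge set aside.\<close>

lemma binomial_drop_two_vertices:
  assumes "3 \<le> r" "r \<le> s" "1 \<le> t" "t \<le> s" "2 \<le> q"
  shows "t + ((s - t choose (r - 1)) + 1) * q < (s choose (r - 1)) * q"
proof (cases "t = 1")
  case True
  have "(s - t choose (r - 1)) + 2 \<le> s choose (r - 1)"
    unfolding True using binomial_drop[OF assms(1,2)] assms(1,2) by linarith
  then have "((s - t choose (r - 1)) + 2) * q \<le> (s choose (r - 1)) * q" by (rule mult_le_mono1)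
  then show ?thesis using True assms by (simp add: algebra_simps)
next
  case False
  have "((s - t choose (r - 1)) + s) * q \<le> (s choose (r - 1)) * q"
    using binomial_drop2[of r s t] assms False by (intro mult_le_mono1) auto
  moreover have "s + q < s * q"
  proof -
    obtain s' q' where "s = Suc (Suc (Suc s'))" "q = Suc (Suc q')"
      using assms by (intro that[of "s - 3" "q - 2"]) auto
    then show ?thesis by simp
  qed
  ultimately show ?thesis using assms by (simp add: algebra_simps)
qed

text \<open>The case \<open>t = s\<close> has to be excluded: for \<open>r = s\<close> both sides
  would equal \<open>s\<close>.\<close>

lemma binomial_drop_one_vertex:
  assumes "3 \<le> r" "r \<le> s" "1 \<le> t" "t < s"
  shows "t + (s - t choose (r - 1)) < s choose (r - 1)"
proof (cases "t = 1")
  case True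
  then show ?thesis using binomial_drop[OF assms(1,2)] assms by simp
next
  case False
  then show ?thesis using binomial_drop2[of r s t] assms by simp
qed

text \<open>Hubs outside \<open>R'\<close> lie in one edge each, and these edges form
  \<open>F1\<close>. When \<open>F1\<close> is set aside, only the hubs in \<open>R'\<close> remain
  beside the ancestors, at most \<open>s - card F1\<close> vertices in all; the fall of the binomial
  coefficient outweighs the edges set aside.\<close>

lemma chunk_edge_bound:
  fixes r s :: nat
  assumes fin: "finite V" "finite F" "finite R" and dis: "R \<inter> V = {}"
    and F: "\<And>g. g \<in> F \<Longrightarrow> g \<subseteq> V \<union> R \<and> card g = r \<and> g \<inter> V \<noteq> {}"
    and rs: "3 \<le> r" "r \<le> s" and R: "R \<subseteq> \<Union>F" and a: "a \<in> R"
    and con: "\<And>x y. x \<in> V \<Longrightarrow> y \<in> V \<Longrightarrow> (x, y) \<in> (adj F V)\<^sup>*"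
    and noend: "\<And>xs es. bpath F (a # xs) es \<Longrightarrow> set xs \<subseteq> V \<Longrightarrow> length xs \<le> L"
    and R': "R' = {b \<in> R. linked F b b}"
    and F1: "F1 = {e \<in> F. \<exists>b\<in>R - R'. b \<in> e}"
    and L: "2 * L + card R + card R' + card F1 \<le> 2 * s + 3"
  shows "card F \<le> (s choose (r - 1)) * card V"
    and "card F = (s choose (r - 1)) * card V \<Longrightarrow> card V = 1 \<and> card R = s"
proof -
  let ?K = "s choose (r - 1)"
  obtain e0 where e0: "e0 \<in> F" "a \<in> e0" using R a by blast
  obtain x0 where x0: "x0 \<in> e0" "x0 \<in> V" using F[OF e0(1)] by blast
  have V0: "V \<noteq> {}" "0 < card V" using x0 fin by (auto simp: card_gt_0_iff)
  have "bpath F (a # [x0]) [e0]" using e0 x0 a dis by (auto simp: bpath_def)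
  from noend[OF this] have L1: "1 \<le> L" using x0 by simp
  have att: "attached F V a"
    unfolding attached_def using con x0 e0 by blast
  have finR': "finite R'" "R' \<subseteq> R" using fin R' by auto
  have unique: "e = f" if "b \<in> R - R'" "e \<in> F" "f \<in> F" "b \<in> e" "b \<in> f" for b e f
    using that unfolding R' linked_def by blast
  have "\<forall>e\<in>F1. \<exists>b. b \<in> R - R' \<and> b \<in> e" by (auto simp: F1)
  then obtain p where p: "\<And>e. e \<in> F1 \<Longrightarrow> p e \<in> R - R' \<and> p e \<in> e" by metis
  have "inj_on p F1"
  proof (rule inj_onI)
    fix e f assume "e \<in> F1" "f \<in> F1" "p e = p f"
    then show "e = f" using p[of e] p[of f] unique[of "p e" e f] by (auto simp: F1)
  qed
  then have "card F1 \<le> card (R - R')" using p fin by (intro card_inj_on_le) auto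
  moreover have "card R' \<le> card R" using finR' fin by (intro card_mono)
  moreover have "card (R - R') = card R - card R'" using finR' by (rule card_Diff_subset)
  ultimately have cR: "card R' + card F1 \<le> card R" by linarith
  \<comment> \<open>Halving \<open>2 * (L + card R' + card F1) \<le> 2 * s + 3\<close> rounds down,
    so the extra vertex available for odd \<open>k\<close> does no harm here.\<close>
  have RL: "card R' + card F1 + L \<le> s + 1" using L cR by linarith
  have "card F \<le> ?K * card V \<and> (card F = ?K * card V \<longrightarrow> card V = 1 \<and> card R = s)"
  proof (cases "F1 = {}")
    case True
    have "R' = R"
    proof -
      have False if "b \<in> R" "b \<notin> R'" for b
        using that R True unfolding F1 by blast
      then show ?thesis using finR' by blast
    qed
    then have RL': "card R + L \<le> s + 1" using RL by simp
    have Fg: "g \<subseteq> V \<union> R \<and> card g = r" if "g \<in> F" for g using F[OF that] by blast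
    have touch: "g \<inter> V \<noteq> {}" if "g \<in> F" for g using F[OF that] by blast
    note EB = edge_bound[of V F R r s a L, OF fin dis Fg touch rs a RL' noend att]
    have le: "card F \<le> ?K * card V" by (rule EB(1))
    have lt: "card F < ?K * card V"
      if "card R < s \<or> (2 \<le> card V \<and> (\<forall>x\<in>V. \<forall>y\<in>V. (x, y) \<in> (adj F V)\<^sup>*))"
      using V0(1) that by (intro EB(2))
    have "card V = 1 \<and> card R = s" if "card F = ?K * card V"
    proof -
      have "\<not> card R < s" "\<not> 2 \<le> card V" using lt that con by auto
      then show ?thesis using RL' L1 V0 by linarith
    qed
    then show ?thesis using le by blast
  next
    case False
    define t where "t = card F1"
    have finF1: "finite F1" "F1 \<subseteq> F" using fin by (auto simp: F1)
    have t: "1 \<le> t" "t \<le> s"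
      using False finF1 RL L1 by (auto simp: t_def card_gt_0_iff Suc_le_eq)
    define F0 where "F0 = F - F1"
    have F0: "g \<subseteq> V \<union> R' \<and> card g = r \<and> g \<inter> V \<noteq> {} \<and> g \<in> F" if "g \<in> F0" for g
      using that F[of g] unfolding F0_def F1 by blast
    have finF0: "finite F0" using fin by (simp add: F0_def)
    have cF: "card F = t + card F0"
      using finF1 fin unfolding F0_def t_def by (simp add: card_Diff_subset card_mono)
    have "card F < ?K * card V"
    proof (cases "2 \<le> card V")
      case True
      \<comment> \<open>The \<open>+ 1\<close> covers the entering edge \<open>e\<close>, which may
        reach beyond the ancestors. The edges of \<open>F1\<close> are still open to the search, but
        they are not counted.\<close>
      have pay: "card ({g \<in> F0 - set es. w \<in> g \<and> g \<inter> V \<subseteq> insert w (set ys)} \<union> ({e} \<inter> F0))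
          \<le> (s - t choose (r - 1)) + 1"
        if h: "bpath F (a # ys @ [w]) (es @ [e])" "set ys \<subseteq> V" "w \<in> V" for ys w es e
      proof -
        have "length (ys @ [w]) \<le> L" using noend[of "ys @ [w]"] h by auto
        then have "card R' + length ys \<le> s - t" using RL by (simp add: t_def)
        then have X: "card (R' \<union> set ys) \<le> s - t"
          using card_Un_le[of R' "set ys"] card_length[of ys] by linarith
        have "card {g \<in> F0. w \<in> g \<and> g \<inter> V \<subseteq> insert w (set ys)} \<le> card (R' \<union> set ys) choose (r - 1)"
          using finR' F0 by (intro card_link_le) blast+
        also have "\<dots> \<le> s - t choose (r - 1)" using X by (rule binomial_right_mono)
        finally have 1: "card {g \<in> F0. w \<in> g \<and> g \<inter> V \<subseteq> insert w (set ys)} \<le> s - t choose (r - 1)" .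
        have "card ({g \<in> F0 - set es. w \<in> g \<and> g \<inter> V \<subseteq> insert w (set ys)} \<union> ({e} \<inter> F0))
            \<le> card (insert e {g \<in> F0. w \<in> g \<and> g \<inter> V \<subseteq> insert w (set ys)})"
          using finF0 by (intro card_mono) auto
        also have "\<dots> \<le> Suc (card {g \<in> F0. w \<in> g \<and> g \<inter> V \<subseteq> insert w (set ys)})"
          by (rule card_insert_le_m1) auto
        finally show ?thesis using 1 by simp
      qed
      have "card F0 \<le> ((s - t choose (r - 1)) + 1) * card V"
      proof (rule conjunct2[OF search_tree_count])
        show "finite V" "finite F0" "F0 \<subseteq> F" "a \<notin> V" "attached F V a"
          using fin finF0 a dis att by (auto simp: F0_def)
        show "g \<inter> V \<noteq> {}" if "g \<in> F0" for g using F0[OF that] by blast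
      qed (rule pay)
      then show ?thesis
        using binomial_drop_two_vertices[OF rs t True] cF by linarith
    next
      case False
      then have V1: "card V = 1" using V0 by linarith
      then obtain v where v: "V = {v}" by (meson card_1_singletonE)
      have "card F0 \<le> card R' choose (r - 1)"
        using finR' F0 v by (intro card_link_le[of _ _ _ v]) blast+
      also have "\<dots> \<le> s - t choose (r - 1)"
        using RL L1 by (intro binomial_right_mono) (simp add: t_def)
      finally have c: "card F0 \<le> s - t choose (r - 1)" .
      show ?thesis
      proof (cases "t < s")
        case True
        then show ?thesis using c cF V1 binomial_drop_one_vertex[OF rs t(1)] by simp
      next
        case False
        \<comment> \<open>Now \<open>L = 1\<close> and \<open>R'\<close> is empty. The edges share
          only \<open>v\<close>, so each uses at least two hubs of its own; at least
          \<open>s\<close> edges would need \<open>2 * s\<close> hubs, while the hypothesis on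
          \<open>L\<close> allows only \<open>s + 1\<close>.\<close>
        then have ts: "t = s" using t by simp
        then have "card R' = 0" using RL L1 unfolding t_def by linarith
        then have "R' = {}" using finR' by simp
        then have uniq: "e = f" if "b \<in> R" "e \<in> F" "f \<in> F" "b \<in> e" "b \<in> f" for b e f
          using unique that by blast
        have "(\<Sum>g\<in>F. card (g - {v})) = card (\<Union>g\<in>F. g - {v})"
        proof (rule card_UN_disjoint[symmetric])
          show "\<forall>g\<in>F. finite (g - {v})" using F fin by (meson finite_Diff finite_Un finite_subset)
          have "x \<in> R" if "g \<in> F" "x \<in> g - {v}" for g x using F that v by blast
          then show "\<forall>g\<in>F. \<forall>h\<in>F. g \<noteq> h \<longrightarrow> (g - {v}) \<inter> (h - {v}) = {}"
            using uniq by blast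
        qed (rule fin)
        also have "\<dots> \<le> card R" using F v fin by (intro card_mono) blast+
        finally have 1: "(\<Sum>g\<in>F. card (g - {v})) \<le> card R" .
        have "2 \<le> card (g - {v})" if "g \<in> F" for g
        proof -
          have "v \<in> g" using F[OF that] v by blast
          then show ?thesis using F[OF that] rs by (simp add: card_Diff_singleton_if)
        qed
        then have "(\<Sum>g\<in>F. 2) \<le> (\<Sum>g\<in>F. card (g - {v}))" by (rule sum_mono)
        then have "2 * card F \<le> card R" using 1 by simp
        then have "2 * s \<le> card R" using cF ts by linarith
        moreover have "2 + card R + s \<le> 2 * s + 3" using L L1 ts by (simp add: t_def)
        ultimately show ?thesis using rs by linarith
      qed
    qed
    then show ?thesis by simp
  qed
  then show "card F \<le> ?K * card V" "card F = ?K * card V \<Longrightarrow> card V = 1 \<and> card R = s" by blast+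
qed

text \<open>Being a hub is thus visible in the end paths of a chunk, and profiles need no separate
  entry for it.\<close>

lemma mem_hubs_iff:
  assumes "a \<notin> W"
  shows "a \<in> \<Union>(touching E W) \<longleftrightarrow> end_path (touching E W) W a 1"
proof
  assume "a \<in> \<Union>(touching E W)"
  then obtain e x where e: "e \<in> touching E W" "a \<in> e" "x \<in> e" "x \<in> W" by (auto simp: touching_def)
  then have "bpath (touching E W) [a, x] [e]" using assms by (auto simp: bpath_def)
  then show "end_path (touching E W) W a 1"
    unfolding end_path_def using e by (intro exI[of _ "[x]"] exI[of _ "[e]"]) simp
next
  assume "end_path (touching E W) W a 1"
  then obtain xs es where p: "bpath (touching E W) (a # xs) es" "length xs = 1"
    unfolding end_path_def by blast
  then obtain e where "es = [e]" using bpath_length[OF p(1)] by (cases es) auto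
  then show "a \<in> \<Union>(touching E W)"
    using p berge_walk_nth[of "a # xs" es 0] by (auto simp: bpath_def)
qed

lemma end_path_Max:
  assumes "finite W"
  shows "\<exists>L. end_path F W a L \<and> (\<forall>xs es. bpath F (a # xs) es \<longrightarrow> set xs \<subseteq> W \<longrightarrow> length xs \<le> L)"
proof -
  have bd: "l \<le> card W" if l: "end_path F W a l" for l
  proof -
    obtain xs es where p: "bpath F (a # xs) es" "set xs \<subseteq> W" "length xs = l"
      using l unfolding end_path_def by blast
    then have "card (set xs) = l" by (simp add: bpath_def distinct_card)
    then show ?thesis using card_mono[OF assms p(2)] by simp
  qed
  have "end_path F W a 0"
    unfolding end_path_def by (intro exI[of _ "[]"]) (simp add: bpath_def)
  then have "end_path F W a (GREATEST l. end_path F W a l)"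
    by (rule GreatestI_nat[where b = "card W"]) (rule bd)
  moreover have "length xs \<le> (GREATEST l. end_path F W a l)"
    if h: "bpath F (a # xs) es" "set xs \<subseteq> W" for xs es
  proof -
    have "end_path F W a (length xs)" using h unfolding end_path_def by blast
    then show ?thesis by (rule Greatest_le_nat[where b = "card W"]) (rule bd)
  qed
  ultimately show ?thesis by blast
qed

lemma linked_sym: "linked F a b \<Longrightarrow> linked F b a"
  unfolding linked_def by blast

context clones
begin

text \<open>Two hubs cannot be joined through an inner vertex of a clone only if both lie in a single, common
  edge of it. So the hubs in at least two edges (\<open>R'\<close>), together with one further hub for
  each edge in \<open>F1\<close>, are pairwise linked; they are placed first on the path.\<close>

lemma root_with_short_end_paths:
  assumes fin: "finite P" "finite \<W>" "\<And>W. W \<in> \<W> \<Longrightarrow> finite W" "finite E"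
    and prof: "\<And>W W' a l. W \<in> \<W> \<Longrightarrow> W' \<in> \<W> \<Longrightarrow> a \<in> P \<Longrightarrow>
        end_path (touching E W) W a l \<Longrightarrow> end_path (touching E W') W' a l"
      "\<And>W W' a b. W \<in> \<W> \<Longrightarrow> W' \<in> \<W> \<Longrightarrow> a \<in> P \<Longrightarrow> b \<in> P \<Longrightarrow>
        linked (touching E W) a b \<Longrightarrow> linked (touching E W') a b"
    and many: "card P + 2 \<le> card \<W>"
    and short: "\<And>xs es. bpath E xs es \<Longrightarrow> length xs \<le> 2 * s + 2"
    and W: "W \<in> \<W>" and R: "R = \<Union>(touching E W) \<inter> P" "R \<noteq> {}"
    and R': "R' = {b \<in> R. linked (touching E W) b b}"
    and F1: "F1 = {e \<in> touching E W. \<exists>b\<in>R - R'. b \<in> e}"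
  shows "\<exists>a\<in>R. \<exists>L. (\<forall>xs es. bpath (touching E W) (a # xs) es \<longrightarrow> set xs \<subseteq> W \<longrightarrow> length xs \<le> L) \<and>
    2 * L + card R + card R' + card F1 \<le> 2 * s + 3"
proof -
  let ?F = "touching E W"
  have finR: "finite R" "finite R'" "R' \<subseteq> R" "R \<subseteq> P" using fin R R' by auto
  have unique: "e = f" if "b \<in> R - R'" "e \<in> ?F" "f \<in> ?F" "b \<in> e" "b \<in> f" for b e f
    using that unfolding R' linked_def by blast
  have "\<forall>e\<in>F1. \<exists>b. b \<in> R - R' \<and> b \<in> e" by (auto simp: F1)
  then obtain p where p: "\<And>e. e \<in> F1 \<Longrightarrow> p e \<in> R - R' \<and> p e \<in> e" by metis
  have F1F: "F1 \<subseteq> ?F" by (auto simp: F1)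
  have inj: "inj_on p F1"
  proof (rule inj_onI)
    fix e f assume "e \<in> F1" "f \<in> F1" "p e = p f"
    then show "e = f" using p[of e] p[of f] unique[of "p e" e f] by (auto simp: F1)
  qed
  define S where "S = R' \<union> p ` F1"
  have "finite ?F" using fin by (simp add: touching_def)
  then have "finite F1" using F1F finite_subset by blast
  then have cS: "card S = card R' + card F1"
    unfolding S_def using finR p inj by (subst card_Un_disjoint) (auto simp: card_image)
  have SR: "S \<subseteq> R" using finR p by (auto simp: S_def)
  have S0: "S \<noteq> {}"
  proof -
    obtain b where b: "b \<in> R" using R by blast
    show ?thesis
    proof (cases "b \<in> R'")
      case False
      then obtain e where "e \<in> F1" using b R F1 by auto
      then show ?thesis by (auto simp: S_def)
    qed (auto simp: S_def)
  qed
  have lk1: "linked ?F a b" if "a \<in> R'" "b \<in> R" for a b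
    using that unfolding R' R linked_def by blast
  have lk: "linked ?F a b" if ab: "a \<in> S" "b \<in> S" "a \<noteq> b" for a b
  proof (cases "a \<in> R' \<or> b \<in> R'")
    case True
    then show ?thesis
    proof
      assume "a \<in> R'"
      then show ?thesis using lk1[of a b] that SR by blast
    next
      assume "b \<in> R'"
      then show ?thesis using lk1[of b a] linked_sym[of ?F b a] that SR by blast
    qed
  next
    case False
    then obtain e f where e: "e \<in> F1" "f \<in> F1" "a = p e" "b = p f" using ab by (auto simp: S_def)
    then have "e \<noteq> f" "a \<in> e" "b \<in> f" using ab p by auto
    then show ?thesis unfolding linked_def using e F1F by blast
  qed
  obtain xs where xs: "set xs = S" "distinct xs"
    using finite_distinct_list[OF finite_subset[OF SR finR(1)]] by blast
  obtain ys where ys: "set ys = R - S" "distinct ys"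
    using finite_distinct_list[of "R - S"] finR by blast
  define hs where "hs = xs @ ys"
  have hs: "distinct hs" "set hs = R" "hs \<noteq> []" using xs ys SR S0 by (auto simp: hs_def)
  have lhs: "length hs = card R" using hs distinct_card by fastforce
  have "length xs = card S" using xs distinct_card by fastforce
  then have gain: "card S \<le> Suc (gain (linked ?F) hs)"
    unfolding hs_def using gain_append[of xs "linked ?F" ys] xs lk by simp
  define h t where "h = hd hs" and "t = last hs"
  have ht: "h \<in> R" "t \<in> R" using hs by (auto simp: h_def t_def)
  obtain Lh where Lh: "end_path ?F W h Lh"
      "\<And>xs es. bpath ?F (h # xs) es \<Longrightarrow> set xs \<subseteq> W \<Longrightarrow> length xs \<le> Lh"
    using end_path_Max[OF fin(3)[OF W], of ?F h] by blast
  obtain Lt where Lt: "end_path ?F W t Lt"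
      "\<And>xs es. bpath ?F (t # xs) es \<Longrightarrow> set xs \<subseteq> W \<Longrightarrow> length xs \<le> Lt"
    using end_path_Max[OF fin(3)[OF W], of ?F t] by blast
  \<comment> \<open>Two clones are kept for the ends. By equality of profiles they admit end paths
    of the lengths \<open>Lh\<close> and \<open>Lt\<close>, which are the longest in
    \<open>W\<close>.\<close>
  obtain W1 where W1: "W1 \<in> \<W>" using W by blast
  have "card (\<W> - {W1}) \<noteq> 0" using many fin W1 by simp
  then have "\<W> - {W1} \<noteq> {}" by fastforce
  then obtain W2 where W2: "W2 \<in> \<W>" "W2 \<noteq> W1" by blast
  define \<W>' where "\<W>' = \<W> - {W1, W2}"
  have "card \<W>' = card \<W> - 2" unfolding \<W>'_def using W1 W2 fin by (simp add: card_Diff_subset)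
  moreover have "card R \<le> card P" using finR fin by (intro card_mono)
  ultimately have c': "length hs \<le> Suc (card \<W>')" using many lhs by linarith
  have sub: "\<W>' \<subseteq> \<W>" by (auto simp: \<W>'_def)
  have "\<exists>xs es. bpath (\<Union>W\<in>\<W>'. touching E W) (hd hs # xs) es \<and>
      set (hd hs # xs) \<subseteq> set hs \<union> \<Union>\<W>' \<and> last (hd hs # xs) = last hs \<and>
      length hs + gain (linked ?F) hs \<le> length (hd hs # xs)"
  proof (rule hub_path[OF _ _ hs(1,3) _ _ sub c'])
    show "a \<in> \<Union>(touching E W')" if "W' \<in> \<W>'" "a \<in> set hs" for W' a
    proof -
      have a: "a \<in> P" "a \<in> \<Union>?F" using that hs R by auto
      have W': "W' \<in> \<W>" using that sub by blast
      have "a \<notin> W" "a \<notin> W'" using a outside[OF W] outside[OF W'] by auto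
      then show ?thesis using mem_hubs_iff[of a W E] mem_hubs_iff[of a W' E] a prof(1)[OF W W'] by blast
    qed
    show "linked (touching E W') a b" if "W' \<in> \<W>'" "linked ?F a b" "a \<in> set hs" "b \<in> set hs" for W' a b
      using prof(2)[OF W, of W' a b] that sub hs finR by blast
    show "set hs \<subseteq> P" using hs finR by simp
    show "finite \<W>'" using fin by (simp add: \<W>'_def)
  qed
  then obtain zs es where m: "bpath (\<Union>W\<in>\<W>'. touching E W) (h # zs) es"
      "set (h # zs) \<subseteq> R \<union> \<Union>\<W>'" "last (h # zs) = t" "card R + gain (linked ?F) hs \<le> length (h # zs)"
    using hs lhs by (auto simp: h_def t_def)
  obtain us fs where us: "bpath (touching E W1) (h # us) fs" "set us \<subseteq> W1" "length us = Lh"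
    using prof(1)[OF W W1 _ Lh(1)] ht finR unfolding end_path_def by blast
  obtain vs gs where vs: "bpath (touching E W2) (t # vs) gs" "set vs \<subseteq> W2" "length vs = Lt"
    using prof(1)[OF W W2(1) _ Lt(1)] ht finR unfolding end_path_def by blast
  have tE: "touching E W' \<subseteq> E" for W' by (auto simp: touching_def)
  have dW: "W' \<inter> (R \<union> \<Union>\<W>') = {}" if "W' \<in> {W1, W2}" for W'
  proof -
    have "W' \<in> \<W>" using that W1 W2 by blast
    moreover have "W' \<inter> W'' = {}" if "W'' \<in> \<W>'" for W''
      using disjoint[OF \<open>W' \<in> \<W>\<close>, of W''] that \<open>W' \<in> {W1, W2}\<close> by (auto simp: \<W>'_def)
    ultimately show ?thesis using outside[of W'] finR by blast
  qed
  have dE: "touching E W' \<inter> touching E W'' = {}" if "W' \<in> {W1, W2}" "W'' \<in> \<W>'" for W' W''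
    using touching_disjoint[of W' W''] that W1 W2 by (auto simp: \<W>'_def)
  have es: "set es \<subseteq> (\<Union>W\<in>\<W>'. touching E W)" "set fs \<subseteq> touching E W1" "set gs \<subseteq> touching E W2"
    using m us vs by (auto simp: bpath_def)
  have e1: "set es \<inter> set fs = {}" using es dE[of W1] by blast
  have e2: "set es \<inter> set gs = {}" using es dE[of W2] by blast
  have e3: "set fs \<inter> set gs = {}" using es touching_disjoint[OF W1 W2(1)] W2 by blast
  have v1: "set us \<inter> set (h # zs) = {}" using us(2) m(2) dW[of W1] by blast
  have v2: "set vs \<inter> set (h # zs) = {}" using vs(2) m(2) dW[of W2] by blast
  have v3: "set us \<inter> set vs = {}" using us(2) vs(2) disjoint[OF W1 W2(1)] W2 by blast
  have mE: "bpath E (h # zs) es" using bpath_mono[OF m(1)] tE by blast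
  have fE: "bpath E (h # us) fs" using bpath_mono[OF us(1) tE] .
  have gE: "bpath E (last (h # zs) # vs) gs" unfolding m(3) using bpath_mono[OF vs(1) tE] .
  obtain ws ks where "bpath E ws ks" "length ws = length us + length (h # zs) + length vs"
    using bpath_attach_ends[OF mE fE gE v1 v2 v3 e1 e2 e3] .
  then have "Lh + length (h # zs) + Lt \<le> 2 * s + 2" using short us(3) vs(3) by metis
  \<comment> \<open>The \<open>card R' + card F1\<close> pairwise linked hubs have one consecutive
    pair fewer, which turns \<open>2 * s + 2\<close> into \<open>2 * s + 3\<close>. The hub with the
    shorter end paths becomes the root, since twice the smaller length is at most the sum.\<close>
  then have tot: "Lh + Lt + card R + card R' + card F1 \<le> 2 * s + 3"
    using m(4) gain cS by linarith
  show ?thesis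
  proof (cases "Lh \<le> Lt")
    case True
    then show ?thesis using Lh(2) ht(1) tot by (intro bexI[of _ h] exI[of _ Lh]) auto
  next
    case False
    then show ?thesis using Lt(2) ht(2) tot by (intro bexI[of _ t] exI[of _ Lt]) auto
  qed
qed

lemma clone_edge_bound:
  assumes fin: "finite P" "finite \<W>" "\<And>W. W \<in> \<W> \<Longrightarrow> finite W" "finite E"
    and prof: "\<And>W W' a l. W \<in> \<W> \<Longrightarrow> W' \<in> \<W> \<Longrightarrow> a \<in> P \<Longrightarrow>
        end_path (touching E W) W a l \<Longrightarrow> end_path (touching E W') W' a l"
      "\<And>W W' a b. W \<in> \<W> \<Longrightarrow> W' \<in> \<W> \<Longrightarrow> a \<in> P \<Longrightarrow> b \<in> P \<Longrightarrow>
        linked (touching E W) a b \<Longrightarrow> linked (touching E W') a b"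
    and many: "card P + 2 \<le> card \<W>"
    and short: "\<And>xs es. bpath E xs es \<Longrightarrow> length xs \<le> 2 * s + 2"
    and W: "W \<in> \<W>" and R: "R = \<Union>(touching E W) \<inter> P" "R \<noteq> {}"
    and r: "\<And>e. e \<in> E \<Longrightarrow> card e = r" and rs: "3 \<le> r" "r \<le> s"
  shows "card (touching E W) \<le> (s choose (r - 1)) * card W"
    and "card (touching E W) = (s choose (r - 1)) * card W \<Longrightarrow> card W = 1 \<and> card R = s"
proof -
  have "\<exists>a\<in>R. \<exists>L. (\<forall>xs es. bpath (touching E W) (a # xs) es \<longrightarrow> set xs \<subseteq> W \<longrightarrow> length xs \<le> L) \<and>
    2 * L + card R + card {b \<in> R. linked (touching E W) b b} +
      card {e \<in> touching E W. \<exists>b\<in>R - {b \<in> R. linked (touching E W) b b}. b \<in> e} \<le> 2 * s + 3"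
  proof (rule root_with_short_end_paths[OF fin _ _ many short W R refl refl])
    show "end_path (touching E W') W' a l"
      if "W \<in> \<W>" "W' \<in> \<W>" "a \<in> P" "end_path (touching E W) W a l" for W W' a l
      using prof(1) that .
    show "linked (touching E W') a b"
      if "W \<in> \<W>" "W' \<in> \<W>" "a \<in> P" "b \<in> P" "linked (touching E W) a b" for W W' a b
      using prof(2) that .
  qed
  then obtain a L where aL: "a \<in> R"
    "\<And>xs es. bpath (touching E W) (a # xs) es \<Longrightarrow> set xs \<subseteq> W \<Longrightarrow> length xs \<le> L"
    "2 * L + card R + card {b \<in> R. linked (touching E W) b b} +
      card {e \<in> touching E W. \<exists>b\<in>R - {b \<in> R. linked (touching E W) b b}. b \<in> e} \<le> 2 * s + 3"
    by blast
  have g: "g \<subseteq> W \<union> R \<and> card g = r \<and> g \<inter> W \<noteq> {}" if "g \<in> touching E W" for g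
    using edges[OF W that] that r R unfolding touching_def by blast
  have 1: "finite W" "finite (touching E W)" "finite R" "R \<inter> W = {}" "R \<subseteq> \<Union>(touching E W)"
    using fin W R outside[OF W] by (auto simp: touching_def)
  note B = chunk_edge_bound[of W "touching E W" R r s a L, OF 1(1-4) g rs 1(5) aL(1) con[OF W] aL(2) refl refl aL(3)]
  show "card (touching E W) \<le> (s choose (r - 1)) * card W" by (rule B(1))
  show "card W = 1 \<and> card R = s" if "card (touching E W) = (s choose (r - 1)) * card W"
    using that by (intro B(2))
qed

end

section \<open>Hypergraphs with a complete core\<close>

lemma leave_set:
  assumes "(x, y) \<in> (adj F W)\<^sup>*" "x \<in> U" "y \<notin> U"
  shows "\<exists>u\<in>U \<inter> W. \<exists>v\<in>W - U. \<exists>g\<in>F. u \<in> g \<and> v \<in> g"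
proof -
  have "y \<in> U \<or> (\<exists>u v. u \<in> U \<and> v \<notin> U \<and> (u, v) \<in> adj F W)"
    using assms(1) by (induction rule: rtrancl_induct) (use assms(2) in auto)
  then show ?thesis using assms(3) by (auto simp: adj_def)
qed

lemma card_link2_le:
  assumes "finite A" "u \<noteq> w" "\<And>g. g \<in> G \<Longrightarrow> card g = r \<and> u \<in> g \<and> w \<in> g \<and> g \<subseteq> insert u (insert w A)"
    and "u \<notin> A"
  shows "card G \<le> card A choose (r - 2)"
proof -
  have "card G = card ((\<lambda>g. g - {u}) ` G)"
  proof (rule card_image[symmetric], rule inj_onI)
    fix g h assume "g \<in> G" "h \<in> G" "g - {u} = h - {u}"
    moreover from this have "u \<in> g" "u \<in> h" using assms(3) by auto
    ultimately show "g = h" by blast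
  qed
  also have "\<dots> \<le> card A choose (r - 1 - 1)"
  proof (rule card_link_le[OF assms(1)])
    fix h assume "h \<in> (\<lambda>g. g - {u}) ` G"
    then obtain g where g: "g \<in> G" "h = g - {u}" by blast
    have "card h = r - 1" using g assms(3)[OF g(1)] by (simp add: card_Diff_singleton_if)
    moreover have "w \<in> h" "h \<subseteq> insert w A" using g assms(3)[OF g(1)] assms(2) by auto
    ultimately show "card h = r - 1 \<and> w \<in> h \<and> h \<subseteq> insert w A" by blast
  qed
  finally show ?thesis by (simp add: diff_diff_eq numeral_2_eq_2)
qed

text \<open>If two edges meet \<open>W\<close> in several vertices and \<open>W\<close> has at least three vertices, then only one vertex
  of \<open>W\<close> has an edge meeting \<open>W\<close> just there, and these few edges leave room for up to two edges per vertex
  of the other kind.\<close>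

lemma deep_component_bound:
  fixes r s :: nat
  assumes fin: "finite W" "finite F" "finite A" and dis: "A \<inter> W = {}" and A: "card A = s"
    and F: "\<And>g. g \<in> F \<Longrightarrow> g \<subseteq> W \<union> A \<and> card g = r \<and> g \<inter> W \<noteq> {}"
    and rs: "3 \<le> r" "r \<le> s" and a0: "a0 \<in> A" "a0 \<in> \<Union>F" and W2: "2 \<le> card W"
    and con: "\<And>x y. x \<in> W \<Longrightarrow> y \<in> W \<Longrightarrow> (x, y) \<in> (adj F W)\<^sup>*"
    and noend: "\<And>a xs es. a \<in> A \<Longrightarrow> bpath F (a # xs) es \<Longrightarrow> set xs \<subseteq> W \<Longrightarrow> length xs \<le> 2"
  shows "card F \<le> (s choose (r - 1)) * card W + (s choose (r - 2))"
proof -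
  let ?K = "s choose (r - 1)"
  define T where "T w = {g \<in> F. g \<inter> W = {w}}" for w
  define F2 where "F2 = {g \<in> F. \<forall>w. g \<inter> W \<noteq> {w}}"
  have finT: "finite (T w)" "finite F2" for w using fin by (auto simp: T_def F2_def)
  have cT: "card (T w) \<le> ?K" for w
    unfolding A[symmetric] using fin F by (intro card_link_le[of _ _ _ w]) (fastforce simp: T_def)+
  have "F = (\<Union>w\<in>W. T w) \<union> F2"
    using F by (auto simp: T_def F2_def)
  then have "card F \<le> card (\<Union>w\<in>W. T w) + card F2" using card_Un_le by metis
  moreover have "card (\<Union>w\<in>W. T w) \<le> (\<Sum>w\<in>W. card (T w))" by (rule card_UN_le[OF fin(1)])
  ultimately have cF: "card F \<le> (\<Sum>w\<in>W. card (T w)) + card F2" by linarith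
  have cT': "(\<Sum>w\<in>W. card (T w)) \<le> ?K * card W"
    using sum_bounded_above[of W "\<lambda>w. card (T w)" ?K] cT by (simp add: mult.commute)
  have no3: False
    if "a \<in> A" "a \<in> e1" "x \<in> e1" "x \<in> e2" "y \<in> e2" "y \<in> e3" "z \<in> e3" "{x, y, z} \<subseteq> W" "{e1, e2, e3} \<subseteq> F"
      "distinct [x, y, z]" "distinct [e1, e2, e3]" for a x y z e1 e2 e3
  proof -
    have "a \<notin> {x, y, z}" using that dis by blast
    then have "bpath F (a # [x, y, z]) [e1, e2, e3]" using that by (auto simp: bpath_def)
    from noend[OF that(1) this] show False using that by simp
  qed
  \<comment> \<open>Edges have at least three vertices, so one with at most two in \<open>W\<close>
    reaches \<open>A\<close> and can begin an end path.\<close>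
  have hubA: "\<exists>a\<in>A. a \<in> g" if "g \<in> F" "card (g \<inter> W) \<le> 2" for g
  proof (rule ccontr)
    assume "\<not> ?thesis"
    then have "g \<inter> W = g" using F[OF that(1)] by blast
    then show False using F[OF that(1)] that(2) rs by simp
  qed
  consider "card F2 \<le> 1" | "card W = 2" | "3 \<le> card W" "\<not> card F2 \<le> 1" using W2 by linarith
  then show ?thesis
  proof cases
    case 1
    have "1 \<le> s choose (r - 2)" using rs zero_less_binomial[of "r - 2" s] by linarith
    then show ?thesis using cF cT' 1 by linarith
  next
    case 2
    then obtain u w where W: "W = {u, w}" "u \<noteq> w" by (meson card_2_iff)
    have "card F2 \<le> card A choose (r - 2)"
    proof (rule card_link2_le[OF fin(3) W(2)])
      fix g assume g: "g \<in> F2"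
      then have gF: "g \<in> F" "g \<inter> W \<noteq> {u}" "g \<inter> W \<noteq> {w}" by (auto simp: F2_def)
      then have "u \<in> g" "w \<in> g" using F[OF gF(1)] W by blast+
      then show "card g = r \<and> u \<in> g \<and> w \<in> g \<and> g \<subseteq> insert u (insert w A)"
        using F[OF gF(1)] W by blast
    qed (use W dis in auto)
    then show ?thesis using cF cT' unfolding A by linarith
  next
    case 3
    obtain f1 f2 where f12: "f1 \<in> F2" "f2 \<in> F2" "f1 \<noteq> f2"
      using 3(2) card_le_Suc0_iff_eq[OF finT(2)] by auto
    \<comment> \<open>Connectedness supplies an edge \<open>h\<close> leaving \<open>{u, w}\<close>,
      and \<open>f\<close>, \<open>g\<close>, \<open>h\<close> in this order would give an end path
      with three vertices of \<open>W\<close>.\<close>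
    have pair: "f = g" if fg: "f \<in> F" "g \<in> F" "f \<inter> W = {u, w}" "g \<inter> W = {u, w}" "u \<noteq> w" for f g u w
    proof (rule ccontr)
      assume ne: "f \<noteq> g"
      have uw: "u \<in> W" "w \<in> W" using fg by auto
      have "\<not> W \<subseteq> {u, w}" using 3(1) card_mono[of "{u, w}" W] fg(5) by auto
      then obtain x where x: "x \<in> W" "x \<notin> {u, w}" by blast
      have "(u, x) \<in> (adj F W)\<^sup>*" using con uw x by blast
      from leave_set[OF this, of "{u, w}"] x obtain y z h where
        h: "y \<in> {u, w}" "z \<in> W - {u, w}" "h \<in> F" "y \<in> h" "z \<in> h" by auto
      obtain y' where y': "y' \<in> {u, w}" "y' \<noteq> y" using fg(5) by blast
      have "h \<noteq> f" "h \<noteq> g" using h fg by blast+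
      have "card (f \<inter> W) \<le> 2" using fg by simp
      then obtain a where a: "a \<in> A" "a \<in> f" using hubA[OF fg(1)] by blast
      show False
        by (rule no3[of a f y' g y h z]) (use a h y' fg uw ne \<open>h \<noteq> f\<close> \<open>h \<noteq> g\<close> in auto)
    qed
    have T_F: "g \<in> F" "g \<notin> F2" "x \<in> g" if "g \<in> T x" for g x
      using that by (auto simp: T_def F2_def)
    have fat: "g \<in> F2" if "g \<in> F" "u \<in> g" "v \<in> g" "u \<in> W" "v \<in> W" "u \<noteq> v" for g u v
    proof -
      have "u \<in> g \<inter> W" "v \<in> g \<inter> W" using that by blast+
      then have "g \<inter> W \<noteq> {w}" for w using that(6) by (metis singletonD)
      then show ?thesis using that(1) by (simp add: F2_def)
    qed
    have no2: False
      if h: "g \<in> T x" "e1 \<in> F2" "e2 \<in> F2" "e1 \<noteq> e2" "x \<in> e1" "y \<in> e1" "y \<in> e2" "z \<in> e2"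
        "{x, y, z} \<subseteq> W" "distinct [x, y, z]" for g e1 e2 x y z
    proof -
      have "card (g \<inter> W) \<le> 2" using h(1) by (simp add: T_def)
      then obtain a where "a \<in> A" "a \<in> g" using hubA T_F(1)[OF h(1)] by blast
      moreover have "{g, e1, e2} \<subseteq> F" "distinct [g, e1, e2]"
        using h T_F[OF h(1)] by (auto simp: F2_def)
      ultimately show False using no3[of a g x e1 y e2 z] h T_F(3)[OF h(1)] by blast
    qed
    \<comment> \<open>Suppose \<open>f\<close> misses \<open>x\<close>. All of \<open>W\<close> must
      be joined to \<open>x\<close> by edges of \<open>F2\<close>, as otherwise \<open>g\<close>
      could be followed by two such edges leading away from \<open>x\<close>. But then
      \<open>g\<close>, an edge from \<open>x\<close> to a vertex of \<open>f\<close>, and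
      \<open>f\<close> itself form the forbidden path.\<close>
    have star: "x \<in> f" if x: "g \<in> T x" "f \<in> F2" "x \<in> W" for x f g
    proof (rule ccontr)
      assume xf: "x \<notin> f"
      define U where "U = insert x {y \<in> W. \<exists>e\<in>F2. x \<in> e \<and> y \<in> e}"
      have WU: "y \<in> U" if y: "y \<in> W" for y
      proof (rule ccontr)
        assume "y \<notin> U"
        have "(x, y) \<in> (adj F W)\<^sup>*" using con x y by blast
        moreover have "x \<in> U" by (simp add: U_def)
        ultimately have "\<exists>u\<in>U \<inter> W. \<exists>v\<in>W - U. \<exists>g\<in>F. u \<in> g \<and> v \<in> g"
          using \<open>y \<notin> U\<close> by (rule leave_set)
        then obtain u v h where h: "u \<in> U" "v \<in> W - U" "h \<in> F" "u \<in> h" "v \<in> h" "u \<in> W"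
          by blast
        have uv: "u \<noteq> v" using h by blast
        have hF2: "h \<in> F2" using fat[of h u v] h uv by blast
        have vx: "v \<noteq> x" "x \<notin> h" using h hF2 by (auto simp: U_def)
        then have "u \<noteq> x" using h by blast
        then obtain e where e: "e \<in> F2" "x \<in> e" "u \<in> e" using h(1) by (auto simp: U_def)
        have "e \<noteq> h" using e vx by blast
        show False
          using no2[OF x(1) e(1) hF2 \<open>e \<noteq> h\<close> e(2,3) h(4,5)] h x(3) uv vx \<open>u \<noteq> x\<close> by simp
      qed
      have fF: "f \<in> F" "\<And>w. f \<inter> W \<noteq> {w}" using x by (auto simp: F2_def)
      then obtain y where y: "y \<in> f" "y \<in> W" using F by blast
      have "\<not> f \<inter> W \<subseteq> {y}" using fF(2)[of y] y by blast
      then obtain z where z: "z \<in> f" "z \<in> W" "z \<noteq> y" by blast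
      have "y \<noteq> x" using y xf by blast
      then obtain e where e: "e \<in> F2" "x \<in> e" "y \<in> e" using WU[OF y(2)] by (auto simp: U_def)
      have "e \<noteq> f" using e xf by blast
      show False
        using no2[OF x(1) e(1) x(2) \<open>e \<noteq> f\<close> e(2,3) y(1) z(1)] x(3) y z xf by auto
    qed
    \<comment> \<open>A third vertex \<open>z\<close> lies in some \<open>e\<close> of
      \<open>F2\<close>, and \<open>F2\<close> has another edge \<open>f\<close>. By
      \<open>star\<close> both contain \<open>x\<close> and \<open>y\<close>, so an end path can go
      through \<open>g\<close>, \<open>f\<close>, \<open>e\<close> to \<open>x\<close>,
      \<open>y\<close>, \<open>z\<close>.\<close>
    have one: "x = y" if xy: "g \<in> T x" "h \<in> T y" "x \<in> W" "y \<in> W" for x y g h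
    proof (rule ccontr)
      assume ne: "x \<noteq> y"
      have "\<not> W \<subseteq> {x, y}" using 3(1) card_mono[of "{x, y}" W] ne by auto
      then obtain z where z: "z \<in> W" "z \<noteq> x" "z \<noteq> y" by blast
      have "(z, x) \<in> (adj F W)\<^sup>*" using con z xy by blast
      from leave_set[OF this, of "{z}"] z obtain v e where
        e: "v \<in> W" "v \<noteq> z" "e \<in> F" "z \<in> e" "v \<in> e" by blast
      then have e2: "e \<in> F2" using fat z by blast
      obtain f where f: "f \<in> F2" "f \<noteq> e" using f12 by metis
      show False
        using no2[OF xy(1) f(1) e2 f(2) star[OF xy(1) f(1) xy(3)] star[OF xy(2) f(1) xy(4)]
            star[OF xy(2) e2 xy(4)] e(4)] xy z ne by simp
    qed
    have cT1: "(\<Sum>w\<in>W. card (T w)) \<le> ?K"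
    proof (cases "\<exists>x\<in>W. T x \<noteq> {}")
      case True
      then obtain x g where x: "x \<in> W" "g \<in> T x" by blast
      have "(\<Sum>w\<in>W. card (T w)) \<le> (\<Sum>w\<in>W. if w = x then ?K else 0)"
      proof (rule sum_mono)
        fix w assume w: "w \<in> W"
        have "T w = {}" if "w \<noteq> x" using one[OF x(2) _ x(1) w] that by blast
        then show "card (T w) \<le> (if w = x then ?K else 0)" using cT by simp
      qed
      also have "\<dots> = ?K" using fin x by simp
      finally show ?thesis .
    next
      case False
      then show ?thesis by simp
    qed
    have "card F2 \<le> 2 * card W"
    proof (rule conjunct2[OF search_tree_count])
      show "finite W" "finite F2" "F2 \<subseteq> F" "a0 \<notin> W" using fin a0 dis by (auto simp: F2_def)
      show "g \<inter> W \<noteq> {}" if "g \<in> F2" for g using F that by (auto simp: F2_def)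
      obtain e0 where e0: "e0 \<in> F" "a0 \<in> e0" using a0 by blast
      then obtain x0 where "x0 \<in> e0" "x0 \<in> W" using F[OF e0(1)] by blast
      then show "attached F W a0" unfolding attached_def using con e0 by blast
      show "card ({g \<in> F2 - set es. w \<in> g \<and> g \<inter> W \<subseteq> insert w (set ys)} \<union> ({e} \<inter> F2)) \<le> 2"
        if h: "bpath F (a0 # ys @ [w]) (es @ [e])" "set ys \<subseteq> W" "w \<in> W" for ys w es e
      proof -
        let ?S = "{g \<in> F2. w \<in> g \<and> g \<inter> W \<subseteq> insert w (set ys)}"
        \<comment> \<open>With at most one vertex \<open>y\<close> before \<open>w\<close>, an edge
          of \<open>F2\<close> inside the ancestors meets \<open>W\<close> in \<open>{y, w}\<close>,
          and by \<open>pair\<close> there is at most one of these. The second unit is for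
          \<open>e\<close>.\<close>
        have "length ys \<le> 1" using noend[OF a0(1) h(1)] h by simp
        then obtain y where y: "set ys \<subseteq> {y}" by (cases ys) auto
        have "f = g" if fg: "f \<in> ?S" "g \<in> ?S" for f g
        proof -
          have "f \<inter> W = {y, w} \<and> y \<noteq> w" if "f \<in> ?S" for f
          proof -
            have "f \<inter> W \<noteq> {w}" "f \<inter> W \<subseteq> {y, w}" "w \<in> f" using that y by (auto simp: F2_def)
            then show ?thesis using h(3) by blast
          qed
          from this[OF fg(1)] this[OF fg(2)] show ?thesis
            using pair[of f g y w] fg by (auto simp: F2_def)
        qed
        then have "card ?S \<le> 1" using finT by (simp add: card_le_Suc0_iff_eq)
        have "card ({g \<in> F2 - set es. w \<in> g \<and> g \<inter> W \<subseteq> insert w (set ys)} \<union> ({e} \<inter> F2))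
            \<le> card (insert e ?S)" using finT by (intro card_mono) auto
        also have "\<dots> \<le> Suc (card ?S)" by (rule card_insert_le_m1) auto
        finally show ?thesis using \<open>card ?S \<le> 1\<close> by simp
      qed
    qed
    \<comment> \<open>This rests on \<open>3 \<le> ?K\<close> and \<open>3 \<le> card W\<close>: one
      vertex takes \<open>?K\<close> for its private edges, and two edges per vertex fit into the
      rest.\<close>
    moreover have "?K + 2 * card W \<le> ?K * card W"
    proof -
      obtain q where q: "card W = Suc (Suc (Suc q))" using 3(1) by (metis Suc_le_D numeral_3_eq_3 Suc_le_mono)
      have "s \<le> ?K" using rs by (intro le_binomial) auto
      then have "3 \<le> ?K" using rs by linarith
      then have "3 * Suc (Suc q) \<le> ?K * Suc (Suc q)" by (rule mult_le_mono1)
      then show ?thesis unfolding q by simp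
    qed
    ultimately show ?thesis using cF cT1 by linarith
  qed
qed

text \<open>The bound \<open>s + 6\<close> leaves room: a path through all of \<open>A\<close> takes
  \<open>s - 1\<close> vertices of \<open>Q\<close> between consecutive vertices of
  \<open>A\<close>, and it has to avoid up to five vertices of its ends.\<close>

locale core =
  fixes V :: "'a set" and E :: "'a set set" and A Q :: "'a set" and r s k :: nat
  assumes finV: "finite V" and E: "e \<in> E \<Longrightarrow> e \<subseteq> V \<and> card e = r"
    and rs: "3 \<le> r" "r \<le> s" and A: "A \<subseteq> V" "card A = s"
    and Q: "Q \<subseteq> V - A" "s + 6 \<le> card Q"
    and full: "v \<in> Q \<Longrightarrow> X \<subseteq> A \<Longrightarrow> card X = r - 1 \<Longrightarrow> insert v X \<in> E"
    and conV: "x \<in> V \<Longrightarrow> y \<in> V \<Longrightarrow> (x, y) \<in> (adj E V)\<^sup>*"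
    and short: "bpath E xs es \<Longrightarrow> length xs < k"
    and k: "k = 2 * s + 2 \<or> k = 2 * s + 3"
begin

lemma finA: "finite A"
  using finV A finite_subset by blast

text \<open>Added to a vertex of \<open>Q\<close>, the sets \<open>X\<close> and \<open>Y\<close>
  become two different edges, one through \<open>a\<close> and one through \<open>b\<close>; so any
  two vertices of \<open>A\<close> are linked there.\<close>

lemma obtain_link:
  assumes "a \<in> A" "b \<in> A" "a \<noteq> b"
  obtains X Y where "X \<subseteq> A" "Y \<subseteq> A" "card X = r - 1" "card Y = r - 1" "a \<in> X" "a \<notin> Y" "b \<in> Y"
proof -
  have c: "r - 2 \<le> card (A - {a, b})" using assms rs A finA by (simp add: card_Diff_subset)
  then obtain Z where Z: "Z \<subseteq> A - {a, b}" "card Z = r - 2" "finite Z"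
    using obtain_subset_with_card_n by metis
  have "card (insert a Z) = r - 1" "card (insert b Z) = r - 1"
    using Z rs by (auto simp: card_insert_if)
  then show ?thesis using that[of "insert a Z" "insert b Z"] Z assms by blast
qed

lemma spine:
  assumes ab: "a \<in> A" "b \<in> A" "a \<noteq> b" and Z: "finite Z" "card Z \<le> 5"
  shows "\<exists>xs es. bpath E (a # xs) es \<and> set (a # xs) \<subseteq> A \<union> (Q - Z) \<and> last (a # xs) = b \<and>
    2 * s - 1 \<le> length (a # xs) \<and> (\<forall>e\<in>set es. \<exists>v\<in>Q - Z. e - A = {v})"
proof -
  \<comment> \<open>Only the edges with one vertex in \<open>Q - Z\<close> and the rest in
    \<open>A\<close> are kept. Nothing in \<open>core\<close> prevents other edges from joining a
    vertex of \<open>Q\<close> to further vertices outside \<open>A\<close>, and then single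
    vertices would not be chunks in the sense of \<open>clones\<close>.\<close>
  define E' where "E' = {insert v X | v X. v \<in> Q - Z \<and> X \<subseteq> A \<and> card X = r - 1}"
  define \<W> where "\<W> = (\<lambda>v. {v}) ` (Q - Z)"
  have QA: "v \<notin> A" if "v \<in> Q" for v using that Q by blast
  have finQ: "finite Q" using Q finV finite_subset by blast
  have "E' \<subseteq> E" using full by (auto simp: E'_def)
  have t: "touching E' {v} = {insert v X | X. X \<subseteq> A \<and> card X = r - 1}" if "v \<in> Q - Z" for v
    using that QA by (fastforce simp: touching_def E'_def)
  interpret clones E' A \<W>
  proof
    show "W \<inter> A = {}" if "W \<in> \<W>" for W using that QA by (auto simp: \<W>_def)
    show "W \<inter> W' = {}" if "W \<in> \<W>" "W' \<in> \<W>" "W \<noteq> W'" for W W' using that by (auto simp: \<W>_def)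
    show "e \<subseteq> W \<union> A" if "W \<in> \<W>" "e \<in> touching E' W" for W e
      using that t by (auto simp: \<W>_def)
    show "(x, y) \<in> (adj (touching E' W) W)\<^sup>*" if "W \<in> \<W>" "x \<in> W" "y \<in> W" for W x y
      using that by (auto simp: \<W>_def)
  qed
  have lk: "linked (touching E' W) c d" if h: "W \<in> \<W>" "c \<in> A" "d \<in> A" "c \<noteq> d" for W c d
  proof -
    obtain v where v: "v \<in> Q - Z" "W = {v}" using h by (auto simp: \<W>_def)
    obtain X Y where XY: "X \<subseteq> A" "Y \<subseteq> A" "card X = r - 1" "card Y = r - 1" "c \<in> X" "c \<notin> Y" "d \<in> Y"
      using obtain_link[OF h(2-4)] .
    have "c \<noteq> v" using QA[of v] v h by blast
    then have "insert v X \<noteq> insert v Y" using XY by blast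
    moreover have "insert v X \<in> touching E' W" "insert v Y \<in> touching E' W"
      unfolding v(2) t[OF v(1)] using XY by auto
    ultimately show ?thesis
      unfolding linked_def using XY by (intro bexI[of _ "insert v X"] bexI[of _ "insert v Y"]) auto
  qed
  obtain mid where mid: "set mid = A - {a, b}" "distinct mid"
    using finite_distinct_list[of "A - {a, b}"] finA by blast
  define hs where "hs = a # mid @ [b]"
  have hs: "distinct hs" "set hs = A" "hs \<noteq> []" "hd hs = a" "last hs = b"
    using mid ab by (auto simp: hs_def)
  have lhs: "length hs = s" using distinct_card[OF hs(1)] hs(2) A by simp
  have gain: "s \<le> Suc (gain (\<noteq>) hs)" using gain_append[of hs "(\<noteq>)" "[]"] hs lhs by simp
  have "\<exists>xs es. bpath (\<Union>W\<in>\<W>. touching E' W) (hd hs # xs) es \<and>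
      set (hd hs # xs) \<subseteq> set hs \<union> \<Union>\<W> \<and> last (hd hs # xs) = last hs \<and>
      length hs + gain (\<noteq>) hs \<le> length (hd hs # xs)"
  proof (rule hub_path[OF _ _ hs(1,3) _ _ subset_refl])
    show "linked (touching E' W) c d" if "W \<in> \<W>" "c \<noteq> d" "c \<in> set hs" "d \<in> set hs" for W c d
      using lk that hs by blast
    show "c \<in> \<Union>(touching E' W)" if "W \<in> \<W>" "c \<in> set hs" for W c
    proof -
      obtain d where "d \<in> A" "c \<noteq> d" using ab by blast
      then show ?thesis using lk[OF that(1), of c d] that hs unfolding linked_def by blast
    qed
    show "set hs \<subseteq> A" "finite \<W>" using hs finQ by (auto simp: \<W>_def)
    have "card \<W> = card (Q - Z)" unfolding \<W>_def by (intro card_image) (auto simp: inj_on_def)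
    moreover have "card Q - card Z \<le> card (Q - Z)" by (rule diff_card_le_card_Diff[OF Z(1)])
    ultimately show "length hs \<le> Suc (card \<W>)" using Q Z lhs by linarith
  qed
  then obtain xs es where p: "bpath (\<Union>W\<in>\<W>. touching E' W) (a # xs) es"
      "set (a # xs) \<subseteq> A \<union> \<Union>\<W>" "last (a # xs) = b" "length hs + gain (\<noteq>) hs \<le> length (a # xs)"
    using hs by auto
  have sub: "(\<Union>W\<in>\<W>. touching E' W) \<subseteq> E'" by (auto simp: touching_def)
  have "bpath E (a # xs) es" using bpath_mono[OF p(1)] sub \<open>E' \<subseteq> E\<close> by blast
  moreover have "\<exists>v\<in>Q - Z. e - A = {v}" if "e \<in> set es" for e
  proof -
    have "e \<in> E'" using that p(1) sub by (auto simp: bpath_def)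
    then obtain v X where e: "e = insert v X" "v \<in> Q - Z" "X \<subseteq> A" by (auto simp: E'_def)
    then have "e - A = {v}" using QA[of v] by blast
    then show ?thesis using e by blast
  qed
  moreover have "set (a # xs) \<subseteq> A \<union> (Q - Z)" using p(2) by (simp add: \<W>_def)
  moreover have "2 * s - 1 \<le> length (a # xs)" using p(4) gain lhs by linarith
  ultimately show ?thesis using p(3) by blast
qed

text \<open>The spine contributes at least \<open>2 * s - 1\<close> vertices: \<open>s\<close> of
  \<open>A\<close> and \<open>s - 1\<close> of \<open>Q\<close>. Its edges have their only vertex
  outside \<open>A\<close> in \<open>Q - Z\<close>, while each edge of an end contains a vertex of
  \<open>Z\<close>, so no edge is used twice.\<close>

lemma two_ends:
  assumes ab: "a \<in> A" "b \<in> A" "a \<noteq> b"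
    and us: "bpath E (a # us) fs" "set us \<inter> A = {}" and vs: "bpath E (b # vs) gs" "set vs \<inter> A = {}"
    and dis: "set us \<inter> set vs = {}" "set fs \<inter> set gs = {}" and l: "length us + length vs \<le> 5"
  shows "length us + length vs + 2 * s < k + 1"
proof -
  define Z where "Z = set us \<union> set vs"
  have "card Z \<le> 5" unfolding Z_def
    using card_Un_le[of "set us" "set vs"] card_length[of us] card_length[of vs] l by linarith
  then obtain xs es where p: "bpath E (a # xs) es" "set (a # xs) \<subseteq> A \<union> (Q - Z)" "last (a # xs) = b"
      "2 * s - 1 \<le> length (a # xs)" "\<forall>e\<in>set es. \<exists>v\<in>Q - Z. e - A = {v}"
    using spine[OF ab, of Z] by (auto simp: Z_def)
  have avoid: "set es \<inter> set hs = {}"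
    if h: "bpath E (c # ws) hs" "set ws \<subseteq> Z" "set ws \<inter> A = {}" for c ws hs
  proof (rule ccontr)
    assume "\<not> ?thesis"
    then obtain e where e: "e \<in> set es" "e \<in> set hs" by blast
    obtain v where v: "v \<in> Q - Z" "e - A = {v}" using p(5) e by blast
    obtain w where "w \<in> e" "w \<in> set ws" using bpath_edge_meets[OF h(1) e(2)] by blast
    then have "w \<in> e - A" "w \<in> Z" using h by auto
    then show False using v by auto
  qed
  have e1: "set es \<inter> set fs = {}" using avoid[OF us(1) _ us(2)] by (auto simp: Z_def)
  have e2: "set es \<inter> set gs = {}" using avoid[OF vs(1) _ vs(2)] by (auto simp: Z_def)
  have v1: "set us \<inter> set (a # xs) = {}" using p(2) us(2) unfolding Z_def by blast
  have v2: "set vs \<inter> set (a # xs) = {}" using p(2) vs(2) unfolding Z_def by blast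
  have "bpath E (last (a # xs) # vs) gs" using vs p(3) by simp
  from bpath_attach_ends[OF p(1) us(1) this v1 v2 dis(1) e1 e2 dis(2)]
  obtain ws hs where "bpath E ws hs" "length ws = length us + length (a # xs) + length vs" .
  then have "length us + length (a # xs) + length vs < k" using short by metis
  then show ?thesis using p(4) by linarith
qed

text \<open>The second end is a single vertex of \<open>Q\<close>, which is why four vertices are
  allowed here and five in \<open>two_ends\<close>.\<close>

lemma one_end:
  assumes a: "a \<in> A" and us: "bpath E (a # us) fs" "set us \<inter> A = {}" and l: "length us \<le> 4"
  shows "length us + 2 * s < k"
proof -
  have "\<not> A \<subseteq> {a}" using A rs card_mono[of "{a}" A] by auto
  then obtain b where b: "b \<in> A" "a \<noteq> b" by blast
  have "\<not> Q \<subseteq> set us" using card_mono[of "set us" Q] card_length[of us] l Q by auto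
  then obtain v where v: "v \<in> Q" "v \<notin> set us" by blast
  obtain X Y where Y: "Y \<subseteq> A" "card Y = r - 1" "b \<in> Y" using obtain_link[OF a b] by metis
  have vA: "v \<notin> A" using v Q by blast
  then have g: "bpath E (b # [v]) [insert v Y]"
    using full[OF v(1) Y(1,2)] Y b by (auto simp: bpath_def)
  have "insert v Y \<notin> set fs"
  proof
    assume "insert v Y \<in> set fs"
    then obtain w where "w \<in> insert v Y" "w \<in> set us" using bpath_edge_meets[OF us(1)] by blast
    then show False using Y v us(2) by blast
  qed
  then have "length us + length [v] + 2 * s < k + 1"
    using v vA l by (intro two_ends[OF a b us g]) auto
  then show ?thesis by simp
qed

lemma end_bound:
  assumes a: "a \<in> A" and us: "bpath E (a # us) fs" "set us \<inter> A = {}"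
  shows "length us < k - 2 * s"
proof (rule ccontr)
  assume n: "\<not> ?thesis"
  \<comment> \<open>Longer end paths are cut down to \<open>k - 2 * s \<le> 3\<close> vertices
    outside \<open>A\<close>, so that \<open>one_end\<close> applies.\<close>
  define L where "L = k - 2 * s"
  have L: "L \<le> 3" "L + 2 * s = k" using k by (auto simp: L_def)
  have "bpath E (take (Suc L) (a # us)) (take L fs)"
    using bpath_length[OF us(1)] n by (intro bpath_take[OF us(1)]) (simp add: L_def)
  then have "bpath E (a # take L us) (take L fs)" by simp
  moreover have "set (take L us) \<inter> A = {}" using us(2) set_take_subset[of L us] by blast
  moreover have "length (take L us) = L" using n by (simp add: L_def)
  ultimately show False using one_end[OF a, of "take L us" "take L fs"] L by simp
qed

lemma edges_le: "card E \<le> (s choose (r - 1)) * (card V - s) + (s choose r) +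
    (if k = 2 * s + 3 then s choose (r - 2) else 0)"
proof -
  let ?K = "s choose (r - 1)"
  define O' where "O' = V - A"
  define \<W> where "\<W> = component E O' ` O'"
  define F where "F W = touching E W" for W
  have finE: "finite E"
    using E finV by (intro finite_subset[of E "Pow V"]) auto
  have finO: "finite O'" using finV by (simp add: O'_def)
  have cO: "card O' = card V - s" unfolding O'_def using A finA by (simp add: card_Diff_subset)
  have W_sub: "W \<subseteq> O'" if "W \<in> \<W>" for W
    using that component_subset by (fastforce simp: \<W>_def)
  have finW: "finite W" if "W \<in> \<W>" for W using W_sub[OF that] finO finite_subset by blast
  have W_ne: "W \<noteq> {}" if "W \<in> \<W>" for W using that component_self by (fastforce simp: \<W>_def)
  have W_dis: "W = W'" if "W \<in> \<W>" "W' \<in> \<W>" "x \<in> W" "x \<in> W'" for W W' x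
    using that component_eq[of x E O'] by (auto simp: \<W>_def)
  have finF: "finite (F W)" for W using finE by (simp add: F_def touching_def)
  have FE: "F W \<subseteq> E" for W by (auto simp: F_def touching_def)
  have Fg: "g \<subseteq> W \<union> A \<and> card g = r \<and> g \<inter> W \<noteq> {}" if Wg: "W \<in> \<W>" "g \<in> F W" for W g
  proof -
    obtain x y where x: "x \<in> O'" "W = component E O' x" "y \<in> g" "y \<in> W"
      using Wg by (auto simp: \<W>_def F_def touching_def)
    have g: "g \<in> E" using Wg FE by blast
    have "g \<inter> O' \<subseteq> W" using component_closed[of y E O' x g] x g by simp
    moreover have "g \<subseteq> O' \<union> A" using E[OF g] by (auto simp: O'_def)
    ultimately show ?thesis using x E[OF g] by blast
  qed
  have con: "(x, y) \<in> (adj (F W) W)\<^sup>*" if W: "W \<in> \<W>" and xy: "x \<in> W" "y \<in> W" for W x y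
  proof -
    obtain z where z: "z \<in> O'" "W = component E O' z" using W by (auto simp: \<W>_def)
    show ?thesis using component_connected[OF z _ xy] by (simp add: F_def touching_def)
  qed
  have F_dis: "F W \<inter> F W' = {}" if W: "W \<in> \<W>" "W' \<in> \<W>" "W \<noteq> W'" for W W'
  proof (rule ccontr)
    assume "\<not> ?thesis"
    then obtain g where g: "g \<in> F W" "g \<in> F W'" by blast
    obtain x where x: "x \<in> g" "x \<in> W'" using Fg[OF W(2) g(2)] by blast
    then have "x \<in> W \<or> x \<in> A" using Fg[OF W(1) g(1)] by blast
    moreover have "x \<notin> A" using x W_sub[OF W(2)] by (auto simp: O'_def)
    ultimately show False using W_dis[OF W(1,2)] x W(3) by blast
  qed
  have ends: "length xs < k - 2 * s"
    if "W \<in> \<W>" "a \<in> A" "bpath (F W) (a # xs) es" "set xs \<subseteq> W" for W a xs es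
  proof (rule end_bound[OF that(2) bpath_mono[OF that(3) FE]])
    show "set xs \<inter> A = {}" using that(4) W_sub[OF that(1)] by (auto simp: O'_def)
  qed
  have att: "attached (F W) W a" if W: "W \<in> \<W>" and a: "a \<in> A" "a \<in> \<Union>(F W)" for W a
  proof -
    obtain e where e: "e \<in> F W" "a \<in> e" using a by blast
    then obtain x where "x \<in> e" "x \<in> W" using Fg[OF W e(1)] by blast
    then show ?thesis unfolding attached_def using e con[OF W] by blast
  qed
  define R where "R W = \<Union>(F W) \<inter> A" for W
  have R_ne: "R W \<noteq> {}" if W: "W \<in> \<W>" for W
  proof -
    obtain x where x: "x \<in> W" using W_ne[OF W] by blast
    have "A \<noteq> {}" using A rs by auto
    then obtain a where a: "a \<in> A" by blast
    have "x \<in> V" "a \<in> V" "a \<notin> W" using x a W_sub[OF W] A by (auto simp: O'_def)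
    then obtain u v g where g: "u \<in> W" "v \<in> V - W" "g \<in> E" "u \<in> g" "v \<in> g"
      using leave_set[OF conV[of x a], of W] x by blast
    then have gF: "g \<in> F W" by (auto simp: F_def touching_def)
    then have "v \<in> A" using Fg[OF W gF] g by blast
    then show ?thesis using gF g by (auto simp: R_def)
  qed
  \<comment> \<open>\<open>B\<close> may be any set between the hubs of \<open>W\<close> and
    \<open>A\<close>: it will be \<open>A\<close> when \<open>L = 1\<close>, and the hubs alone when
    \<open>L = 2\<close>.\<close>
  have shallow: "card (F W) \<le> ?K * card W"
    if W: "W \<in> \<W>" and a: "a \<in> R W" and B: "R W \<subseteq> B" "B \<subseteq> A" "card B + L \<le> s + 1"
      and noend: "\<And>xs es. bpath (F W) (a # xs) es \<Longrightarrow> set xs \<subseteq> W \<Longrightarrow> length xs \<le> L" for W a B L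
  proof -
    have BW: "B \<inter> W = {}" using B W_sub[OF W] by (auto simp: O'_def)
    have g: "g \<subseteq> W \<union> B \<and> card g = r" if "g \<in> F W" for g
      using Fg[OF W that] that B(1) unfolding R_def by blast
    have t: "g \<inter> W \<noteq> {}" if "g \<in> F W" for g using Fg[OF W that] by blast
    have aB: "a \<in> B" using a B by blast
    have "finite B" using B finA finite_subset by blast
    note EB = edge_bound(1)[OF finW[OF W] finF this BW g t rs aB B(3) noend]
    show ?thesis by (rule EB) (use att[OF W] a in \<open>auto simp: R_def\<close>)
  qed
  \<comment> \<open>Given \<open>card B + L \<le> s + 1\<close>, end paths with two vertices from
    every hub can be afforded only if some vertex of \<open>A\<close> is not a hub. What remains are
    the \<open>bad\<close> components; by \<open>ends\<close> they occur only for odd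
    \<open>k\<close>.\<close>
  define bad where "bad W \<longleftrightarrow> R W = A \<and> (\<forall>a\<in>A. end_path (F W) W a 2)" for W
  have good_bound: "card (F W) \<le> ?K * card W" if W: "W \<in> \<W>" and nb: "k = 2 * s + 2 \<or> \<not> bad W" for W
  proof (cases "\<exists>a\<in>R W. \<forall>xs es. bpath (F W) (a # xs) es \<longrightarrow> set xs \<subseteq> W \<longrightarrow> length xs \<le> 1")
    case True
    then obtain a where a: "a \<in> R W"
      "\<And>xs es. bpath (F W) (a # xs) es \<Longrightarrow> set xs \<subseteq> W \<Longrightarrow> length xs \<le> 1" by blast
    show ?thesis by (rule shallow[OF W a(1) _ subset_refl _ a(2)]) (auto simp: R_def A)
  next
    case False
    have RA: "R W \<subseteq> A" by (auto simp: R_def)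
    have k3: "k = 2 * s + 3"
    proof (rule ccontr)
      assume "k \<noteq> 2 * s + 3"
      then have "k - 2 * s = 2" using k by simp
      then have "length xs \<le> 1" if "a \<in> R W" "bpath (F W) (a # xs) es" "set xs \<subseteq> W" for a xs es
        using ends[OF W _ that(2,3)] that(1) RA by fastforce
      then show False using False R_ne[OF W] by blast
    qed
    have deep: "end_path (F W) W a 2" if a: "a \<in> R W" for a
    proof -
      obtain xs es where p: "bpath (F W) (a # xs) es" "set xs \<subseteq> W" "\<not> length xs \<le> 1"
        using False a by blast
      moreover have "length xs < 3" using ends[OF W _ p(1,2)] a RA k3 by auto
      ultimately show ?thesis unfolding end_path_def by (intro exI[of _ xs] exI[of _ es]) simp
    qed
    then have "R W \<noteq> A" using nb k3 by (auto simp: bad_def)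
    then have "card (R W) < s" using RA A finA by (metis psubset_card_mono psubsetI)
    obtain a where a: "a \<in> R W" using R_ne[OF W] by blast
    have "length xs \<le> 2" if "bpath (F W) (a # xs) es" "set xs \<subseteq> W" for xs es
      using ends[OF W _ that] a RA k3 by fastforce
    then show ?thesis
      using shallow[OF W a subset_refl RA, of 2] \<open>card (R W) < s\<close> by simp
  qed
  have bad_bound: "card (F W) \<le> ?K * card W + (s choose (r - 2))"
    if W: "W \<in> \<W>" and b: "bad W" "k = 2 * s + 3" for W
  proof -
    have AW: "A \<inter> W = {}" using W_sub[OF W] by (auto simp: O'_def)
    have "A \<noteq> {}" using A rs by auto
    then obtain a where "a \<in> A" by blast
    moreover from this have "a \<in> R W" using b(1) by (simp add: bad_def)
    ultimately have a: "a \<in> A" "a \<in> \<Union>(F W)" by (auto simp: R_def)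
    obtain xs es where p: "bpath (F W) (a # xs) es" "set xs \<subseteq> W" "length xs = 2"
      using b(1) a unfolding bad_def end_path_def by blast
    then have "card (set xs) = 2" by (simp add: bpath_def distinct_card)
    then have W2: "2 \<le> card W" using card_mono[OF finW[OF W] p(2)] by simp
    have noend: "length xs \<le> 2" if "c \<in> A" "bpath (F W) (c # xs) es" "set xs \<subseteq> W" for c xs es
      using ends[OF W that] b(2) by simp
    show ?thesis
      by (rule deep_component_bound[OF finW[OF W] finF finA AW A(2) Fg[OF W] rs a W2 con[OF W] noend])
  qed
  \<comment> \<open>Two bad components at the ends of a spine would give at least
    \<open>2 + (2 * s - 1) + 2 = k\<close> vertices.\<close>
  have one_bad: "W = W'" if W: "W \<in> \<W>" "W' \<in> \<W>" "bad W" "bad W'" and k3: "k = 2 * s + 3" for W W'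
  proof (rule ccontr)
    assume ne: "W \<noteq> W'"
    have "\<not> A \<subseteq> {a}" for a using A rs card_mono[of "{a}" A] by auto
    then obtain a b where ab: "a \<in> A" "b \<in> A" "a \<noteq> b" by blast
    obtain us fs where us: "bpath (F W) (a # us) fs" "set us \<subseteq> W" "length us = 2"
      using W(3) ab unfolding bad_def end_path_def by blast
    obtain vs gs where vs: "bpath (F W') (b # vs) gs" "set vs \<subseteq> W'" "length vs = 2"
      using W(4) ab unfolding bad_def end_path_def by blast
    have "W \<inter> W' = {}" using W_dis[OF W(1,2)] ne by blast
    then have d1: "set us \<inter> set vs = {}" using us vs by blast
    have "set fs \<subseteq> F W" "set gs \<subseteq> F W'" using us vs by (auto simp: bpath_def)
    then have d2: "set fs \<inter> set gs = {}" using F_dis[OF W(1,2) ne] by blast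
    have dA: "set us \<inter> A = {}" "set vs \<inter> A = {}" using us vs W_sub W by (auto simp: O'_def)
    show False
      using two_ends[OF ab bpath_mono[OF us(1) FE] dA(1) bpath_mono[OF vs(1) FE] dA(2) d1 d2]
        us(3) vs(3) k3 by simp
  qed
  let ?c = "if k = 2 * s + 3 then s choose (r - 2) else 0"
  have finWW: "finite \<W>" using finO by (simp add: \<W>_def)
  have "E \<subseteq> {e. e \<subseteq> A \<and> card e = r} \<union> (\<Union>W\<in>\<W>. F W)"
  proof
    fix e assume e: "e \<in> E"
    show "e \<in> {e. e \<subseteq> A \<and> card e = r} \<union> (\<Union>W\<in>\<W>. F W)"
    proof (cases "e \<subseteq> A")
      case False
      then obtain x where x: "x \<in> e" "x \<in> O'" using E[OF e] by (auto simp: O'_def)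
      then have "e \<in> F (component E O' x)"
        using e component_self[of x E O'] by (auto simp: F_def touching_def)
      then show ?thesis using x by (auto simp: \<W>_def)
    qed (use E[OF e] in auto)
  qed
  then have "card E \<le> card ({e. e \<subseteq> A \<and> card e = r} \<union> (\<Union>W\<in>\<W>. F W))"
    using finA finWW finF by (intro card_mono) auto
  also have "\<dots> \<le> card {e. e \<subseteq> A \<and> card e = r} + card (\<Union>W\<in>\<W>. F W)" by (rule card_Un_le)
  also have "card {e. e \<subseteq> A \<and> card e = r} = s choose r" using n_subsets[OF finA] A by simp
  also have "card (\<Union>W\<in>\<W>. F W) \<le> (\<Sum>W\<in>\<W>. card (F W))" by (rule card_UN_le[OF finWW])
  also have "\<dots> \<le> (\<Sum>W\<in>\<W>. ?K * card W + (if bad W then ?c else 0))"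
  proof (rule sum_mono)
    fix W assume W: "W \<in> \<W>"
    show "card (F W) \<le> ?K * card W + (if bad W then ?c else 0)"
      using good_bound[OF W] bad_bound[OF W] k by auto
  qed
  also have "\<dots> = ?K * (\<Sum>W\<in>\<W>. card W) + (\<Sum>W\<in>\<W>. if bad W then ?c else 0)"
    by (simp add: sum.distrib sum_distrib_left)
  also have "(\<Sum>W\<in>\<W>. card W) = card O'"
  proof -
    have "\<Union>\<W> = O'" using W_sub component_self by (fastforce simp: \<W>_def)
    moreover have "card (\<Union>\<W>) = (\<Sum>W\<in>\<W>. card W)"
      using finW W_dis by (intro card_Union_disjoint) (auto simp: pairwise_def disjnt_def)
    ultimately show ?thesis by simp
  qed
  also have "(\<Sum>W\<in>\<W>. if bad W then ?c else 0) \<le> ?c"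
  proof (cases "k = 2 * s + 3 \<and> (\<exists>W\<in>\<W>. bad W)")
    case True
    then obtain W0 where W0: "W0 \<in> \<W>" "bad W0" by blast
    have "(\<Sum>W\<in>\<W>. if bad W then ?c else 0) \<le> (\<Sum>W\<in>\<W>. if W = W0 then ?c else 0)"
      using one_bad[OF W0(1) _ W0(2)] True by (intro sum_mono) auto
    also have "\<dots> = ?c" using W0 finWW by simp
    finally show ?thesis .
  next
    case False
    then have "(\<Sum>W\<in>\<W>. if bad W then ?c else 0) = 0" by (intro sum.neutral) auto
    then show ?thesis by simp
  qed
  finally show ?thesis using cO by (simp add: add_ac)
qed

end

section \<open>Progressive induction\<close>

lemma pigeonhole_fibre:
  assumes "finite I" "finite B" "f ` I \<subseteq> B" "card B * m < card I"
  shows "\<exists>y. m < card {i \<in> I. f i = y}"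
proof (rule ccontr)
  assume n: "\<not> ?thesis"
  have "card I = card (\<Union>y\<in>B. {i \<in> I. f i = y})" using assms(3) by (intro arg_cong[of _ _ card]) auto
  also have "\<dots> \<le> (\<Sum>y\<in>B. card {i \<in> I. f i = y})" by (rule card_UN_le[OF assms(2)])
  also have "\<dots> \<le> (\<Sum>y\<in>B. m)" using n by (intro sum_mono) (simp add: not_less)
  finally show False using assms(4) by simp
qed

definition good_hypergraph :: "nat \<Rightarrow> nat \<Rightarrow> 'a set \<Rightarrow> 'a set set \<Rightarrow> bool" where
  "good_hypergraph r k V E \<longleftrightarrow> finite V \<and> (\<forall>e\<in>E. e \<subseteq> V \<and> card e = r) \<and>
    (\<forall>x\<in>V. \<forall>y\<in>V. (x, y) \<in> (adj E V)\<^sup>*) \<and> (\<forall>xs es. bpath E xs es \<longrightarrow> length xs < k)"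

lemma good_hypergraph_finite: "good_hypergraph r k V E \<Longrightarrow> finite E"
  unfolding good_hypergraph_def by (meson PowI finite_Pow_iff finite_subset subsetI)

text \<open>A profile over at most \<open>T\<close> vertices is a set of pairs of a vertex and an
  end path length up to \<open>q\<close>, together with a set of linked pairs; the two factors bound
  the choices for each.\<close>

definition profiles :: "nat \<Rightarrow> nat \<Rightarrow> nat" where
  "profiles T q = 2 ^ (T * (q + 1)) * 2 ^ (T * T)"

definition max_edges :: "nat \<Rightarrow> nat \<Rightarrow> nat \<Rightarrow> nat \<Rightarrow> nat" where
  "max_edges r s k n = (s choose (r - 1)) * (n - s) + (s choose r) +
    (if k = 2 * s + 3 then s choose (r - 2) else 0)"

text \<open>A walk through \<open>W\<close> enters and leaves by vertices of \<open>R\<close>, and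
  these stay connected through \<open>W2\<close>, which touches all of them. Hence one other clone
  suffices to keep the hypergraph connected.\<close>

lemma remove_chunk:
  assumes g: "good_hypergraph r k V E" and W: "W \<subseteq> V" "W \<noteq> {}" and W2: "W2 \<subseteq> V - W"
    and F: "\<And>e. e \<in> touching E W \<Longrightarrow> e \<subseteq> W \<union> R" and R: "R \<subseteq> V - W"
    and disj: "touching E W2 \<inter> touching E W = {}"
    and con2: "\<And>x y. x \<in> W2 \<Longrightarrow> y \<in> W2 \<Longrightarrow> (x, y) \<in> (adj (touching E W2) W2)\<^sup>*"
    and hubs: "R \<subseteq> \<Union>(touching E W2)"
  shows "good_hypergraph r k (V - W) (E - touching E W)"
proof -
  let ?V = "V - W" and ?E = "E - touching E W"
  have E: "e \<subseteq> V" "card e = r" if "e \<in> E" for e using g that by (auto simp: good_hypergraph_def)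
  have "adj (touching E W2) W2 \<subseteq> adj ?E ?V"
    using W2 disj by (auto simp: adj_def touching_def)
  then have sub: "(adj (touching E W2) W2)\<^sup>* \<subseteq> (adj ?E ?V)\<^sup>*" by (rule rtrancl_mono)
  have toW2: "\<exists>x\<in>W2. (a, x) \<in> adj ?E ?V" if a: "a \<in> R" for a
  proof -
    obtain e where e: "e \<in> touching E W2" "a \<in> e" using hubs a by blast
    then obtain x where x: "x \<in> e" "x \<in> W2" by (auto simp: touching_def)
    have "e \<in> ?E" using e disj by (auto simp: touching_def)
    then have "(a, x) \<in> adj ?E ?V" using e x a R W2 by (intro adjI) auto
    then show ?thesis using x by blast
  qed
  have RR: "(a, b) \<in> (adj ?E ?V)\<^sup>*" if ab: "a \<in> R" "b \<in> R" for a b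
  proof -
    obtain x y where x: "x \<in> W2" "(a, x) \<in> adj ?E ?V" and y: "y \<in> W2" "(b, y) \<in> adj ?E ?V"
      using toW2 ab by blast
    have "(x, y) \<in> (adj ?E ?V)\<^sup>*" using con2[OF x(1) y(1)] sub by blast
    moreover have "(y, b) \<in> (adj ?E ?V)\<^sup>*" using y(2) adj_rtrancl_sym by (metis r_into_rtrancl)
    ultimately show ?thesis using x(2) by (meson converse_rtrancl_into_rtrancl rtrancl_trans)
  qed
  have con: "(x, y) \<in> (adj ?E ?V)\<^sup>*" if xy: "x \<in> ?V" "y \<in> ?V" for x y
  proof -
    have "(x, y) \<in> (adj E V)\<^sup>*" using g xy by (auto simp: good_hypergraph_def)
    \<comment> \<open>Invariant along the walk: while it is inside \<open>W\<close>, all hubs are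
      already reachable in what remains.\<close>
    then have "(y \<notin> W \<longrightarrow> (x, y) \<in> (adj ?E ?V)\<^sup>*) \<and> (y \<in> W \<longrightarrow> (\<forall>a\<in>R. (x, a) \<in> (adj ?E ?V)\<^sup>*))"
    proof (induction rule: rtrancl_induct)
      case base
      then show ?case using xy by simp
    next
      case (step y z)
      obtain e where e: "e \<in> E" "y \<in> e" "z \<in> e" "y \<in> V" "z \<in> V" using step(2) by (auto simp: adj_def)
      show ?case
      proof (cases "e \<in> touching E W")
        case False
        then have "y \<notin> W" "z \<notin> W" "e \<in> ?E" using e by (auto simp: touching_def)
        then show ?thesis
          using step(3) e by (auto intro: rtrancl_into_rtrancl adjI)
      next
        case True
        then have yz: "y \<in> W \<or> y \<in> R" "z \<in> W \<or> z \<in> R" using F e by auto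
        have "\<forall>a\<in>R. (x, a) \<in> (adj ?E ?V)\<^sup>*"
        proof (cases "y \<in> W")
          case True
          then show ?thesis using step(3) by simp
        next
          case False
          then have "y \<in> R" "(x, y) \<in> (adj ?E ?V)\<^sup>*" using yz step(3) by auto
          then show ?thesis using RR rtrancl_trans by metis
        qed
        then show ?thesis using yz by blast
      qed
    qed
    then show ?thesis using xy by simp
  qed
  have 1: "finite ?V" using g by (simp add: good_hypergraph_def)
  have 2: "e \<subseteq> ?V \<and> card e = r" if "e \<in> ?E" for e using that E[of e] by (auto simp: touching_def)
  have 3: "length xs < k" if "bpath ?E xs es" for xs es
  proof -
    have "bpath E xs es" using bpath_mono[OF that] by blast
    then show ?thesis using g unfolding good_hypergraph_def by blast
  qed
  show ?thesis unfolding good_hypergraph_def using 1 2 3 con by blast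
qed

lemma progress:
  fixes r s k :: nat
  assumes rs: "3 \<le> r" "r \<le> s" and k: "k = 2 * s + 2 \<or> k = 2 * s + 3"
  shows "\<exists>n0 q0. s \<le> n0 \<and> (\<forall>(V :: 'a set) E. good_hypergraph r k V E \<longrightarrow> n0 \<le> card V \<longrightarrow>
    card E \<le> max_edges r s k (card V) \<or>
    (\<exists>(V' :: 'a set) E'. good_hypergraph r k V' E' \<and> card V' < card V \<and> card V \<le> card V' + q0 \<and>
      card E + (s choose (r - 1)) * card V' < card E' + (s choose (r - 1)) * card V))"
proof -
  let ?K = "s choose (r - 1)"
  define T where "T = shadow_length r k"
  \<comment> \<open>More than \<open>m\<close> clones give both \<open>card P + 2\<close> of them,
    to link the hubs and keep two for the ends, and \<open>s + 6\<close> of them, to form a core.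
    \<open>M\<close> is chosen so that some profile occurs more than \<open>m\<close> times.\<close>
  define m where "m = T + s + 10"
  define M where "M q = profiles T q * m + 1" for q
  \<comment> \<open>This bounds the size of a clone at whichever \<open>d\<close> the descent stops,
    and hence the number of vertices lost in one deletion.\<close>
  define q0 where "q0 = (\<Sum>d\<le>T. chunk_size M d)"
  define n0 where "n0 = chunk_size M T + s"
  have "card E \<le> max_edges r s k (card V) \<or>
    (\<exists>(V' :: 'a set) E'. good_hypergraph r k V' E' \<and> card V' < card V \<and> card V \<le> card V' + q0 \<and>
      card E + ?K * card V' < card E' + ?K * card V)"
    if g: "good_hypergraph r k V E" and big: "n0 \<le> card V" for V :: "'a set" and E
  proof -
    have finV: "finite V" and E: "\<And>e. e \<in> E \<Longrightarrow> e \<subseteq> V \<and> card e = r"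
      and conn: "\<And>x y. x \<in> V \<Longrightarrow> y \<in> V \<Longrightarrow> (x, y) \<in> (adj E V)\<^sup>*"
      and short: "\<And>xs es. bpath E xs es \<Longrightarrow> length xs < k"
      using g by (auto simp: good_hypergraph_def)
    have finE: "finite E" using good_hypergraph_finite[OF g] .
    have "V \<noteq> {}" using big rs unfolding n0_def by auto
    have e: "finite e \<and> card e \<le> r" if "e \<in> E" for e using E[OF that] finV finite_subset by auto
    have short': "length xs \<le> k" if "bpath E xs es" for xs es using short[OF that] by simp
    have bigT: "chunk_size M T \<le> card V" using big by (simp add: n0_def)
    have "\<exists>P d \<W>. P \<subseteq> V \<and> P \<noteq> {} \<and> card P \<le> T \<and> d \<le> T \<and>
      \<W> \<subseteq> component E (V - P) ` (V - P) \<and> M (chunk_size M d) \<le> card \<W> \<and>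
      (\<forall>W\<in>\<W>. card W \<le> chunk_size M d)"
      by (rule many_small_components[OF finV \<open>V \<noteq> {}\<close> conn e short' T_def bigT])
    then obtain P d \<W> where P: "P \<subseteq> V" "P \<noteq> {}" "card P \<le> T" "d \<le> T"
      and \<W>: "\<W> \<subseteq> component E (V - P) ` (V - P)" "M (chunk_size M d) \<le> card \<W>"
        "\<forall>W\<in>\<W>. card W \<le> chunk_size M d"
      by (elim exE conjE)
    have cW: "card W \<le> chunk_size M d" if "W \<in> \<W>" for W using \<W>(3) that by blast
    define q where "q = chunk_size M d"
    have finP: "finite P" using P finV finite_subset by blast
    have qq0: "q \<le> q0" unfolding q_def q0_def using P(4) by (intro member_le_sum) auto
    have W_comp: "\<exists>x\<in>V - P. W = component E (V - P) x" if "W \<in> \<W>" for W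
      using that \<W>(1) by blast
    have W_sub: "W \<subseteq> V - P" if "W \<in> \<W>" for W using W_comp[OF that] component_subset by metis
    have finW: "finite W" if "W \<in> \<W>" for W using W_sub[OF that] finV finite_subset by blast
    have W_ne: "W \<noteq> {}" if "W \<in> \<W>" for W using W_comp[OF that] component_self by (metis empty_iff)
    have W_dis: "W \<inter> W' = {}" if W: "W \<in> \<W>" "W' \<in> \<W>" "W \<noteq> W'" for W W'
    proof (rule ccontr)
      assume "\<not> ?thesis"
      then obtain x where x: "x \<in> W" "x \<in> W'" by blast
      obtain y z where y: "W = component E (V - P) y" "W' = component E (V - P) z"
        using W_comp[OF W(1)] W_comp[OF W(2)] by blast
      show False using component_eq[of x E "V - P" y] component_eq[of x E "V - P" z] x y W(3) by simp
    qed
    have W_edges: "g \<subseteq> W \<union> P" if W: "W \<in> \<W>" "g \<in> touching E W" for W g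
    proof -
      obtain y where y: "y \<in> V - P" "W = component E (V - P) y" using W_comp[OF W(1)] by blast
      obtain x where x: "x \<in> g" "x \<in> W" "g \<in> E" using W(2) by (auto simp: touching_def)
      have "g \<inter> (V - P) \<subseteq> W" using component_closed[of x E "V - P" y g] x y by simp
      then show ?thesis using E[OF x(3)] by blast
    qed
    have W_con: "(x, y) \<in> (adj (touching E W) W)\<^sup>*" if W: "W \<in> \<W>" and xy: "x \<in> W" "y \<in> W" for W x y
    proof -
      obtain z where z: "z \<in> V - P" "W = component E (V - P) z" using W_comp[OF W] by blast
      show ?thesis using component_connected[OF z _ xy] by (simp add: touching_def)
    qed
    define prof where "prof W = ({(a, l). a \<in> P \<and> l \<le> q \<and> end_path (touching E W) W a l},
      {(a, b). a \<in> P \<and> b \<in> P \<and> linked (touching E W) a b})" for W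
    define B where "B = Pow (P \<times> {..q}) \<times> Pow (P \<times> P)"
    have "card B = 2 ^ (card P * (q + 1)) * 2 ^ (card P * card P)"
      unfolding B_def using finP by (simp add: card_cartesian_product card_Pow)
    also have "\<dots> \<le> profiles T q"
      unfolding profiles_def using P(3) by (intro mult_le_mono power_increasing) auto
    finally have cB: "card B * m \<le> profiles T q * m" by (rule mult_le_mono1)
    have less: "card B * m < card \<W>" using cB \<W>(2) unfolding q_def[symmetric] M_def by linarith
    have "finite \<W>" using \<W>(1) finite_surj[of "V - P"] finV by blast
    moreover have "finite B" using finP by (simp add: B_def)
    moreover have "prof ` \<W> \<subseteq> B" by (auto simp: prof_def B_def)
    ultimately have "\<exists>y. m < card {W \<in> \<W>. prof W = y}" using less by (rule pigeonhole_fibre)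
    then obtain y where y: "m < card {W \<in> \<W>. prof W = y}" by blast
    define \<W>0 where "\<W>0 = {W \<in> \<W>. prof W = y}"
    have sub: "\<W>0 \<subseteq> \<W>" by (auto simp: \<W>0_def)
    have fin0: "finite \<W>0" using \<open>finite \<W>\<close> sub finite_subset by blast
    interpret clones E P \<W>0
    proof
      show "W \<inter> P = {}" if "W \<in> \<W>0" for W using W_sub sub that by blast
      show "W \<inter> W' = {}" if "W \<in> \<W>0" "W' \<in> \<W>0" "W \<noteq> W'" for W W' using W_dis sub that by blast
      show "e \<subseteq> W \<union> P" if "W \<in> \<W>0" "e \<in> touching E W" for W e using W_edges sub that by blast
      show "(x, y) \<in> (adj (touching E W) W)\<^sup>*" if "W \<in> \<W>0" "x \<in> W" "y \<in> W" for W x y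
        using W_con sub that by blast
    qed
    have ends: "end_path (touching E W') W' a l"
      if h: "W \<in> \<W>0" "W' \<in> \<W>0" "a \<in> P" "end_path (touching E W) W a l" for W W' a l
    proof -
      obtain xs es where p: "bpath (touching E W) (a # xs) es" "set xs \<subseteq> W" "length xs = l"
        using h(4) unfolding end_path_def by blast
      then have "l = card (set xs)" by (simp add: bpath_def distinct_card)
      also have "\<dots> \<le> card W" using p(2) finW h sub by (intro card_mono) auto
      also have "\<dots> \<le> q" using cW h sub by (auto simp: q_def)
      finally have "(a, l) \<in> fst (prof W)" using h by (simp add: prof_def)
      also have "prof W = prof W'" using h by (simp add: \<W>0_def)
      finally show ?thesis by (simp add: prof_def)
    qed
    have lks: "linked (touching E W') a b"
      if h: "W \<in> \<W>0" "W' \<in> \<W>0" "a \<in> P" "b \<in> P" "linked (touching E W) a b" for W W' a b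
    proof -
      have "(a, b) \<in> snd (prof W)" using h by (simp add: prof_def)
      also have "prof W = prof W'" using h by (simp add: \<W>0_def)
      finally show ?thesis by (simp add: prof_def)
    qed
    define R where "R W = \<Union>(touching E W) \<inter> P" for W
    have R_sub: "R W \<subseteq> R W'" if h: "W \<in> \<W>0" "W' \<in> \<W>0" for W W'
    proof
      fix a assume "a \<in> R W"
      then have a: "a \<in> P" "a \<in> \<Union>(touching E W)" by (auto simp: R_def)
      have "a \<notin> W" "a \<notin> W'" using a outside h by blast+
      then have "a \<in> \<Union>(touching E W')"
        using mem_hubs_iff[of a W E] mem_hubs_iff[of a W' E] a ends[OF h a(1)] by blast
      then show "a \<in> R W'" using a by (simp add: R_def)
    qed
    have R_ne: "R W \<noteq> {}" if h: "W \<in> \<W>0" for W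
    proof -
      have WW: "W \<in> \<W>" using h sub by blast
      obtain x p where x: "x \<in> W" "p \<in> P" using W_ne[OF WW] P by blast
      then have "x \<in> V" "p \<in> V" "p \<notin> W" using W_sub[OF WW] P by auto
      then obtain u v g where g: "u \<in> W" "v \<in> V - W" "g \<in> E" "u \<in> g" "v \<in> g"
        using leave_set[OF conn[of x p], of W] x by blast
      then have "g \<in> touching E W" by (auto simp: touching_def)
      then show ?thesis using W_edges[OF WW, of g] g unfolding R_def by blast
    qed
    have cP: "card P + 2 \<le> card \<W>0" "s + 6 \<le> card \<W>0"
      using y P(3) unfolding \<W>0_def[symmetric] m_def by linarith+
    have short2: "length xs \<le> 2 * s + 2" if "bpath E xs es" for xs es
      using short[OF that] k by auto
    have r: "card e = r" if "e \<in> E" for e using E[OF that] by simp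
    have finW0: "finite W" if "W \<in> \<W>0" for W using finW sub that by blast
    have le: "card (touching E W) \<le> ?K * card W" if h: "W \<in> \<W>0" for W
      proof (rule clone_edge_bound(1)[OF finP fin0 finW0 finE _ _ cP(1) short2 h R_def R_ne[OF h] r rs])
        show "end_path (touching E W') W' a l"
          if "W \<in> \<W>0" "W' \<in> \<W>0" "a \<in> P" "end_path (touching E W) W a l" for W W' a l
          using ends[OF that] .
        show "linked (touching E W') a b"
          if "W \<in> \<W>0" "W' \<in> \<W>0" "a \<in> P" "b \<in> P" "linked (touching E W) a b" for W W' a b
          using lks[OF that] .
      qed
    have eq: "card W = 1 \<and> card (R W) = s"
      if h: "W \<in> \<W>0" and e: "card (touching E W) = ?K * card W" for W
      proof (rule clone_edge_bound(2)[OF finP fin0 finW0 finE _ _ cP(1) short2 h R_def R_ne[OF h] r rs e])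
        show "end_path (touching E W') W' a l"
          if "W \<in> \<W>0" "W' \<in> \<W>0" "a \<in> P" "end_path (touching E W) W a l" for W W' a l
          using ends[OF that] .
        show "linked (touching E W') a b"
          if "W \<in> \<W>0" "W' \<in> \<W>0" "a \<in> P" "b \<in> P" "linked (touching E W) a b" for W W' a b
          using lks[OF that] .
      qed
    show ?thesis
    proof (cases "\<exists>W\<in>\<W>0. card (touching E W) < ?K * card W")
      case True
      then obtain W where W: "W \<in> \<W>0" "card (touching E W) < ?K * card W" by blast
      have WW: "W \<in> \<W>" using W sub by blast
      have "card (\<W>0 - {W}) \<noteq> 0" using cP fin0 W by simp
      then have "\<W>0 - {W} \<noteq> {}" by fastforce
      then obtain W2 where W2: "W2 \<in> \<W>0" "W2 \<noteq> W" by blast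
      have "good_hypergraph r k (V - W) (E - touching E W)"
      proof (rule remove_chunk[OF g, where R = "R W" and ?W2.0 = W2])
        show "W \<subseteq> V" "W \<noteq> {}" using W_sub[OF WW] W_ne[OF WW] by auto
        show "W2 \<subseteq> V - W" using W_sub[of W2] W2 sub disjoint[OF W(1) W2(1)] by blast
        show "R W \<subseteq> V - W" using P(1) outside[OF W(1)] by (auto simp: R_def)
        show "R W \<subseteq> \<Union>(touching E W2)" using R_sub[OF W(1) W2(1)] by (auto simp: R_def)
        show "touching E W2 \<inter> touching E W = {}" using touching_disjoint[OF W2(1) W(1)] W2 by blast
        show "e \<subseteq> W \<union> R W" if "e \<in> touching E W" for e
          using edges[OF W(1) that] that by (auto simp: R_def)
        show "(x, y) \<in> (adj (touching E W2) W2)\<^sup>*" if "x \<in> W2" "y \<in> W2" for x y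
          using clones.con[OF clones_axioms W2(1) that] .
      qed
      moreover have cV: "card V = card (V - W) + card W"
        using W_sub[OF WW] finV finW[OF WW] by (metis Diff_subset card_Diff_subset card_mono le_add_diff_inverse2 subset_trans)
      moreover have "card W \<le> q0" using cW[OF WW] qq0 by (simp add: q_def)
      moreover have "0 < card W" using finW[OF WW] W_ne[OF WW] by (simp add: card_gt_0_iff)
      moreover have "card E = card (E - touching E W) + card (touching E W)"
      proof -
        have "touching E W \<subseteq> E" by (auto simp: touching_def)
        then show ?thesis using finE
          by (metis card_Diff_subset card_mono finite_subset le_add_diff_inverse2)
      qed
      ultimately have "good_hypergraph r k (V - W) (E - touching E W) \<and> card (V - W) < card V \<and>
          card V \<le> card (V - W) + q0 \<and>
          card E + ?K * card (V - W) < card (E - touching E W) + ?K * card V"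
        using W(2) by (simp add: algebra_simps)
      then show ?thesis by blast
    next
      case False
      have tight: "card (touching E W) = ?K * card W" if "W \<in> \<W>0" for W
        using le[OF that] False that by (meson le_neq_implies_less)
      have "\<W>0 \<noteq> {}" using cP by auto
      then obtain W1 where W1: "W1 \<in> \<W>0" by blast
      define A where "A = R W1"
      have RA: "R W = A" if "W \<in> \<W>0" for W using R_sub that W1 by (auto simp: A_def)
      have A: "A \<subseteq> P" "card A = s" using eq[OF W1 tight[OF W1]] by (auto simp: A_def R_def)
      have finA: "finite A" using A finP finite_subset by blast
      have sing: "\<exists>v. W = {v}" if "W \<in> \<W>0" for W
        using eq[OF that tight[OF that]] by (meson card_1_singletonE)
      interpret core V E A "\<Union>\<W>0" r s k
      proof
        show "\<Union>\<W>0 \<subseteq> V - A" using W_sub sub A by blast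
        have "card (\<Union>\<W>0) = (\<Sum>W\<in>\<W>0. card W)"
          using finW0 disjoint by (intro card_Union_disjoint) (auto simp: pairwise_def disjnt_def)
        also have "\<dots> = (\<Sum>W\<in>\<W>0. 1)" using eq tight by (intro sum.cong) auto
        finally show "s + 6 \<le> card (\<Union>\<W>0)" using cP by simp
        show "insert v X \<in> E" if h: "v \<in> \<Union>\<W>0" "X \<subseteq> A" "card X = r - 1" for v X
        proof -
          have W: "{v} \<in> \<W>0" using h(1) sing by blast
          have vA: "v \<notin> A" using outside[OF W] A by blast
          \<comment> \<open>Equality in the count forces completeness: the link of \<open>v\<close>
            consists of \<open>(r - 1)\<close>-subsets of \<open>A\<close>, and as \<open>v\<close>
            lies in \<open>?K\<close> edges there are as many of them as there can be.\<close>
          have "(\<lambda>e. e - {v}) ` touching E {v} = {X. X \<subseteq> A \<and> card X = r - 1}"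
          proof (rule card_subset_eq)
            show "finite {X. X \<subseteq> A \<and> card X = r - 1}" using finA by simp
            show "(\<lambda>e. e - {v}) ` touching E {v} \<subseteq> {X. X \<subseteq> A \<and> card X = r - 1}"
            proof
              fix Y assume "Y \<in> (\<lambda>e. e - {v}) ` touching E {v}"
              then obtain e where e: "e \<in> touching E {v}" "Y = e - {v}" by blast
              have "e \<subseteq> {v} \<union> P" using edges[OF W e(1)] .
              moreover have "e \<inter> P \<subseteq> A" using RA[OF W] e(1) by (auto simp: R_def)
              moreover have "v \<in> e" "card e = r" using e(1) r by (auto simp: touching_def)
              ultimately show "Y \<in> {X. X \<subseteq> A \<and> card X = r - 1}"
                using e(2) by (auto simp: card_Diff_singleton_if)
            qed
            have "inj_on (\<lambda>e. e - {v}) (touching E {v})"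
              by (rule inj_onI) (auto simp: touching_def)
            then have "card ((\<lambda>e. e - {v}) ` touching E {v}) = ?K"
              using tight[OF W] by (simp add: card_image)
            then show "card ((\<lambda>e. e - {v}) ` touching E {v}) = card {X. X \<subseteq> A \<and> card X = r - 1}"
              using n_subsets[OF finA] A by simp
          qed
          then have "X \<in> (\<lambda>e. e - {v}) ` touching E {v}" using h by blast
          then obtain e where e: "e \<in> touching E {v}" "X = e - {v}" by blast
          then have "insert v X = e" by (auto simp: touching_def)
          then show ?thesis using e by (simp add: touching_def)
        qed
      qed (use finV E rs A P conn short k in auto)
      show ?thesis using edges_le by (simp add: max_edges_def)
    qed
  qed
  then show ?thesis by (intro exI[of _ n0] exI[of _ q0]) (auto simp: n0_def)
qed

text \<open>One deletion lowers \<open>card V\<close> by at most \<open>q0\<close> and raises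
  \<open>\<phi>\<close> by at least 1, so \<open>q0 * \<phi> + card V\<close> never falls. Below
  \<open>n0\<close> vertices it is at most \<open>C\<close>; hence a hypergraph with
  \<open>\<phi> > \<tau>\<close> has a bounded number of vertices.\<close>

lemma upper_bound:
  fixes r s k :: nat
  assumes rs: "3 \<le> r" "r \<le> s" and k: "k = 2 * s + 2 \<or> k = 2 * s + 3"
  shows "\<exists>N. \<forall>(V :: 'a set) E. good_hypergraph r k V E \<longrightarrow> N < card V \<longrightarrow>
    card E \<le> max_edges r s k (card V)"
proof -
  define K where "K = int (s choose (r - 1))"
  obtain n0 q0 where n0: "s \<le> n0" and step: "\<And>(V :: 'a set) E. good_hypergraph r k V E \<Longrightarrow> n0 \<le> card V \<Longrightarrow>
    card E \<le> max_edges r s k (card V) \<or>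
    (\<exists>(V' :: 'a set) E'. good_hypergraph r k V' E' \<and> card V' < card V \<and> card V \<le> card V' + q0 \<and>
      card E + (s choose (r - 1)) * card V' < card E' + (s choose (r - 1)) * card V)"
    using progress[OF assms] by blast
  define \<tau> where "\<tau> = int (max_edges r s k s) - K * int s"
  define \<phi> where "\<phi> V E = int (card E) - K * int (card V)" for V :: "'a set" and E :: "'a set set"
  define C where "C = int q0 * 2 ^ n0 + int n0"
  \<comment> \<open>The subtraction in \<open>max_edges\<close> truncates; from \<open>s\<close> on
    the difference is constant, so that \<open>\<phi>\<close> can be compared with the single number
    \<open>\<tau>\<close>.\<close>
  have max: "int (max_edges r s k n) - K * int n = \<tau>" if "s \<le> n" for n
  proof -
    have "n = s + (n - s)" using that by simp
    then obtain i where "n = s + i" by blast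
    then show ?thesis by (simp add: max_edges_def \<tau>_def K_def algebra_simps)
  qed
  have main: "\<phi> V E \<le> \<tau> \<or> int q0 * \<phi> V E + int (card V) \<le> C"
    if "good_hypergraph r k V E" for V :: "'a set" and E
    using that
  proof (induction "card V" arbitrary: V E rule: less_induct)
    case less
    show ?case
    proof (cases "n0 \<le> card V")
      case False
      have "E \<subseteq> Pow V" "finite V" using less.prems by (auto simp: good_hypergraph_def)
      then have "card E \<le> 2 ^ card V" using card_mono[of "Pow V" E] by (simp add: card_Pow)
      also have "(2::nat) ^ card V \<le> 2 ^ n0" using False by (intro power_increasing) auto
      finally have "int (card E) \<le> 2 ^ n0" by (metis of_nat_le_iff of_nat_numeral of_nat_power)
      moreover have "0 \<le> K * int (card V)" by (simp add: K_def)
      ultimately have "\<phi> V E \<le> 2 ^ n0" unfolding \<phi>_def by linarith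
      then have "int q0 * \<phi> V E \<le> int q0 * 2 ^ n0" by (intro mult_left_mono) auto
      then show ?thesis using False by (auto simp: C_def)
    next
      case True
      from step[OF less.prems True] show ?thesis
      proof
        assume "card E \<le> max_edges r s k (card V)"
        then show ?thesis using max[of "card V"] True n0 by (simp add: \<phi>_def)
      next
        assume "\<exists>(V' :: 'a set) E'. good_hypergraph r k V' E' \<and> card V' < card V \<and> card V \<le> card V' + q0 \<and>
          card E + (s choose (r - 1)) * card V' < card E' + (s choose (r - 1)) * card V"
        then obtain V' :: "'a set" and E' where V': "good_hypergraph r k V' E'" "card V' < card V"
          "card V \<le> card V' + q0"
          "card E + (s choose (r - 1)) * card V' < card E' + (s choose (r - 1)) * card V" by blast
        have "int (card E + (s choose (r - 1)) * card V') < int (card E' + (s choose (r - 1)) * card V)"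
          using V'(4) by (rule iffD2[OF of_nat_less_iff])
        then have \<phi>: "\<phi> V E + 1 \<le> \<phi> V' E'" by (simp add: \<phi>_def K_def)
        have "\<phi> V' E' \<le> \<tau> \<or> int q0 * \<phi> V' E' + int (card V') \<le> C"
          by (rule less.hyps[OF V'(2,1)])
        then show ?thesis
        proof
          assume "int q0 * \<phi> V' E' + int (card V') \<le> C"
          moreover have "int q0 * (\<phi> V E + 1) \<le> int q0 * \<phi> V' E'" using \<phi> by (intro mult_left_mono) auto
          moreover have "int q0 * (\<phi> V E + 1) = int q0 * \<phi> V E + int q0" by (simp add: algebra_simps)
          ultimately show ?thesis using V'(3) by linarith
        qed (use \<phi> in linarith)
      qed
    qed
  qed
  define N where "N = nat (C - int q0 * \<tau>) + s"
  have "card E \<le> max_edges r s k (card V)"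
    if g: "good_hypergraph r k V E" and n: "N < card V" for V :: "'a set" and E
  proof -
    have big: "C - int q0 * \<tau> < int (card V)" "s \<le> card V" using n by (auto simp: N_def)
    have "\<phi> V E \<le> \<tau>"
    proof (rule ccontr)
      assume n: "\<not> ?thesis"
      then have "int q0 * \<tau> \<le> int q0 * \<phi> V E" by (intro mult_left_mono) auto
      moreover have "int q0 * \<phi> V E + int (card V) \<le> C" using main[OF g] n by blast
      ultimately show False using big by linarith
    qed
    then have "int (card E) \<le> int (max_edges r s k (card V))" using max[OF big(2)] by (simp add: \<phi>_def)
    then show ?thesis by simp
  qed
  then show ?thesis by blast
qed

section \<open>The extremal hypergraph\<close>

text \<open>Since \<open>bpath\<close> does not mention \<open>verts H\<close>, the vertices of the
  path are found there only because each of them lies in an edge of the path; this is where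
  \<open>2 \<le> k\<close> enters.\<close>

lemma bpath_imp_not_Berge_free:
  assumes H: "hypergraph H" and p: "bpath (hedges H) xs es" and k: "2 \<le> k" "k \<le> length xs"
  shows "\<not> Berge_free (path_graph k) H"
proof -
  obtain j where j: "k = Suc (Suc j)" using k by (intro that[of "k - 2"]) simp
  define ys fs where "ys = take (Suc (Suc j)) xs" and "fs = take (Suc j) es"
  have q: "bpath (hedges H) ys fs"
    unfolding ys_def fs_def using bpath_length[OF p] k j by (intro bpath_take[OF p]) simp
  have l: "length ys = k" "length fs = Suc j"
    using bpath_length[OF p] k j by (auto simp: ys_def fs_def)
  have d: "distinct ys" "distinct fs" "set fs \<subseteq> hedges H" and w: "berge_walk ys fs"
    using q by (auto simp: bpath_def)
  have step: "ys ! i \<in> fs ! i" "ys ! Suc i \<in> fs ! i" if "Suc i < k" for i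
    using berge_walk_nth[OF w, of i] that l j by auto
  have fsH: "fs ! i \<subseteq> verts H" if "Suc i < k" for i
  proof -
    have "fs ! i \<in> hedges H" using d(3) that l j nth_mem[of i fs] by auto
    then show ?thesis using H by (simp add: hypergraph_def)
  qed
  \<comment> \<open>An edge \<open>{i, Suc i}\<close> of the path graph is decoded by its minimum,
    which gives the bijection \<open>\<lambda>e. fs ! Min e\<close>.\<close>
  have Min: "Min {i, Suc i} = i" for i by simp
  let ?H' = "(verts H, set fs)"
  have "subhypergraph ?H' H"
    using H d(3) by (auto simp: subhypergraph_def hypergraph_def)
  moreover have "is_Berge (path_graph k) ?H'"
    unfolding is_Berge_def
  proof (intro exI conjI)
    show "inj_on ((!) ys) (verts (path_graph k))"
      using d(1) l by (auto simp: path_graph_def inj_on_def nth_eq_iff_index_eq)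
    show "(!) ys ` verts (path_graph k) \<subseteq> verts ?H'"
    proof
      fix x assume "x \<in> (!) ys ` verts (path_graph k)"
      then obtain i where i: "i < k" "x = ys ! i" by (auto simp: path_graph_def)
      show "x \<in> verts ?H'"
      proof (cases "Suc i < k")
        case True
        then show ?thesis using step(1) fsH i by auto
      next
        case False
        then have "i = Suc j" using i j by simp
        then show ?thesis using step(2)[of j] fsH[of j] i j by auto
      qed
    qed
    show "bij_betw (\<lambda>e. fs ! Min e) (hedges (path_graph k)) (hedges ?H')"
      unfolding bij_betw_def
    proof
      show "inj_on (\<lambda>e. fs ! Min e) (hedges (path_graph k))"
      proof (rule inj_onI)
        fix a b assume "a \<in> hedges (path_graph k)" "b \<in> hedges (path_graph k)" "fs ! Min a = fs ! Min b"
        then obtain i i' where i: "a = {i, Suc i}" "b = {i', Suc i'}" "Suc i < k" "Suc i' < k"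
            "fs ! i = fs ! i'"
          unfolding path_graph_def using Min by auto
        then have "i = i'" using d(2) l j by (simp add: nth_eq_iff_index_eq)
        then show "a = b" using i by simp
      qed
      have "hedges (path_graph k) = (\<lambda>i. {i, Suc i}) ` {..<Suc j}"
        using j by (auto simp: path_graph_def)
      then have "(\<lambda>e. fs ! Min e) ` hedges (path_graph k) = (\<lambda>i. fs ! Min {i, Suc i}) ` {..<Suc j}"
        by (simp add: image_image)
      also have "\<dots> = set fs" unfolding Min using l by (auto simp: set_conv_nth)
      finally show "(\<lambda>e. fs ! Min e) ` hedges (path_graph k) = hedges ?H'" by simp
    qed
    show "\<forall>e\<in>hedges (path_graph k). (!) ys ` e \<subseteq> fs ! Min e"
    proof
      fix e assume "e \<in> hedges (path_graph k)"
      then obtain i where i: "e = {i, Suc i}" "Suc i < k" by (auto simp: path_graph_def)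
      show "(!) ys ` e \<subseteq> fs ! Min e" unfolding i(1) Min using step[OF i(2)] by simp
    qed
  qed
  ultimately show ?thesis unfolding Berge_free_def by blast
qed

lemma connected_hypergraph_adj:
  assumes "connected_hypergraph H" "x \<in> verts H" "y \<in> verts H"
  shows "(x, y) \<in> (adj (hedges H) (verts H))\<^sup>*"
proof (rule ccontr)
  assume n: "\<not> ?thesis"
  let ?C = "component (hedges H) (verts H) x"
  have y: "y \<notin> ?C" using n by (simp add: component_def)
  have "?C \<noteq> {}" using component_self by fast
  moreover have "verts H - ?C \<noteq> {}" using y assms by blast
  moreover have "?C \<union> (verts H - ?C) = verts H" using component_subset[OF assms(2)] by blast
  moreover have "e \<inter> ?C = {} \<or> e \<inter> (verts H - ?C) = {}" if "e \<in> hedges H" for e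
    using component_closed[OF _ assms(2) that] by blast
  ultimately show False
    using assms(1) unfolding connected_hypergraph_def by (metis Diff_disjoint)
qed

lemma good_hypergraph_of_Berge_free:
  assumes "r_graph r H" "connected_hypergraph H" "Berge_free (path_graph k) H" "2 \<le> k"
  shows "good_hypergraph r k (verts H) (hedges H)"
  unfolding good_hypergraph_def
proof (intro conjI ballI allI impI)
  have h: "hypergraph H" using assms by (simp add: r_graph_def)
  show "e \<subseteq> verts H" if "e \<in> hedges H" for e using that h by (auto simp: hypergraph_def)
  show "finite (verts H)" using h by (simp add: hypergraph_def)
  show "card e = r" if "e \<in> hedges H" for e using that assms by (simp add: r_graph_def)
  show "(x, y) \<in> (adj (hedges H) (verts H))\<^sup>*" if "x \<in> verts H" "y \<in> verts H" for x y
    using connected_hypergraph_adj[OF assms(2) that] .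
  show "length xs < k" if "bpath (hedges H) xs es" for xs es
    using bpath_imp_not_Berge_free[OF h that assms(4)] assms(3) by fastforce
qed

text \<open>\<open>{..<s}\<close> is the core. For odd \<open>k\<close> one pair of outer vertices,
  \<open>s\<close> and \<open>Suc s\<close>, may share edges; a path can step between these two only
  once, so it gains just a single vertex.\<close>

definition extremal_edges :: "nat \<Rightarrow> nat \<Rightarrow> nat \<Rightarrow> nat \<Rightarrow> nat set set" where
  "extremal_edges r s k n = {X. X \<subseteq> {..<s} \<and> card X = r} \<union>
    (\<lambda>(v, X). insert v X) ` ({s..<n} \<times> {X. X \<subseteq> {..<s} \<and> card X = r - 1}) \<union>
    (if k = 2 * s + 3 then (\<lambda>X. {s, Suc s} \<union> X) ` {X. X \<subseteq> {..<s} \<and> card X = r - 2} else {})"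

lemma card_extremal_edges:
  assumes "3 \<le> r" "r \<le> s" "s + 2 \<le> n"
  shows "card (extremal_edges r s k n) = max_edges r s k n"
proof -
  let ?A = "{..<s}"
  let ?P = "\<lambda>j. {X. X \<subseteq> ?A \<and> card X = j}"
  let ?S2 = "(\<lambda>(v, X). insert v X) ` ({s..<n} \<times> ?P (r - 1))"
  let ?S3 = "(\<lambda>X. {s, Suc s} \<union> X) ` ?P (r - 2)"
  have cP: "card (?P j) = s choose j" "finite (?P j)" for j
    using n_subsets[of ?A j] by auto
  have "inj_on (\<lambda>(v, X). insert v X) ({s..<n} \<times> ?P (r - 1))"
  proof (rule inj_onI, clarify)
    fix v X w Y
    assume h: "v \<in> {s..<n}" "w \<in> {s..<n}" "X \<subseteq> ?A" "Y \<subseteq> ?A" "insert v X = insert w Y"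
    have "insert v X - ?A = {v}" "insert w Y - ?A = {w}" using h by auto
    then have "v = w" using arg_cong[OF h(5), of "\<lambda>e. e - ?A"] by (metis singleton_inject)
    moreover have "insert v X \<inter> ?A = X" "insert w Y \<inter> ?A = Y" using h(1-4) by auto
    ultimately show "v = w \<and> X = Y" using arg_cong[OF h(5), of "\<lambda>e. e \<inter> ?A"] by metis
  qed
  then have c2: "card ?S2 = (n - s) * (s choose (r - 1))"
    by (simp add: card_image card_cartesian_product cP)
  have "inj_on (\<lambda>X. {s, Suc s} \<union> X) (?P (r - 2))"
  proof (rule inj_onI)
    fix X Y assume h: "X \<in> ?P (r - 2)" "Y \<in> ?P (r - 2)" "{s, Suc s} \<union> X = {s, Suc s} \<union> Y"
    have "({s, Suc s} \<union> X) \<inter> ?A = X" "({s, Suc s} \<union> Y) \<inter> ?A = Y" using h(1,2) by auto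
    then show "X = Y" using arg_cong[OF h(3), of "\<lambda>e. e \<inter> ?A"] by metis
  qed
  then have c3: "card ?S3 = s choose (r - 2)" by (simp add: card_image cP)
  have fin: "finite ?S2" "finite ?S3" using cP by simp_all
  \<comment> \<open>The three kinds of edges are told apart by their vertices outside the core:
    none, one, or \<open>s\<close> and \<open>Suc s\<close>.\<close>
  have o1: "e - ?A = {}" if "e \<in> ?P r" for e using that by auto
  have o2: "\<exists>v. e - ?A = {v}" if h: "e \<in> ?S2" for e
  proof -
    obtain v X where "v \<in> {s..<n}" "X \<subseteq> ?A" "e = insert v X" using h by auto
    then have "e - ?A = {v}" by auto
    then show ?thesis ..
  qed
  have o3: "e - ?A = {s, Suc s}" if "e \<in> ?S3" for e using that by auto
  have d12: "?P r \<inter> ?S2 = {}" using o1 o2 by (metis (no_types, lifting) disjoint_iff empty_not_insert)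
  have d3: "(?P r \<union> ?S2) \<inter> ?S3 = {}"
  proof (rule equals0I)
    fix e assume e: "e \<in> (?P r \<union> ?S2) \<inter> ?S3"
    from e have "e - ?A = {s, Suc s}" by (intro o3) (rule IntD2)
    moreover from e have "e \<in> ?P r \<or> e \<in> ?S2" by (simp only: Int_iff Un_iff)
    then have "e - ?A = {} \<or> (\<exists>v. e - ?A = {v})" using o1[of e] o2[of e] by argo
    ultimately show False by auto
  qed
  have c12: "card (?P r \<union> ?S2) = (s choose r) + (n - s) * (s choose (r - 1))"
    using card_Un_disjoint[OF cP(2) fin(1) d12] c2 cP by simp
  have c123: "card (?P r \<union> ?S2 \<union> ?S3) = (s choose r) + (n - s) * (s choose (r - 1)) + (s choose (r - 2))"
    using card_Un_disjoint[OF _ fin(2) d3] c12 c3 cP fin by simp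
  show ?thesis
  proof (cases "k = 2 * s + 3")
    case True
    then show ?thesis using c123 by (simp add: extremal_edges_def max_edges_def)
  next
    case False
    then show ?thesis using c12 by (simp add: extremal_edges_def max_edges_def)
  qed
qed

lemma extremal_edges_uniform:
  assumes "3 \<le> r" "r \<le> s" "s + 2 \<le> n" "e \<in> extremal_edges r s k n"
  shows "e \<subseteq> {..<n}" "card e = r"
    "(\<exists>v. e - {..<s} \<subseteq> {v}) \<or> (k = 2 * s + 3 \<and> e - {..<s} = {s, Suc s})"
proof -
  consider (1) "e \<subseteq> {..<s}" "card e = r"
    | (2) v X where "v \<in> {s..<n}" "X \<subseteq> {..<s}" "card X = r - 1" "e = insert v X"
    | (3) X where "k = 2 * s + 3" "X \<subseteq> {..<s}" "card X = r - 2" "e = {s, Suc s} \<union> X"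
    using assms(4) unfolding extremal_edges_def by (auto split: if_splits)
  then have "e \<subseteq> {..<n} \<and> card e = r \<and>
    ((\<exists>v. e - {..<s} \<subseteq> {v}) \<or> (k = 2 * s + 3 \<and> e - {..<s} = {s, Suc s}))"
  proof cases
    case 1
    then show ?thesis using assms by auto
  next
    case 2
    have "v \<notin> X" "finite X" using 2 finite_subset by fastforce+
    then have "card e = r" using 2 assms by (simp add: card_insert_if)
    moreover have "e \<subseteq> {..<n}" "e - {..<s} \<subseteq> {v}" using 2 assms by auto
    ultimately show ?thesis by blast
  next
    case 3
    have X: "s \<notin> X" "Suc s \<notin> X" "finite X" using 3 finite_subset by fastforce+
    then have "card e = r" using 3 assms by (simp add: card_insert_if)
    moreover have "e \<subseteq> {..<n}" "e - {..<s} = {s, Suc s}" using 3 assms by auto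
    ultimately show ?thesis using 3 by blast
  qed
  then show "e \<subseteq> {..<n}" "card e = r"
    "(\<exists>v. e - {..<s} \<subseteq> {v}) \<or> (k = 2 * s + 3 \<and> e - {..<s} = {s, Suc s})" by blast+
qed

lemma extremal_connected:
  assumes rs: "3 \<le> r" "r \<le> s" "s + 2 \<le> n"
  shows "connected_hypergraph ({..<n}, extremal_edges r s k n)"
  unfolding connected_hypergraph_def
proof (rule notI, elim exE conjE)
  fix C D assume CD: "C \<noteq> {}" "D \<noteq> {}" "C \<inter> D = {}" "C \<union> D = verts ({..<n}, extremal_edges r s k n)"
    and no: "\<forall>e\<in>hedges ({..<n}, extremal_edges r s k n). e \<inter> C = {} \<or> e \<inter> D = {}"
  \<comment> \<open>Any outer vertex shares an edge with any core vertex, so both lie on the same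
    side of a partition.\<close>
  have same: "v \<in> C \<longleftrightarrow> a \<in> C" if v: "v \<in> {s..<n}" and a: "a < s" for v a
  proof -
    have "r - 2 \<le> card ({..<s} - {a})" using a rs by (simp add: card_Diff_singleton_if)
    then obtain Z where Z: "Z \<subseteq> {..<s} - {a}" "card Z = r - 2" "finite Z"
      using obtain_subset_with_card_n by metis
    have "a \<notin> Z" using Z by blast
    then have "card (insert a Z) = r - 1" using Z rs by (simp add: card_insert_if)
    moreover have "insert a Z \<subseteq> {..<s}" using Z a by auto
    ultimately have mem: "insert v (insert a Z) \<in> extremal_edges r s k n"
      using v unfolding extremal_edges_def by (auto intro!: image_eqI[of _ _ "(v, insert a Z)"])
    have "insert v (insert a Z) \<inter> C = {} \<or> insert v (insert a Z) \<inter> D = {}"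
      using bspec[OF no[unfolded snd_conv] mem] .
    moreover have "v \<in> C \<union> D" "a \<in> C \<union> D" using v a CD(4) rs by auto
    ultimately show ?thesis using CD(3) by blast
  qed
  have all: "u \<in> C \<longleftrightarrow> 0 \<in> C" if "u < n" for u
  proof (cases "u < s")
    case True
    then show ?thesis using same[of s u] same[of s 0] rs by simp
  next
    case False
    then show ?thesis using same[of u 0] rs that by simp
  qed
  obtain x y where xy: "x \<in> C" "y \<in> D" using CD by blast
  have "x \<in> C \<union> D" "y \<in> C \<union> D" using xy by blast+
  then have "x < n" "y < n" unfolding CD(4) by simp_all
  then show False using all[of x] all[of y] xy CD(3) by blast
qed

text \<open>The first \<open>2 * s + 2\<close> places of a path split into \<open>s + 1\<close>
  pairs of neighbours, and there are only \<open>s\<close> core vertices, so one pair lies outside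
  the core. For odd \<open>k\<close> the pairs shifted by one place give a second such pair; both
  would have to be \<open>{s, Suc s}\<close>, but their starting places differ in parity.\<close>

lemma extremal_Berge_free:
  assumes rs: "3 \<le> r" "r \<le> s" "s + 2 \<le> n" and k: "k = 2 * s + 2 \<or> k = 2 * s + 3"
  shows "Berge_free (path_graph k) ({..<n}, extremal_edges r s k n)"
proof (rule ccontr)
  assume "\<not> ?thesis"
  then obtain H' :: "nat hypergraph" where H': "hedges H' \<subseteq> extremal_edges r s k n" "is_Berge (path_graph k) H'"
    unfolding Berge_free_def subhypergraph_def by auto
  then obtain f \<phi> where f: "inj_on f {..<k}"
    and \<phi>: "bij_betw \<phi> (hedges (path_graph k)) (hedges H')" "\<forall>e\<in>hedges (path_graph k). f ` e \<subseteq> \<phi> e"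
    unfolding is_Berge_def by (auto simp: path_graph_def)
  have bad: "k = 2 * s + 3 \<and> {f i, f (Suc i)} = {s, Suc s}"
    if i: "Suc i < k" and out: "\<not> f i < s" "\<not> f (Suc i) < s" for i
  proof -
    have e: "{i, Suc i} \<in> hedges (path_graph k)" using i by (auto simp: path_graph_def)
    define g where "g = \<phi> {i, Suc i}"
    have g: "g \<in> extremal_edges r s k n" using \<phi>(1) e H'(1) by (auto simp: bij_betw_def g_def)
    have "{f i, f (Suc i)} \<subseteq> g" using \<phi>(2) e by (auto simp: g_def)
    then have sub: "{f i, f (Suc i)} \<subseteq> g - {..<s}" using out by auto
    have ne: "f i \<noteq> f (Suc i)" using inj_onD[OF f, of i "Suc i"] i by auto
    have "\<not> (\<exists>v. g - {..<s} \<subseteq> {v})" using sub ne by blast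
    then have "k = 2 * s + 3" "g - {..<s} = {s, Suc s}" using extremal_edges_uniform(3)[OF rs g] by blast+
    then show ?thesis using sub ne by auto
  qed
  have hit: "\<exists>j\<le>s. \<not> f (2 * j + d) < s \<and> \<not> f (Suc (2 * j + d)) < s" if d: "Suc (2 * s + d) < k" for d
  proof (rule ccontr)
    assume n: "\<not> ?thesis"
    \<comment> \<open>\<open>h j\<close> is the place of a core vertex in the \<open>j\<close>-th
      pair; subtracting \<open>d\<close> and halving recovers \<open>j\<close>.\<close>
    define h where "h j = (if f (2 * j + d) < s then 2 * j + d else Suc (2 * j + d))" for j
    have "inj_on (\<lambda>j. f (h j)) {..s}"
    proof (rule inj_onI)
      fix i j assume ij: "i \<in> {..s}" "j \<in> {..s}" "f (h i) = f (h j)"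
      have "h i < k" "h j < k" using ij d by (auto simp: h_def)
      then have "h i = h j" using f ij(3) by (auto simp: inj_on_def)
      then have "(h i - d) div 2 = (h j - d) div 2" by (rule arg_cong)
      moreover have "(h i - d) div 2 = i" "(h j - d) div 2 = j" by (auto simp: h_def)
      ultimately show "i = j" by simp
    qed
    moreover have "(\<lambda>j. f (h j)) ` {..s} \<subseteq> {..<s}" using n by (auto simp: h_def)
    ultimately have "card {..s} \<le> card {..<s}" by (intro card_inj_on_le) auto
    then show False by simp
  qed
  have "Suc (2 * s + 0) < k" using k by auto
  from hit[OF this] obtain i where i: "i \<le> s" "\<not> f (2 * i) < s" "\<not> f (Suc (2 * i)) < s" by auto
  have "Suc (2 * i) < k" using i k by auto
  from bad[OF this i(2,3)] have k3: "k = 2 * s + 3" and fi: "{f (2 * i), f (Suc (2 * i))} = {s, Suc s}" by auto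
  have "Suc (2 * s + 1) < k" using k3 by auto
  from hit[OF this] obtain j where j: "j \<le> s" "\<not> f (2 * j + 1) < s" "\<not> f (Suc (2 * j + 1)) < s" by auto
  have "Suc (2 * j + 1) < k" using j k3 by auto
  from bad[OF this j(2,3)] have "{f (2 * j + 1), f (Suc (2 * j + 1))} = {s, Suc s}" by auto
  with fi have "f ` {2 * i, Suc (2 * i)} = f ` {2 * j + 1, Suc (2 * j + 1)}" by simp
  then have "{2 * i, Suc (2 * i)} = {2 * j + 1, Suc (2 * j + 1)}"
    by (rule iffD1[OF inj_on_image_eq_iff[OF f], rotated 2]) (use i j k3 in auto)
  then have "2 * i = 2 * j + 1 \<or> (2 * i = Suc (2 * j + 1) \<and> Suc (2 * i) = 2 * j + 1)"
    by (simp only: doubleton_eq_iff) arith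
  then show False by presburger
qed

lemma ex_conn_eq:
  fixes r s k :: nat
  assumes rs: "3 \<le> r" "r \<le> s" and k: "k = 2 * s + 2 \<or> k = 2 * s + 3"
  shows "\<exists>N. \<forall>n>N. s + 2 \<le> n \<and> ex_conn r n (path_graph k) = max_edges r s k n"
proof -
  obtain N where N: "\<And>(V :: nat set) E. good_hypergraph r k V E \<Longrightarrow> N < card V \<Longrightarrow>
      card E \<le> max_edges r s k (card V)"
    using upper_bound[OF assms] by blast
  have "ex_conn r n (path_graph k) = max_edges r s k n" if n: "N + s + 2 < n" for n
  proof -
    let ?S = "{card (hedges H) | H :: nat hypergraph.
      r_graph r H \<and> card (verts H) = n \<and> connected_hypergraph H \<and> Berge_free (path_graph k) H}"
    have le: "c \<le> max_edges r s k n" if "c \<in> ?S" for c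
    proof -
      obtain H :: "nat hypergraph" where H: "c = card (hedges H)" "r_graph r H" "card (verts H) = n"
          "connected_hypergraph H" "Berge_free (path_graph k) H"
        using \<open>c \<in> ?S\<close> by blast
      have "good_hypergraph r k (verts H) (hedges H)"
        using H k by (intro good_hypergraph_of_Berge_free) auto
      then show ?thesis using N[of "verts H" "hedges H"] H n by simp
    qed
    let ?H = "({..<n}, extremal_edges r s k n)"
    have n2: "s + 2 \<le> n" using n by simp
    have "r_graph r ?H"
      using extremal_edges_uniform(1,2)[OF rs n2] by (simp add: r_graph_def hypergraph_def)
    then have "card (hedges ?H) \<in> ?S"
      using extremal_connected[OF rs n2] extremal_Berge_free[OF rs n2 k]
      by (intro CollectI exI[of _ ?H]) simp
    then have mem: "max_edges r s k n \<in> ?S" using card_extremal_edges[OF rs n2] by simp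
    have "finite ?S" using le by (intro finite_subset[of ?S "{..max_edges r s k n}"]) auto
    then show ?thesis unfolding ex_conn_def using le mem by (intro Max_eqI)
  qed
  then show ?thesis by (intro exI[of _ "N + s + 2"]) auto
qed

theorem theorem1p8:
  fixes r k :: nat
  assumes "k \<ge> 2 * r + 2" and "2 * r + 2 \<ge> 8"
  shows "\<exists>N::nat. \<forall>n>N.
    int (ex_conn r n (path_graph k)) =
      int ((nat \<lfloor>real k / 2\<rfloor> - 1) choose (r - 1)) * (int n - \<lceil>real k / 2\<rceil>)
      + int (nat \<lceil>real k / 2\<rceil> choose r)"
proof -
  define s where "s = k div 2 - 1"
  have rs: "3 \<le> r" "r \<le> s" using assms by (auto simp: s_def)
  have k: "k = 2 * s + 2 \<or> k = 2 * s + 3" using assms unfolding s_def by linarith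
  obtain N where N: "\<And>n. N < n \<Longrightarrow> s + 2 \<le> n \<and> ex_conn r n (path_graph k) = max_edges r s k n"
    using ex_conn_eq[OF rs k] by blast
  have fl: "nat \<lfloor>real k / 2\<rfloor> - 1 = s"
  proof -
    have "\<lfloor>real k / 2\<rfloor> = int s + 1" using k by (intro floor_unique) auto
    then show ?thesis by simp
  qed
  obtain q where r: "r = Suc (Suc q)" using rs by (intro that[of "r - 2"]) simp
  \<comment> \<open>The ceiling is \<open>s + 1\<close> for even and \<open>s + 2\<close> for odd
    \<open>k\<close>. Pascal's rule, applied once or twice, matches the closed formula with
    \<open>max_edges\<close>; the summand \<open>s choose (r - 2)\<close> appears only in the second
    case.\<close>
  have "int (max_edges r s k n) =
      int (s choose (r - 1)) * (int n - \<lceil>real k / 2\<rceil>) + int (nat \<lceil>real k / 2\<rceil> choose r)"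
    if n: "s + 2 \<le> n" for n
  proof -
    obtain i where n: "n = s + i" using n le_Suc_ex add_leD1 by blast
    from k show ?thesis
    proof
      assume k: "k = 2 * s + 2"
      have c: "\<lceil>real k / 2\<rceil> = int (Suc s)" using k by (intro ceiling_unique) auto
      moreover have "Suc s choose r = (s choose Suc q) + (s choose r)" using r by simp
      moreover have "max_edges r s k n = (s choose Suc q) * i + (s choose r)"
        using k n r by (simp add: max_edges_def)
      ultimately show ?thesis unfolding c nat_int using n r by (simp add: algebra_simps del: binomial_Suc_Suc)
    next
      assume k: "k = 2 * s + 3"
      have c: "\<lceil>real k / 2\<rceil> = int (Suc (Suc s))" using k by (intro ceiling_unique) auto
      moreover have "Suc (Suc s) choose r = (s choose q) + 2 * (s choose Suc q) + (s choose r)"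
        using r by simp
      moreover have "max_edges r s k n = (s choose Suc q) * i + (s choose r) + (s choose q)"
        using k n r by (simp add: max_edges_def)
      ultimately show ?thesis unfolding c nat_int using n r by (simp add: algebra_simps del: binomial_Suc_Suc)
    qed
  qed
  then show ?thesis using N fl by metis
qed

end
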